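(* Let $\mathcal S$ be a triangulated category with a very good metric $\{\mathcal M_i,\ i\in\mathbb N\}$ such that each $\mathcal M_i$ is closed in $\mathcal S$ under direct summands, and let $F:\mathcal S\to\mathcal T$ be a good extension with respect to the metric. Then $\mathfrak L'(\mathcal S)$ is a triangulated subcategory of $\mathcal T$. Moreover, suppose we are given: (i) a morphism $\varphi:A\to B$ in $\mathfrak L'(\mathcal S)$; (ii) Cauchy sequences $a_*,b_*$ in $\mathcal S$ and isomorphisms $A\cong\mathrm{Hocolim}\,F(a_* )$, $B\cong\mathrm{Hocolim}\,F(b_* )$; write $\alpha:F(a_* )\to A$ and $\beta:F(b_* )\to B$ for the induced maps in $\mathcal T$ from the sequences to $A$ and $B$; (iii) (after passing to subsequences of $a_*$ and $b_*$, which is always possible) a map of Cauchy sequences $\varphi_*:a_*\to b_*$ with $\mathrm{colim}\,Y(\varphi_* )=\mathcal Y(\varphi)$. Let $A\xrightarrow{\varphi}B\to C\to\Sigma A$ be a distinguished triangle in $\mathcal T$. Then, after passing to subsequences, $\varphi_*$ may be completed in $\mathcal S$ to a Cauchy sequence of triangles $a_*\xrightarrow{\varphi_*}b_*\to c_*\to\Sigma a_*$ in such a way that: (iv) the commutative square formed by $F(\varphi_* ):F(a_* )\to F(b_* )$, $\alpha$, $\beta$ and $\varphi$ extends in $\mathcal T$ to a commutative diagram $$\begin{array}{ccccccc}F(a_* )&\xrightarrow{F(\varphi_* )}&F(b_* )&\to&F(c_* )&\to&\Sigma F(a_* )\\ {\scriptstyle\alpha}\downarrow&&{\scriptstyle\beta}\downarrow&&{\scriptstyle\gamma}\downarrow&&{\scriptstyle\Sigma\alpha}\downarrow\\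 A&\xrightarrow{\varphi}&B&\to&C&\to&\Sigma A\end{array}$$ (v) there is an isomorphism $\mathrm{Hocolim}\,F(c_* )\to C$ in $\mathcal T$ which exhibits the sequence $\mathcal Y(A)\xrightarrow{\mathcal Y(\varphi)}\mathcal Y(B)\to\mathcal Y(C)\to\Sigma\mathcal Y(A)$ as naturally isomorphic to the strong triangle obtained as the colimit in $\mathrm{Mod}\text{-}\mathcal S$ of the sequence $Y(a_* )\xrightarrow{Y(\varphi_* )}Y(b_* )\to Y(c_* )\to\Sigma Y(a_* )$.
   Context: Conventions: subcategories are full; $\Sigma$ is the shift; $\mathcal A*\mathcal B$ is the class of $b$ admitting a distinguished triangle $a\to b\to c\to\Sigma a$ with $a\in\mathcal A,c\in\mathcal B$; ${}^\perp\mathcal A=\{b:\mathrm{Hom}(b,a)=0\ \forall a\in\mathcal A\}$. Good metric on a triangulated category $\mathcal S$: full subcategories $\{\mathcal M_i,\ i\in\mathbb N\}$ with $0\in\mathcal M_i$, $\Sigma^{-1}\mathcal M_{i+1}\cup\mathcal M_{i+1}\cup\Sigma\mathcal M_{i+1}\subset\mathcal M_i$ and $\mathcal M_i*\mathcal M_i\subset\mathcal M_i$. It is very good if in addition (a) $\mathcal S=\bigcup_i{}^\perp\mathcal M_i$ and (b) for every $m\in\mathbb N$ there is $n>m$ such that every $F\in\mathcal S$ admits a distinguished triangle $E\to F\to D\to\Sigma E$ in $\mathcal S$ with $E\in{}^\perp\mathcal M_n$ and $D\in\mathcal M_m$. A sequence $E_1\to E_2\to\cdots$ in $\mathcal S$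 is Cauchy if for every $i$ there is $N$ such that for all $k>j\ge N$ the cone of $E_j\to E_k$ lies in $\mathcal M_i$. A Cauchy sequence of triangles is a sequence $a_*\to b_*\to c_*\to\Sigma a_*$ of distinguished triangles and maps of triangles, with $a_*,b_*,c_*$ Cauchy. $\mathrm{Mod}\text{-}\mathcal S$ is the category of additive functors $\mathcal S^{op}\to\mathrm{Ab}$, $Y$ the Yoneda embedding, $\Sigma$ extended so that $Y\Sigma=\Sigma Y$. A strong triangle is a sequence in $\mathrm{Mod}\text{-}\mathcal S$ isomorphic to the colimit of the image under $Y$ of a Cauchy sequence of triangles. Let $F:\mathcal S\to\mathcal T$ be a fully faithful triangulated functor; $\mathcal Y:\mathcal T\to\mathrm{Mod}\text{-}\mathcal S$ is $\mathcal Y(t)=\mathrm{Hom}_{\mathcal T}(F(-),t)$, so $\mathcal Y F\cong Y$. $F$ is a good extension with respect to the metric if for every Cauchy sequence $a_*$ in $\mathcal S$ the coproduct $\coprod_iF(a_i)$ exists in $\mathcal T$, and the natural map $\mathrm{colim}\,Y(a_* )\to\mathcal Y\big(\mathrm{Hocolim}\,F(a_* )\big)$ is an isomorphism, where $\mathrm{Hocolim}\,F(a_* )$ is the third object of a distinguished triangle on $\mathrm{id}-\mathrm{shift}:\coprod_iF(a_i)\to\coprod_iF(a_i)$. $\mathfrak L'(\mathcal S)\subset\mathcal T$ is the full subcategory of objects isomorphic to $\mathrm{Hocolim}\,F(a_* )$ for some Cauchy sequence $a_*$ in $\mathcal S$. *)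

theory Defs
  imports "HOL-Algebra.Group"
begin

section \<open>Additive categories\<close>

text \<open>Categories are given by their objects and arrows; every arrow knows its domain and
  codomain. The category-theoretic hom-sets are called \<open>Hom\<close>; the library's \<open>hom\<close> and \<open>iso\<close>
  are homomorphisms and isomorphisms of groups.\<close>

record ('o, 'm) cat =
  Obj :: "'o set"
  Arr :: "'m set"
  Dom :: "'m \<Rightarrow> 'o"
  Cod :: "'m \<Rightarrow> 'o"
  Ident :: "'o \<Rightarrow> 'm"
  Comp :: "'m \<Rightarrow> 'm \<Rightarrow> 'm"  (infixr \<open>\<cdot>\<index>\<close> 70)

definition Hom :: "('o, 'm, 'z) cat_scheme \<Rightarrow> 'o \<Rightarrow> 'o \<Rightarrow> 'm set" where
  "Hom C a b = {f \<in> Arr C. Dom C f = a \<and> Cod C f = b}"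

locale category =
  fixes C (structure)
  assumes Dom_closed: "f \<in> Arr C \<Longrightarrow> Dom C f \<in> Obj C"
    and Cod_closed: "f \<in> Arr C \<Longrightarrow> Cod C f \<in> Obj C"
    and Ident_Hom: "a \<in> Obj C \<Longrightarrow> Ident C a \<in> Hom C a a"
    and Comp_Hom: "\<lbrakk>f \<in> Hom C a b; g \<in> Hom C b c\<rbrakk> \<Longrightarrow> g \<cdot> f \<in> Hom C a c"
    and Comp_Ident: "f \<in> Hom C a b \<Longrightarrow> f \<cdot> Ident C a = f"
    and Ident_Comp: "f \<in> Hom C a b \<Longrightarrow> Ident C b \<cdot> f = f"
    and Comp_assoc:
      "\<lbrakk>f \<in> Hom C a b; g \<in> Hom C b c; h \<in> Hom C c d\<rbrakk> \<Longrightarrow> (h \<cdot> g) \<cdot> f = h \<cdot> (g \<cdot> f)"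

definition is_iso_mor :: "('o, 'm, 'z) cat_scheme \<Rightarrow> 'm \<Rightarrow> 'o \<Rightarrow> 'o \<Rightarrow> bool" where
  "is_iso_mor C f a b \<longleftrightarrow>
     f \<in> Hom C a b \<and> (\<exists>g \<in> Hom C b a. g \<cdot>\<^bsub>C\<^esub> f = Ident C a \<and> f \<cdot>\<^bsub>C\<^esub> g = Ident C b)"

record ('o, 'm) ab_cat = "('o, 'm) cat" +
  Plus :: "'m \<Rightarrow> 'm \<Rightarrow> 'm"
  Zero :: "'o \<Rightarrow> 'o \<Rightarrow> 'm"

definition Hom_group :: "('o, 'm, 'z) ab_cat_scheme \<Rightarrow> 'o \<Rightarrow> 'o \<Rightarrow> 'm monoid" where
  "Hom_group C a b = \<lparr>carrier = Hom C a b, mult = Plus C, one = Zero C a b\<rparr>"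

definition Neg :: "('o, 'm, 'z) ab_cat_scheme \<Rightarrow> 'm \<Rightarrow> 'm" where
  "Neg C f = inv\<^bsub>Hom_group C (Dom C f) (Cod C f)\<^esub> f"

definition is_zero_object :: "('o, 'm, 'z) ab_cat_scheme \<Rightarrow> 'o \<Rightarrow> bool" where
  "is_zero_object C z \<longleftrightarrow>
     z \<in> Obj C \<and> (\<forall>a \<in> Obj C. (\<exists>!f. f \<in> Hom C z a) \<and> (\<exists>!f. f \<in> Hom C a z))"

definition is_biproduct :: "('o, 'm, 'z) ab_cat_scheme \<Rightarrow> 'o \<Rightarrow> 'o \<Rightarrow> 'o \<Rightarrow> bool" where
  "is_biproduct C s a b \<longleftrightarrow>
     (\<exists>i \<in> Hom C a s. \<exists>j \<in> Hom C b s. \<exists>p \<in> Hom C s a. \<exists>q \<in> Hom C s b.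
        p \<cdot>\<^bsub>C\<^esub> i = Ident C a \<and> q \<cdot>\<^bsub>C\<^esub> j = Ident C b \<and>
        p \<cdot>\<^bsub>C\<^esub> j = Zero C b a \<and> q \<cdot>\<^bsub>C\<^esub> i = Zero C a b \<and>
        Plus C (i \<cdot>\<^bsub>C\<^esub> p) (j \<cdot>\<^bsub>C\<^esub> q) = Ident C s)"

locale additive_category = category C for C :: "('o, 'm, 'z) ab_cat_scheme" (structure) +
  assumes Hom_comm_group:
      "\<lbrakk>a \<in> Obj C; b \<in> Obj C\<rbrakk> \<Longrightarrow> comm_group (Hom_group C a b)"
    and Comp_Plus: "\<lbrakk>f \<in> Hom C a b; g \<in> Hom C b c; g' \<in> Hom C b c\<rbrakk>
      \<Longrightarrow> Plus C g g' \<cdot> f = Plus C (g \<cdot> f) (g' \<cdot> f)"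
    and Plus_Comp: "\<lbrakk>f \<in> Hom C a b; f' \<in> Hom C a b; g \<in> Hom C b c\<rbrakk>
      \<Longrightarrow> g \<cdot> Plus C f f' = Plus C (g \<cdot> f) (g \<cdot> f')"
    and ex_zero_object: "\<exists>z. is_zero_object C z"
    and ex_biproduct: "\<lbrakk>a \<in> Obj C; b \<in> Obj C\<rbrakk> \<Longrightarrow> \<exists>s \<in> Obj C. is_biproduct C s a b"
begin

lemma Plus_closed: "\<lbrakk>f \<in> Hom C a b; g \<in> Hom C a b\<rbrakk> \<Longrightarrow> Plus C f g \<in> Hom C a b"
  using monoid.m_closed[of "Hom_group C a b" f g] Hom_comm_group[of a b]
    Dom_closed[of f] Cod_closed[of f]
  by (auto simp: Hom_group_def Hom_def comm_group_def group_def)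

end


section \<open>Triangulated categories\<close>

text \<open>The shift is an invertible functor (an automorphism, not merely an autoequivalence).
  A triangle \<open>a \<rightarrow> b \<rightarrow> c \<rightarrow> \<Sigma>a\<close> is recorded by its three arrows.\<close>

record ('o, 'm) tri_cat = "('o, 'm) ab_cat" +
  ShO :: "'o \<Rightarrow> 'o"
  ShM :: "'m \<Rightarrow> 'm"
  Dist :: "'m \<Rightarrow> 'm \<Rightarrow> 'm \<Rightarrow> bool"

definition UnshO :: "('o, 'm, 'z) tri_cat_scheme \<Rightarrow> 'o \<Rightarrow> 'o" where
  "UnshO C = inv_into (Obj C) (ShO C)"

definition UnshM :: "('o, 'm, 'z) tri_cat_scheme \<Rightarrow> 'm \<Rightarrow> 'm" where
  "UnshM C = inv_into (Arr C) (ShM C)"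

locale triangulated_category = additive_category C
  for C :: "('o, 'm, 'z) tri_cat_scheme" (structure) +
  assumes ShO_bij: "bij_betw (ShO C) (Obj C) (Obj C)"
    and ShM_bij: "bij_betw (ShM C) (Arr C) (Arr C)"
    and ShM_Hom: "f \<in> Hom C a b \<Longrightarrow> ShM C f \<in> Hom C (ShO C a) (ShO C b)"
    and ShM_Ident: "a \<in> Obj C \<Longrightarrow> ShM C (Ident C a) = Ident C (ShO C a)"
    and ShM_Comp: "\<lbrakk>f \<in> Hom C a b; g \<in> Hom C b c\<rbrakk> \<Longrightarrow> ShM C (g \<cdot> f) = ShM C g \<cdot> ShM C f"
    and ShM_Plus: "\<lbrakk>f \<in> Hom C a b; g \<in> Hom C a b\<rbrakk>
      \<Longrightarrow> ShM C (Plus C f g) = Plus C (ShM C f) (ShM C g)"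
    and Dist_typed: "Dist C f g h \<Longrightarrow>
      \<exists>a b c. f \<in> Hom C a b \<and> g \<in> Hom C b c \<and> h \<in> Hom C c (ShO C a)"
    and TR1_iso: "\<lbrakk>Dist C f g h; f \<in> Hom C a b; g \<in> Hom C b c; h \<in> Hom C c (ShO C a);
      f' \<in> Hom C a' b'; g' \<in> Hom C b' c'; h' \<in> Hom C c' (ShO C a');
      is_iso_mor C u a a'; is_iso_mor C v b b'; is_iso_mor C w c c';
      f' \<cdot> u = v \<cdot> f; g' \<cdot> v = w \<cdot> g; h' \<cdot> w = ShM C u \<cdot> h\<rbrakk> \<Longrightarrow> Dist C f' g' h'"
    and TR1_Ident: "\<lbrakk>a \<in> Obj C; is_zero_object C z\<rbrakk>
      \<Longrightarrow> Dist C (Ident C a) (Zero C a z) (Zero C z (ShO C a))"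
    and TR1_cone: "f \<in> Arr C \<Longrightarrow> \<exists>g h. Dist C f g h"
    and TR2: "\<lbrakk>f \<in> Hom C a b; g \<in> Hom C b c; h \<in> Hom C c (ShO C a)\<rbrakk>
      \<Longrightarrow> Dist C f g h \<longleftrightarrow> Dist C g h (Neg C (ShM C f))"
    and TR3: "\<lbrakk>Dist C f g h; f \<in> Hom C a b; g \<in> Hom C b c; h \<in> Hom C c (ShO C a);
      Dist C f' g' h'; f' \<in> Hom C a' b'; g' \<in> Hom C b' c'; h' \<in> Hom C c' (ShO C a');
      u \<in> Hom C a a'; v \<in> Hom C b b'; f' \<cdot> u = v \<cdot> f\<rbrakk>
      \<Longrightarrow> \<exists>w \<in> Hom C c c'. g' \<cdot> v = w \<cdot> g \<and> h' \<cdot> w = ShM C u \<cdot> h"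
    and TR4: "\<lbrakk>f \<in> Hom C a b; g \<in> Hom C b c;
      Dist C f f' f''; f' \<in> Hom C b x; f'' \<in> Hom C x (ShO C a);
      Dist C (g \<cdot> f) h' h''; h' \<in> Hom C c y; h'' \<in> Hom C y (ShO C a);
      Dist C g g' g''; g' \<in> Hom C c z; g'' \<in> Hom C z (ShO C b)\<rbrakk>
      \<Longrightarrow> \<exists>u \<in> Hom C x y. \<exists>v \<in> Hom C y z. Dist C u v (ShM C f' \<cdot> g'') \<and>
            u \<cdot> f' = h' \<cdot> g \<and> h'' \<cdot> u = f'' \<and> v \<cdot> h' = g' \<and> g'' \<cdot> v = ShM C f \<cdot> h''"

text \<open>Full subcategories are identified with their sets of objects.\<close>

definition triangulated_subcategory :: "('o, 'm, 'z) tri_cat_scheme \<Rightarrow> 'o set \<Rightarrow> bool" where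
  "triangulated_subcategory C X \<longleftrightarrow>
     X \<subseteq> Obj C \<and>
     (\<exists>z \<in> X. is_zero_object C z) \<and>
     (\<forall>a \<in> X. \<forall>b \<in> X. \<forall>s. is_biproduct C s a b \<longrightarrow> s \<in> X) \<and>
     (\<forall>a \<in> X. \<forall>b f. is_iso_mor C f a b \<longrightarrow> b \<in> X) \<and>
     ShO C ` X = X \<and>
     (\<forall>f g h. Dist C f g h \<and> Dom C f \<in> X \<and> Cod C f \<in> X \<longrightarrow> Cod C g \<in> X)"

definition closed_under_summands :: "('o, 'm, 'z) ab_cat_scheme \<Rightarrow> 'o set \<Rightarrow> bool" where
  "closed_under_summands C X \<longleftrightarrow>
     (\<forall>s a b. is_biproduct C s a b \<and> a \<in> Obj C \<and> b \<in> Obj C \<and> s \<in> X \<longrightarrow> a \<in> X)"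

text \<open>In a triangulated functor, \<open>fsh x : F(\<Sigma>x) \<rightarrow> \<Sigma>F(x)\<close> is the natural isomorphism that is
  part of the data.\<close>

record ('o, 'm, 'p, 'n) tri_fun =
  fob :: "'o \<Rightarrow> 'p"
  fmor :: "'m \<Rightarrow> 'n"
  fsh :: "'o \<Rightarrow> 'n"

definition triangulated_functor ::
  "('o, 'm, 'y) tri_cat_scheme \<Rightarrow> ('p, 'n, 'z) tri_cat_scheme \<Rightarrow> ('o, 'm, 'p, 'n) tri_fun \<Rightarrow> bool"
  where
  "triangulated_functor S T F \<longleftrightarrow>
     (\<forall>a \<in> Obj S. fob F a \<in> Obj T) \<and>
     (\<forall>a b. \<forall>f \<in> Hom S a b. fmor F f \<in> Hom T (fob F a) (fob F b)) \<and>
     (\<forall>a \<in> Obj S. fmor F (Ident S a) = Ident T (fob F a)) \<and>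
     (\<forall>a b c. \<forall>f \<in> Hom S a b. \<forall>g \<in> Hom S b c.
        fmor F (g \<cdot>\<^bsub>S\<^esub> f) = fmor F g \<cdot>\<^bsub>T\<^esub> fmor F f) \<and>
     (\<forall>a b. \<forall>f \<in> Hom S a b. \<forall>g \<in> Hom S a b.
        fmor F (Plus S f g) = Plus T (fmor F f) (fmor F g)) \<and>
     (\<forall>a \<in> Obj S. is_iso_mor T (fsh F a) (fob F (ShO S a)) (ShO T (fob F a))) \<and>
     (\<forall>a b. \<forall>f \<in> Hom S a b.
        fsh F b \<cdot>\<^bsub>T\<^esub> fmor F (ShM S f) = ShM T (fmor F f) \<cdot>\<^bsub>T\<^esub> fsh F a) \<and>
     (\<forall>f g h. Dist S f g h \<longrightarrow>
        Dist T (fmor F f) (fmor F g) (fsh F (Dom S f) \<cdot>\<^bsub>T\<^esub> fmor F h))"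

definition fully_faithful ::
  "('o, 'm, 'y) cat_scheme \<Rightarrow> ('p, 'n, 'z) cat_scheme \<Rightarrow> ('o, 'm, 'p, 'n) tri_fun \<Rightarrow> bool" where
  "fully_faithful S T F \<longleftrightarrow>
     (\<forall>a \<in> Obj S. \<forall>b \<in> Obj S. bij_betw (fmor F) (Hom S a b) (Hom T (fob F a) (fob F b)))"


section \<open>Sequences\<close>

text \<open>A sequence \<open>E\<^sub>0 \<rightarrow> E\<^sub>1 \<rightarrow> \<dots>\<close>; the arrow \<open>smap E n\<close> goes from \<open>sob E n\<close> to \<open>sob E (Suc n)\<close>.\<close>

record ('o, 'm) sequence =
  sob :: "nat \<Rightarrow> 'o"
  smap :: "nat \<Rightarrow> 'm"

definition is_sequence :: "('o, 'm, 'z) cat_scheme \<Rightarrow> ('o, 'm) sequence \<Rightarrow> bool" where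
  "is_sequence C E \<longleftrightarrow>
     (\<forall>n. sob E n \<in> Obj C \<and> smap E n \<in> Hom C (sob E n) (sob E (Suc n)))"

text \<open>The composite \<open>E\<^sub>j \<rightarrow> E\<^sub>k\<close>, meaningful for \<open>j \<le> k\<close>.\<close>

primrec strans :: "('o, 'm, 'z) cat_scheme \<Rightarrow> ('o, 'm) sequence \<Rightarrow> nat \<Rightarrow> nat \<Rightarrow> 'm" where
  "strans C E j 0 = Ident C (sob E j)"
| "strans C E j (Suc k) =
     (if j \<le> k then smap E k \<cdot>\<^bsub>C\<^esub> strans C E j k else Ident C (sob E j))"

definition subsequence ::
  "('o, 'm, 'z) cat_scheme \<Rightarrow> (nat \<Rightarrow> nat) \<Rightarrow> ('o, 'm) sequence \<Rightarrow> ('o, 'm) sequence" where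
  "subsequence C r E =
     \<lparr>sob = (\<lambda>n. sob E (r n)), smap = (\<lambda>n. strans C E (r n) (r (Suc n)))\<rparr>"

definition shift_seq ::
  "('o, 'm, 'z) tri_cat_scheme \<Rightarrow> ('o, 'm) sequence \<Rightarrow> ('o, 'm) sequence" where
  "shift_seq C E = \<lparr>sob = (\<lambda>n. ShO C (sob E n)), smap = (\<lambda>n. ShM C (smap E n))\<rparr>"

definition image_seq ::
  "('o, 'm, 'p, 'n) tri_fun \<Rightarrow> ('o, 'm) sequence \<Rightarrow> ('p, 'n) sequence" where
  "image_seq F E = \<lparr>sob = (\<lambda>n. fob F (sob E n)), smap = (\<lambda>n. fmor F (smap E n))\<rparr>"

definition seq_map ::
  "('o, 'm, 'z) cat_scheme \<Rightarrow> ('o, 'm) sequence \<Rightarrow> ('o, 'm) sequence \<Rightarrow> (nat \<Rightarrow> 'm) \<Rightarrow> bool" where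
  "seq_map C D E f \<longleftrightarrow>
     (\<forall>n. f n \<in> Hom C (sob D n) (sob E n) \<and>
          f (Suc n) \<cdot>\<^bsub>C\<^esub> smap D n = smap E n \<cdot>\<^bsub>C\<^esub> f n)"

definition seq_cocone ::
  "('o, 'm, 'z) cat_scheme \<Rightarrow> ('o, 'm) sequence \<Rightarrow> 'o \<Rightarrow> (nat \<Rightarrow> 'm) \<Rightarrow> bool" where
  "seq_cocone C E X f \<longleftrightarrow>
     (\<forall>n. f n \<in> Hom C (sob E n) X \<and> f (Suc n) \<cdot>\<^bsub>C\<^esub> smap E n = f n)"

definition is_coproduct ::
  "('o, 'm, 'z) cat_scheme \<Rightarrow> (nat \<Rightarrow> 'o) \<Rightarrow> 'o \<Rightarrow> (nat \<Rightarrow> 'm) \<Rightarrow> bool" where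
  "is_coproduct C E P i \<longleftrightarrow>
     P \<in> Obj C \<and> (\<forall>n. i n \<in> Hom C (E n) P) \<and>
     (\<forall>X \<in> Obj C. \<forall>f. (\<forall>n. f n \<in> Hom C (E n) X) \<longrightarrow>
        (\<exists>!g. g \<in> Hom C P X \<and> (\<forall>n. g \<cdot>\<^bsub>C\<^esub> i n = f n)))"

text \<open>\<open>is_hocolim C E H \<iota>\<close>: the object \<open>H\<close> is a homotopy colimit of \<open>E\<close> and \<open>\<iota> n : E\<^sub>n \<rightarrow> H\<close> are
  the structure maps; \<open>d\<close> is \<open>id - shift\<close>.\<close>

definition is_hocolim ::
  "('o, 'm, 'z) tri_cat_scheme \<Rightarrow> ('o, 'm) sequence \<Rightarrow> 'o \<Rightarrow> (nat \<Rightarrow> 'm) \<Rightarrow> bool" where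
  "is_hocolim C E H \<iota> \<longleftrightarrow>
     (\<exists>P i d q w. is_coproduct C (sob E) P i \<and>
        d \<in> Hom C P P \<and>
        (\<forall>n. d \<cdot>\<^bsub>C\<^esub> i n = Plus C (i n) (Neg C (i (Suc n) \<cdot>\<^bsub>C\<^esub> smap E n))) \<and>
        q \<in> Hom C P H \<and> Dist C d q w \<and> (\<forall>n. \<iota> n = q \<cdot>\<^bsub>C\<^esub> i n))"

text \<open>\<open>\<alpha> n : E\<^sub>n \<rightarrow> X\<close> are the maps induced by some isomorphism of \<open>Hocolim E\<close> with \<open>X\<close>.\<close>

definition hocolim_presentation ::
  "('o, 'm, 'z) tri_cat_scheme \<Rightarrow> ('o, 'm) sequence \<Rightarrow> 'o \<Rightarrow> (nat \<Rightarrow> 'm) \<Rightarrow> bool" where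
  "hocolim_presentation C E X \<alpha> \<longleftrightarrow>
     (\<exists>H \<iota> u. is_hocolim C E H \<iota> \<and> is_iso_mor C u H X \<and> (\<forall>n. \<alpha> n = u \<cdot>\<^bsub>C\<^esub> \<iota> n))"


section \<open>Metrics and Cauchy sequences\<close>

definition star :: "('o, 'm, 'z) tri_cat_scheme \<Rightarrow> 'o set \<Rightarrow> 'o set \<Rightarrow> 'o set" where
  "star C A B =
     {b \<in> Obj C. \<exists>f g h. Dist C f g h \<and> Dom C f \<in> A \<and> Cod C f = b \<and> Cod C g \<in> B}"

definition left_perp :: "('o, 'm, 'z) ab_cat_scheme \<Rightarrow> 'o set \<Rightarrow> 'o set" where
  "left_perp C A = {b \<in> Obj C. \<forall>a \<in> A. Hom C b a = {Zero C b a}}"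

definition good_metric :: "('o, 'm, 'z) tri_cat_scheme \<Rightarrow> (nat \<Rightarrow> 'o set) \<Rightarrow> bool" where
  "good_metric C M \<longleftrightarrow>
     (\<forall>i. M i \<subseteq> Obj C \<and> (\<exists>z \<in> M i. is_zero_object C z) \<and>
          UnshO C ` M (Suc i) \<union> M (Suc i) \<union> ShO C ` M (Suc i) \<subseteq> M i \<and>
          star C (M i) (M i) \<subseteq> M i)"

definition very_good_metric :: "('o, 'm, 'z) tri_cat_scheme \<Rightarrow> (nat \<Rightarrow> 'o set) \<Rightarrow> bool" where
  "very_good_metric C M \<longleftrightarrow>
     good_metric C M \<and>
     Obj C = (\<Union>i. left_perp C (M i)) \<and>
     (\<forall>m. \<exists>n>m. Obj C = star C (left_perp C (M n)) (M m))"

text \<open>Cones are unique up to isomorphism, and the \<open>M i\<close> of a good metric are closed under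
  isomorphism, so it does not matter which cone is taken.\<close>

definition is_Cauchy ::
  "('o, 'm, 'z) tri_cat_scheme \<Rightarrow> (nat \<Rightarrow> 'o set) \<Rightarrow> ('o, 'm) sequence \<Rightarrow> bool" where
  "is_Cauchy C M E \<longleftrightarrow>
     is_sequence C E \<and>
     (\<forall>i. \<exists>N. \<forall>j k. N \<le> j \<and> j < k \<longrightarrow>
        (\<exists>g h. Dist C (strans C E j k) g h \<and> Cod C g \<in> M i))"

definition is_Cauchy_triangles ::
  "('o, 'm, 'z) tri_cat_scheme \<Rightarrow> (nat \<Rightarrow> 'o set) \<Rightarrow>
    ('o, 'm) sequence \<Rightarrow> ('o, 'm) sequence \<Rightarrow> ('o, 'm) sequence \<Rightarrow>
    (nat \<Rightarrow> 'm) \<Rightarrow> (nat \<Rightarrow> 'm) \<Rightarrow> (nat \<Rightarrow> 'm) \<Rightarrow> bool" where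
  "is_Cauchy_triangles C M a b c f g h \<longleftrightarrow>
     is_Cauchy C M a \<and> is_Cauchy C M b \<and> is_Cauchy C M c \<and>
     seq_map C a b f \<and> seq_map C b c g \<and> seq_map C c (shift_seq C a) h \<and>
     (\<forall>n. Dist C (f n) (g n) (h n))"


section \<open>The category Mod-S\<close>

text \<open>An object of Mod-S is an additive functor from the opposite of \<open>S\<close> to abelian groups;
  the groups are library groups with elements in an arbitrary type, written
  multiplicatively. An arrow \<open>f : x \<rightarrow> y\<close> acts by \<open>res f : M(y) \<rightarrow> M(x)\<close>.\<close>

record ('o, 'm, 'g) md =
  val :: "'o \<Rightarrow> 'g monoid"
  res :: "'m \<Rightarrow> 'g \<Rightarrow> 'g"

definition is_module :: "('o, 'm, 'z) ab_cat_scheme \<Rightarrow> ('o, 'm, 'g) md \<Rightarrow> bool" where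
  "is_module S M \<longleftrightarrow>
     (\<forall>x \<in> Obj S. comm_group (val M x)) \<and>
     (\<forall>x y. \<forall>f \<in> Hom S x y. res M f \<in> hom (val M y) (val M x)) \<and>
     (\<forall>x \<in> Obj S. \<forall>m \<in> carrier (val M x). res M (Ident S x) m = m) \<and>
     (\<forall>x y z. \<forall>f \<in> Hom S x y. \<forall>g \<in> Hom S y z. \<forall>m \<in> carrier (val M z).
        res M (g \<cdot>\<^bsub>S\<^esub> f) m = res M f (res M g m)) \<and>
     (\<forall>x y. \<forall>f \<in> Hom S x y. \<forall>g \<in> Hom S x y. \<forall>m \<in> carrier (val M y).
        res M (Plus S f g) m = res M f m \<otimes>\<^bsub>val M x\<^esub> res M g m)"

definition is_mod_map ::
  "('o, 'm, 'z) ab_cat_scheme \<Rightarrow> ('o, 'm, 'g) md \<Rightarrow> ('o, 'm, 'h) md \<Rightarrow> ('o \<Rightarrow> 'g \<Rightarrow> 'h) \<Rightarrow> bool" where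
  "is_mod_map S M N \<eta> \<longleftrightarrow>
     (\<forall>x \<in> Obj S. \<eta> x \<in> hom (val M x) (val N x)) \<and>
     (\<forall>x y. \<forall>f \<in> Hom S x y. \<forall>m \<in> carrier (val M y). \<eta> x (res M f m) = res N f (\<eta> y m))"

definition is_mod_iso ::
  "('o, 'm, 'z) ab_cat_scheme \<Rightarrow> ('o, 'm, 'g) md \<Rightarrow> ('o, 'm, 'h) md \<Rightarrow> ('o \<Rightarrow> 'g \<Rightarrow> 'h) \<Rightarrow> bool" where
  "is_mod_iso S M N \<eta> \<longleftrightarrow>
     is_mod_map S M N \<eta> \<and> (\<forall>x \<in> Obj S. \<eta> x \<in> iso (val M x) (val N x))"

text \<open>The shift on Mod-S is precomposition with the inverse of the shift on \<open>S\<close>; the natural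
  isomorphism of \<open>\<Sigma>Y(s) = Hom(\<Sigma>\<^sup>-\<^sup>1 -, s)\<close> with \<open>Y(\<Sigma>s)\<close> is the shift on arrows.\<close>

definition md_shift ::
  "('o, 'm, 'z) tri_cat_scheme \<Rightarrow> ('o, 'm, 'g) md \<Rightarrow> ('o, 'm, 'g) md" where
  "md_shift S M = \<lparr>val = (\<lambda>x. val M (UnshO S x)), res = (\<lambda>f. res M (UnshM S f))\<rparr>"

definition md_shift_map ::
  "('o, 'm, 'z) tri_cat_scheme \<Rightarrow> ('o \<Rightarrow> 'g \<Rightarrow> 'h) \<Rightarrow> ('o \<Rightarrow> 'g \<Rightarrow> 'h)" where
  "md_shift_map S \<eta> = (\<lambda>x. \<eta> (UnshO S x))"

subsection \<open>Sequential colimits\<close>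

text \<open>Colimits in Mod-S are computed objectwise. The colimit of a sequence of abelian groups is
  the set of pairs (index, element) modulo becoming equal at a later index. The universal property is
  proved below as \<open>colim_universal\<close>.\<close>

type_synonym ('o, 'm, 'g) md_seq = "nat \<Rightarrow> ('o, 'm, 'g) md"
type_synonym ('o, 'g) md_trans = "nat \<Rightarrow> 'o \<Rightarrow> 'g \<Rightarrow> 'g"

definition is_md_sequence ::
  "('o, 'm, 'z) ab_cat_scheme \<Rightarrow> ('o, 'm, 'g) md_seq \<Rightarrow> ('o, 'g) md_trans \<Rightarrow> bool" where
  "is_md_sequence S M \<tau> \<longleftrightarrow>
     (\<forall>n. is_module S (M n) \<and> is_mod_map S (M n) (M (Suc n)) (\<tau> n))"

primrec mtrans :: "('o, 'g) md_trans \<Rightarrow> 'o \<Rightarrow> nat \<Rightarrow> nat \<Rightarrow> 'g \<Rightarrow> 'g" where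
  "mtrans \<tau> x j 0 = (\<lambda>m. m)"
| "mtrans \<tau> x j (Suc k) = (if j \<le> k then (\<lambda>m. \<tau> k x (mtrans \<tau> x j k m)) else (\<lambda>m. m))"

definition colim_rel ::
  "('o, 'm, 'g) md_seq \<Rightarrow> ('o, 'g) md_trans \<Rightarrow> 'o \<Rightarrow> ((nat \<times> 'g) \<times> (nat \<times> 'g)) set" where
  "colim_rel M \<tau> x = {((i, m), (j, n)).
     m \<in> carrier (val (M i) x) \<and> n \<in> carrier (val (M j) x) \<and>
     (\<exists>k. i \<le> k \<and> j \<le> k \<and> mtrans \<tau> x i k m = mtrans \<tau> x j k n)}"

definition colim_group ::
  "('o, 'm, 'g) md_seq \<Rightarrow> ('o, 'g) md_trans \<Rightarrow> 'o \<Rightarrow> (nat \<times> 'g) set monoid" where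
  "colim_group M \<tau> x =
     \<lparr>carrier = (SIGMA i:UNIV. carrier (val (M i) x)) // colim_rel M \<tau> x,
      mult = (\<lambda>A B. colim_rel M \<tau> x `` {(k, a \<otimes>\<^bsub>val (M k) x\<^esub> b) |k a b. (k, a) \<in> A \<and> (k, b) \<in> B}),
      one = colim_rel M \<tau> x `` {(0, \<one>\<^bsub>val (M 0) x\<^esub>)}\<rparr>"

definition colim ::
  "('o, 'm, 'z) ab_cat_scheme \<Rightarrow> ('o, 'm, 'g) md_seq \<Rightarrow> ('o, 'g) md_trans \<Rightarrow>
    ('o, 'm, (nat \<times> 'g) set) md" where
  "colim S M \<tau> =
     \<lparr>val = colim_group M \<tau>,
      res = (\<lambda>f A. colim_rel M \<tau> (Dom S f) `` {(k, res (M k) f a) |k a. (k, a) \<in> A})\<rparr>"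

definition colim_in ::
  "('o, 'm, 'g) md_seq \<Rightarrow> ('o, 'g) md_trans \<Rightarrow> nat \<Rightarrow> 'o \<Rightarrow> 'g \<Rightarrow> (nat \<times> 'g) set" where
  "colim_in M \<tau> i x m = colim_rel M \<tau> x `` {(i, m)}"

definition colim_desc ::
  "(nat \<Rightarrow> 'o \<Rightarrow> 'g \<Rightarrow> 'h) \<Rightarrow> 'o \<Rightarrow> (nat \<times> 'g) set \<Rightarrow> 'h" where
  "colim_desc \<kappa> x A = (THE n. \<forall>(i, a) \<in> A. \<kappa> i x a = n)"

text \<open>The map of colimits induced by a map \<open>\<phi>\<close> to the sequence \<open>N\<close>, \<open>\<sigma>\<close>.\<close>

definition colim_map ::
  "('o, 'm, 'h) md_seq \<Rightarrow> ('o, 'h) md_trans \<Rightarrow> (nat \<Rightarrow> 'o \<Rightarrow> 'g \<Rightarrow> 'h) \<Rightarrow>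
    'o \<Rightarrow> (nat \<times> 'g) set \<Rightarrow> (nat \<times> 'h) set" where
  "colim_map N \<sigma> \<phi> = colim_desc (\<lambda>n x m. colim_in N \<sigma> n x (\<phi> n x m))"

lemma colim_group_shift:
  "colim_group (\<lambda>n. md_shift S (M n)) (\<lambda>n. md_shift_map S (\<tau> n)) x = colim_group M \<tau> (UnshO S x)"
proof -
  have "mtrans (\<lambda>n. md_shift_map S (\<tau> n)) x j k = mtrans \<tau> (UnshO S x) j k" for j k
    by (induction k) (auto simp: md_shift_map_def)
  then show ?thesis
    by (simp add: colim_group_def colim_rel_def md_shift_def)
qed

context
  fixes S :: "('o, 'm, 'z) ab_cat_scheme"
    and M :: "('o, 'm, 'g) md_seq" and \<tau> :: "('o, 'g) md_trans"
  assumes S: "additive_category S" and M: "is_md_sequence S M \<tau>"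
begin

lemma module_M: "is_module S (M n)" and map_\<tau>: "is_mod_map S (M n) (M (Suc n)) (\<tau> n)"
  using M by (auto simp: is_md_sequence_def)

lemma group_M: "x \<in> Obj S \<Longrightarrow> comm_group (val (M n) x)"
  using module_M[of n] by (auto simp: is_module_def)

lemma mtrans_refl: "mtrans \<tau> x j j m = m"
  by (cases j) auto

lemma mtrans_comp:
  "\<lbrakk>i \<le> j; j \<le> k\<rbrakk> \<Longrightarrow> mtrans \<tau> x j k (mtrans \<tau> x i j m) = mtrans \<tau> x i k m"
proof (induction k)
  case (Suc k)
  then show ?case
    by (cases "j = Suc k") (auto simp: mtrans_refl simp del: mtrans.simps, auto)
qed auto

lemma mtrans_hom:
  assumes "x \<in> Obj S"
  shows "i \<le> k \<Longrightarrow> mtrans \<tau> x i k \<in> hom (val (M i) x) (val (M k) x)"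
proof (induction k)
  case 0
  then show ?case by (auto simp: hom_def)
next
  case (Suc k)
  show ?case
  proof (cases "i = Suc k")
    case True
    then show ?thesis by (auto simp: hom_def)
  next
    case False
    then have "mtrans \<tau> x i k \<in> hom (val (M i) x) (val (M k) x)" "i \<le> k"
      using Suc by auto
    moreover have "\<tau> k x \<in> hom (val (M k) x) (val (M (Suc k)) x)"
      using map_\<tau>[of k] assms by (auto simp: is_mod_map_def)
    ultimately have "\<tau> k x \<circ> mtrans \<tau> x i k \<in> hom (val (M i) x) (val (M (Suc k)) x)"
      using hom_compose by blast
    with \<open>i \<le> k\<close> show ?thesis
      by (simp add: comp_def)
  qed
qed

lemma mtrans_closed:
  "\<lbrakk>x \<in> Obj S; i \<le> k; m \<in> carrier (val (M i) x)\<rbrakk> \<Longrightarrow> mtrans \<tau> x i k m \<in> carrier (val (M k) x)"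
  using mtrans_hom by (auto simp: hom_def)

lemma mtrans_mult:
  "\<lbrakk>x \<in> Obj S; i \<le> k; m \<in> carrier (val (M i) x); n \<in> carrier (val (M i) x)\<rbrakk> \<Longrightarrow>
    mtrans \<tau> x i k (m \<otimes>\<^bsub>val (M i) x\<^esub> n) = mtrans \<tau> x i k m \<otimes>\<^bsub>val (M k) x\<^esub> mtrans \<tau> x i k n"
  using mtrans_hom by (auto simp: hom_def)

lemma mtrans_one:
  "\<lbrakk>x \<in> Obj S; i \<le> k\<rbrakk> \<Longrightarrow> mtrans \<tau> x i k \<one>\<^bsub>val (M i) x\<^esub> = \<one>\<^bsub>val (M k) x\<^esub>"
  using mtrans_hom group_M by (meson comm_group.axioms(2) hom_one)

lemma mtrans_res:
  assumes f: "f \<in> Hom S x y"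
  shows "\<lbrakk>i \<le> k; m \<in> carrier (val (M i) y)\<rbrakk> \<Longrightarrow>
    mtrans \<tau> x i k (res (M i) f m) = res (M k) f (mtrans \<tau> y i k m)"
proof (induction k)
  case (Suc k)
  have y: "y \<in> Obj S"
    using f additive_category.axioms(1)[OF S] by (auto simp: Hom_def category_def)
  show ?case
  proof (cases "i = Suc k")
    case False
    with Suc have *: "i \<le> k" by auto
    then have "mtrans \<tau> y i k m \<in> carrier (val (M k) y)"
      using Suc.prems y mtrans_closed by blast
    with map_\<tau>[of k] f have
      "\<tau> k x (res (M k) f (mtrans \<tau> y i k m)) = res (M (Suc k)) f (\<tau> k y (mtrans \<tau> y i k m))"
      by (auto simp: is_mod_map_def)
    with * Suc show ?thesis by simp
  qed auto
qed auto

abbreviation "elts x \<equiv> SIGMA i:UNIV. carrier (val (M i) x)"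

lemma colim_rel_equiv:
  assumes x: "x \<in> Obj S"
  shows "equiv (elts x) (colim_rel M \<tau> x)"
proof (rule equivI)
  show "colim_rel M \<tau> x \<subseteq> elts x \<times> elts x"
    by (auto simp: colim_rel_def)
  show "refl_on (elts x) (colim_rel M \<tau> x)"
    by (auto simp: refl_on_def colim_rel_def)
  show "sym (colim_rel M \<tau> x)"
    by (fastforce simp: sym_def colim_rel_def)
  show "trans (colim_rel M \<tau> x)"
  proof (rule transI, clarify)
    fix i m j n k p
    assume a: "((i, m), (j, n)) \<in> colim_rel M \<tau> x" "((j, n), (k, p)) \<in> colim_rel M \<tau> x"
    then obtain u v where u: "i \<le> u" "j \<le> u" "mtrans \<tau> x i u m = mtrans \<tau> x j u n"
      and v: "j \<le> v" "k \<le> v" "mtrans \<tau> x j v n = mtrans \<tau> x k v p"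
      by (auto simp: colim_rel_def)
    let ?w = "max u v"
    have "mtrans \<tau> x i ?w m = mtrans \<tau> x j ?w n"
      using u by (metis max.cobounded1 mtrans_comp)
    also have "\<dots> = mtrans \<tau> x k ?w p"
      using v by (metis max.cobounded2 mtrans_comp)
    finally have "mtrans \<tau> x i ?w m = mtrans \<tau> x k ?w p" .
    with a u v show "((i, m), (k, p)) \<in> colim_rel M \<tau> x"
      by (auto simp: colim_rel_def intro!: exI[of _ ?w])
  qed
qed

lemma colim_in_eq_iff:
  assumes "x \<in> Obj S" "m \<in> carrier (val (M i) x)" "n \<in> carrier (val (M j) x)"
  shows "colim_in M \<tau> i x m = colim_in M \<tau> j x n \<longleftrightarrow>
    (\<exists>k. i \<le> k \<and> j \<le> k \<and> mtrans \<tau> x i k m = mtrans \<tau> x j k n)"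
  unfolding colim_in_def using assms
  by (subst eq_equiv_class_iff[OF colim_rel_equiv]) (auto simp: colim_rel_def)

lemma colim_in_trans:
  assumes "x \<in> Obj S" "m \<in> carrier (val (M i) x)" "i \<le> k"
  shows "colim_in M \<tau> k x (mtrans \<tau> x i k m) = colim_in M \<tau> i x m"
  using assms by (subst colim_in_eq_iff) (auto simp: mtrans_refl mtrans_closed intro!: exI[of _ k])

lemma mem_colim_in:
  assumes "x \<in> Obj S" "m \<in> carrier (val (M i) x)"
  shows "(j, n) \<in> colim_in M \<tau> i x m \<longleftrightarrow>
    n \<in> carrier (val (M j) x) \<and> colim_in M \<tau> j x n = colim_in M \<tau> i x m"
proof -
  have "(j, n) \<in> colim_in M \<tau> i x m \<longleftrightarrow> ((i, m), (j, n)) \<in> colim_rel M \<tau> x"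
    by (simp add: colim_in_def)
  also have "\<dots> \<longleftrightarrow> n \<in> carrier (val (M j) x) \<and> colim_in M \<tau> j x n = colim_in M \<tau> i x m"
    using equiv_class_eq_iff[OF colim_rel_equiv[OF assms(1)], of "(i, m)" "(j, n)"] assms(2)
    by (auto simp: colim_in_def)
  finally show ?thesis .
qed

lemma colim_image_eq:
  assumes x: "x \<in> Obj S" and m: "m \<in> carrier (val (M i) x)"
    and X: "X \<noteq> {}" "\<And>j n. (j, n) \<in> X \<Longrightarrow>
      n \<in> carrier (val (M j) x) \<and> colim_in M \<tau> j x n = colim_in M \<tau> i x m"
  shows "colim_rel M \<tau> x `` X = colim_in M \<tau> i x m"
proof -
  have "colim_rel M \<tau> x `` {p} = colim_in M \<tau> i x m" if "p \<in> X" for p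
    using X(2)[of "fst p" "snd p"] that by (simp add: colim_in_def)
  then show ?thesis using X(1) by blast
qed

lemma carrier_colim_group:
  "carrier (colim_group M \<tau> x) = {colim_in M \<tau> i x m |i m. m \<in> carrier (val (M i) x)}"
  by (auto simp: colim_group_def quotient_def colim_in_def)

lemma colim_cases2:
  assumes x: "x \<in> Obj S" and A: "A \<in> carrier (colim_group M \<tau> x)" and B: "B \<in> carrier (colim_group M \<tau> x)"
  obtains k a b where "a \<in> carrier (val (M k) x)" "b \<in> carrier (val (M k) x)"
    "A = colim_in M \<tau> k x a" "B = colim_in M \<tau> k x b"
proof -
  obtain i a where a: "a \<in> carrier (val (M i) x)" "A = colim_in M \<tau> i x a"
    using A by (auto simp: carrier_colim_group)
  obtain j b where b: "b \<in> carrier (val (M j) x)" "B = colim_in M \<tau> j x b"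
    using B by (auto simp: carrier_colim_group)
  let ?k = "max i j"
  show thesis
    by (rule that[of "mtrans \<tau> x i ?k a" ?k "mtrans \<tau> x j ?k b"])
      (auto simp: mtrans_closed x a b colim_in_trans)
qed

lemma colim_mult:
  assumes x: "x \<in> Obj S" and a: "a \<in> carrier (val (M k) x)" and b: "b \<in> carrier (val (M k) x)"
  shows "colim_in M \<tau> k x a \<otimes>\<^bsub>colim_group M \<tau> x\<^esub> colim_in M \<tau> k x b =
    colim_in M \<tau> k x (a \<otimes>\<^bsub>val (M k) x\<^esub> b)"
proof -
  interpret G: comm_group "val (M j) x" for j using group_M x .
  let ?X = "{(j, c \<otimes>\<^bsub>val (M j) x\<^esub> d) |j c d. (j, c) \<in> colim_in M \<tau> k x a \<and> (j, d) \<in> colim_in M \<tau> k x b}"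
  have "colim_rel M \<tau> x `` ?X = colim_in M \<tau> k x (a \<otimes>\<^bsub>val (M k) x\<^esub> b)"
  proof (rule colim_image_eq[OF x])
    have "(k, a \<otimes>\<^bsub>val (M k) x\<^esub> b) \<in> ?X"
      using mem_colim_in[OF x a, of k a] mem_colim_in[OF x b, of k b] a b by blast
    then show "?X \<noteq> {}" by blast
  next
    fix j n assume "(j, n) \<in> ?X"
    then obtain c d where n: "n = c \<otimes>\<^bsub>val (M j) x\<^esub> d"
      and c: "c \<in> carrier (val (M j) x)" "colim_in M \<tau> j x c = colim_in M \<tau> k x a"
      and d: "d \<in> carrier (val (M j) x)" "colim_in M \<tau> j x d = colim_in M \<tau> k x b"
      using mem_colim_in[OF x a] mem_colim_in[OF x b] by blast
    obtain u where u: "j \<le> u" "k \<le> u" "mtrans \<tau> x j u c = mtrans \<tau> x k u a"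
      using colim_in_eq_iff[OF x c(1) a] c(2) by blast
    obtain v where v: "j \<le> v" "k \<le> v" "mtrans \<tau> x j v d = mtrans \<tau> x k v b"
      using colim_in_eq_iff[OF x d(1) b] d(2) by blast
    let ?w = "max u v"
    have w: "j \<le> ?w" "k \<le> ?w" using u by auto
    have 1: "mtrans \<tau> x j ?w c = mtrans \<tau> x k ?w a"
      using u by (metis max.cobounded1 mtrans_comp)
    have 2: "mtrans \<tau> x j ?w d = mtrans \<tau> x k ?w b"
      using v by (metis max.cobounded2 mtrans_comp)
    have "mtrans \<tau> x j ?w n = mtrans \<tau> x k ?w (a \<otimes>\<^bsub>val (M k) x\<^esub> b)"
      unfolding n mtrans_mult[OF x w(1) c(1) d(1)] mtrans_mult[OF x w(2) a b] 1 2 ..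
    moreover have "n \<in> carrier (val (M j) x)" "a \<otimes>\<^bsub>val (M k) x\<^esub> b \<in> carrier (val (M k) x)"
      using a b c d n by simp_all
    ultimately have "colim_in M \<tau> j x n = colim_in M \<tau> k x (a \<otimes>\<^bsub>val (M k) x\<^esub> b)"
      using w colim_in_eq_iff[OF x] by blast
    then show "n \<in> carrier (val (M j) x) \<and>
        colim_in M \<tau> j x n = colim_in M \<tau> k x (a \<otimes>\<^bsub>val (M k) x\<^esub> b)"
      using c d n by simp
  qed (use a b in simp)
  then show ?thesis by (simp add: colim_group_def)
qed

lemma colim_one:
  assumes x: "x \<in> Obj S"
  shows "\<one>\<^bsub>colim_group M \<tau> x\<^esub> = colim_in M \<tau> k x \<one>\<^bsub>val (M k) x\<^esub>"
proof -
  interpret G: comm_group "val (M j) x" for j using group_M x .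
  have "colim_in M \<tau> k x \<one>\<^bsub>val (M k) x\<^esub> = colim_in M \<tau> 0 x \<one>\<^bsub>val (M 0) x\<^esub>"
    using colim_in_trans[OF x, of "\<one>\<^bsub>val (M 0) x\<^esub>" 0 k] mtrans_one[OF x, of 0 k] by simp
  then show ?thesis
    by (simp add: colim_group_def colim_in_def)
qed

lemma colim_group: 
  assumes x: "x \<in> Obj S"
  shows "comm_group (colim_group M \<tau> x)"
proof (rule comm_groupI)
  interpret G: comm_group "val (M j) x" for j using group_M x .
  let ?L = "colim_group M \<tau> x"
  note [simp] = colim_mult[OF x]
  show one: "\<one>\<^bsub>?L\<^esub> \<in> carrier ?L"
    by (auto simp: colim_one[OF x, of 0] carrier_colim_group)
  fix A assume A: "A \<in> carrier ?L"
  obtain k a where a: "a \<in> carrier (val (M k) x)" "A = colim_in M \<tau> k x a"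
    using A by (auto simp: carrier_colim_group)
  show "\<one>\<^bsub>?L\<^esub> \<otimes>\<^bsub>?L\<^esub> A = A"
    using a by (simp add: colim_one[OF x, of k])
  have "colim_in M \<tau> k x (inv\<^bsub>val (M k) x\<^esub> a) \<in> carrier ?L"
    using a by (auto simp: carrier_colim_group)
  moreover have "colim_in M \<tau> k x (inv\<^bsub>val (M k) x\<^esub> a) \<otimes>\<^bsub>?L\<^esub> A = \<one>\<^bsub>?L\<^esub>"
    using a by (simp add: colim_one[OF x, of k])
  ultimately show "\<exists>y\<in>carrier ?L. y \<otimes>\<^bsub>?L\<^esub> A = \<one>\<^bsub>?L\<^esub>" by blast
  fix B assume B: "B \<in> carrier ?L"
  obtain k a b where ab: "a \<in> carrier (val (M k) x)" "b \<in> carrier (val (M k) x)"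
    "A = colim_in M \<tau> k x a" "B = colim_in M \<tau> k x b"
    using colim_cases2[OF x A B] .
  show AB: "A \<otimes>\<^bsub>?L\<^esub> B \<in> carrier ?L"
    using ab by (auto simp: carrier_colim_group)
  show "A \<otimes>\<^bsub>?L\<^esub> B = B \<otimes>\<^bsub>?L\<^esub> A"
    using ab by (simp add: G.m_comm)
  fix D assume D: "D \<in> carrier ?L"
  obtain j d where d: "d \<in> carrier (val (M j) x)" "D = colim_in M \<tau> j x d"
    using D by (auto simp: carrier_colim_group)
  let ?w = "max j k"
  have "A = colim_in M \<tau> ?w x (mtrans \<tau> x k ?w a)" "B = colim_in M \<tau> ?w x (mtrans \<tau> x k ?w b)"
    "D = colim_in M \<tau> ?w x (mtrans \<tau> x j ?w d)"
    using ab d x by (simp_all add: colim_in_trans)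
  moreover have "mtrans \<tau> x k ?w a \<in> carrier (val (M ?w) x)"
    "mtrans \<tau> x k ?w b \<in> carrier (val (M ?w) x)" "mtrans \<tau> x j ?w d \<in> carrier (val (M ?w) x)"
    using ab d x by (auto intro: mtrans_closed)
  ultimately show "A \<otimes>\<^bsub>?L\<^esub> B \<otimes>\<^bsub>?L\<^esub> D = A \<otimes>\<^bsub>?L\<^esub> (B \<otimes>\<^bsub>?L\<^esub> D)"
    by (simp add: G.m_assoc)
qed

lemma res_M:
  assumes "f \<in> Hom S x y"
  shows "m \<in> carrier (val (M k) y) \<Longrightarrow> res (M k) f m \<in> carrier (val (M k) x)"
    and "\<lbrakk>m \<in> carrier (val (M k) y); n \<in> carrier (val (M k) y)\<rbrakk> \<Longrightarrow>
      res (M k) f (m \<otimes>\<^bsub>val (M k) y\<^esub> n) = res (M k) f m \<otimes>\<^bsub>val (M k) x\<^esub> res (M k) f n"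
proof -
  have "res (M k) f \<in> hom (val (M k) y) (val (M k) x)"
    using module_M[of k] assms by (auto simp: is_module_def)
  then show "m \<in> carrier (val (M k) y) \<Longrightarrow> res (M k) f m \<in> carrier (val (M k) x)"
    and "\<lbrakk>m \<in> carrier (val (M k) y); n \<in> carrier (val (M k) y)\<rbrakk> \<Longrightarrow>
      res (M k) f (m \<otimes>\<^bsub>val (M k) y\<^esub> n) = res (M k) f m \<otimes>\<^bsub>val (M k) x\<^esub> res (M k) f n"
    by (auto simp: hom_def)
qed

lemma Hom_Obj: "f \<in> Hom S x y \<Longrightarrow> x \<in> Obj S" "f \<in> Hom S x y \<Longrightarrow> y \<in> Obj S"
  using additive_category.axioms(1)[OF S] by (auto simp: Hom_def category_def)

lemma colim_res:
  assumes f: "f \<in> Hom S x y" and a: "a \<in> carrier (val (M k) y)"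
  shows "res (colim S M \<tau>) f (colim_in M \<tau> k y a) = colim_in M \<tau> k x (res (M k) f a)"
proof -
  have x: "x \<in> Obj S" and y: "y \<in> Obj S" using f Hom_Obj by auto
  let ?X = "{(j, res (M j) f c) |j c. (j, c) \<in> colim_in M \<tau> k y a}"
  have "colim_rel M \<tau> x `` ?X = colim_in M \<tau> k x (res (M k) f a)"
  proof (rule colim_image_eq[OF x])
    show "res (M k) f a \<in> carrier (val (M k) x)" using res_M f a by blast
    have "(k, res (M k) f a) \<in> ?X"
      using a y by (auto simp: mem_colim_in)
    then show "?X \<noteq> {}" by blast
  next
    fix j n assume "(j, n) \<in> ?X"
    then obtain c where n: "n = res (M j) f c"
      and c: "c \<in> carrier (val (M j) y)" "colim_in M \<tau> j y c = colim_in M \<tau> k y a"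
      using a y by (auto simp: mem_colim_in)
    obtain u where u: "j \<le> u" "k \<le> u" "mtrans \<tau> y j u c = mtrans \<tau> y k u a"
      using c a y by (auto simp: colim_in_eq_iff)
    have "mtrans \<tau> x j u n = mtrans \<tau> x k u (res (M k) f a)"
      using u a c n f by (simp add: mtrans_res[OF f])
    with u have "colim_in M \<tau> j x n = colim_in M \<tau> k x (res (M k) f a)"
      using x n c a res_M[OF f] by (subst colim_in_eq_iff) auto
    then show "n \<in> carrier (val (M j) x) \<and>
        colim_in M \<tau> j x n = colim_in M \<tau> k x (res (M k) f a)"
      using n c res_M[OF f] by auto
  qed
  moreover have "Dom S f = x" using f by (simp add: Hom_def)
  ultimately show ?thesis by (simp add: colim_def)
qed

lemma colim_val: "val (colim S M \<tau>) = colim_group M \<tau>"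
  by (simp add: colim_def)

lemma colim_module: "is_module S (colim S M \<tau>)"
  unfolding is_module_def colim_val
proof (intro conjI ballI allI)
  fix x assume x: "x \<in> Obj S"
  show "comm_group (colim_group M \<tau> x)" using colim_group x .
  fix A assume "A \<in> carrier (colim_group M \<tau> x)"
  then obtain k a where "a \<in> carrier (val (M k) x)" "A = colim_in M \<tau> k x a"
    by (auto simp: carrier_colim_group)
  moreover have "Ident S x \<in> Hom S x x" using additive_category.axioms(1)[OF S] x by (auto simp: category_def)
  ultimately show "res (colim S M \<tau>) (Ident S x) A = A"
    using module_M[of k] x by (simp add: colim_res is_module_def)
next
  fix x y f assume f: "f \<in> Hom S x y"
  have x: "x \<in> Obj S" and y: "y \<in> Obj S" using f Hom_Obj by auto
  interpret G: comm_group "val (M j) y" for j using group_M y .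
  show "res (colim S M \<tau>) f \<in> hom (colim_group M \<tau> y) (colim_group M \<tau> x)"
  proof (rule homI)
    fix A assume A: "A \<in> carrier (colim_group M \<tau> y)"
    then obtain k a where "a \<in> carrier (val (M k) y)" "A = colim_in M \<tau> k y a"
      by (auto simp: carrier_colim_group)
    then show "res (colim S M \<tau>) f A \<in> carrier (colim_group M \<tau> x)"
      using res_M[OF f] by (auto simp: carrier_colim_group colim_res[OF f])
    fix B assume B: "B \<in> carrier (colim_group M \<tau> y)"
    obtain k a b where "a \<in> carrier (val (M k) y)" "b \<in> carrier (val (M k) y)"
      "A = colim_in M \<tau> k y a" "B = colim_in M \<tau> k y b"
      using colim_cases2[OF y A B] .
    then show "res (colim S M \<tau>) f (A \<otimes>\<^bsub>colim_group M \<tau> y\<^esub> B) =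
        res (colim S M \<tau>) f A \<otimes>\<^bsub>colim_group M \<tau> x\<^esub> res (colim S M \<tau>) f B"
      using res_M[OF f] by (simp add: colim_mult x y colim_res[OF f])
  qed
next
  fix x y z f g A
  assume f: "f \<in> Hom S x y" and g: "g \<in> Hom S y z" and A: "A \<in> carrier (colim_group M \<tau> z)"
  obtain k a where "a \<in> carrier (val (M k) z)" "A = colim_in M \<tau> k z a"
    using A by (auto simp: carrier_colim_group)
  moreover have "g \<cdot>\<^bsub>S\<^esub> f \<in> Hom S x z"
    using category.Comp_Hom[OF additive_category.axioms(1)[OF S] f g] .
  ultimately show "res (colim S M \<tau>) (g \<cdot>\<^bsub>S\<^esub> f) A = res (colim S M \<tau>) f (res (colim S M \<tau>) g A)"
    using module_M[of k] f g res_M[OF g] by (simp add: colim_res is_module_def)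
next
  fix x y f g A
  assume f: "f \<in> Hom S x y" and g: "g \<in> Hom S x y" and A: "A \<in> carrier (colim_group M \<tau> y)"
  have x: "x \<in> Obj S" using f Hom_Obj by auto
  obtain k a where a: "a \<in> carrier (val (M k) y)" "A = colim_in M \<tau> k y a"
    using A by (auto simp: carrier_colim_group)
  have *: "Plus S f g \<in> Hom S x y"
    using additive_category.Plus_closed[OF S f g] .
  with a show "res (colim S M \<tau>) (Plus S f g) A =
      res (colim S M \<tau>) f A \<otimes>\<^bsub>colim_group M \<tau> x\<^esub> res (colim S M \<tau>) g A"
    using module_M[of k] f g res_M[OF f] res_M[OF g] x
    by (simp add: colim_res colim_mult is_module_def)
qed

lemma colim_in_map: "is_mod_map S (M i) (colim S M \<tau>) (colim_in M \<tau> i)"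
  unfolding is_mod_map_def colim_val
proof (intro conjI ballI allI)
  fix x assume x: "x \<in> Obj S"
  show "colim_in M \<tau> i x \<in> hom (val (M i) x) (colim_group M \<tau> x)"
    by (rule homI) (auto simp: carrier_colim_group colim_mult[OF x])
qed (simp add: colim_res)

lemma colim_desc_in:
  assumes N: "\<And>i. is_mod_map S (M i) N (\<kappa> i)"
    and \<kappa>: "\<And>i x m. \<lbrakk>x \<in> Obj S; m \<in> carrier (val (M i) x)\<rbrakk> \<Longrightarrow> \<kappa> (Suc i) x (\<tau> i x m) = \<kappa> i x m"
    and x: "x \<in> Obj S" and m: "m \<in> carrier (val (M i) x)"
  shows "colim_desc \<kappa> x (colim_in M \<tau> i x m) = \<kappa> i x m"
proof -
  have *: "\<kappa> k x (mtrans \<tau> x j k n) = \<kappa> j x n" if "j \<le> k" "n \<in> carrier (val (M j) x)" for j k n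
    using that
  proof (induction k)
    case (Suc k)
    show ?case
    proof (cases "j = Suc k")
      case False
      with Suc.prems have j: "j \<le> k" by simp
      with Suc.prems have "mtrans \<tau> x j k n \<in> carrier (val (M k) x)"
        by (intro mtrans_closed[OF x j])
      then have "\<kappa> (Suc k) x (\<tau> k x (mtrans \<tau> x j k n)) = \<kappa> k x (mtrans \<tau> x j k n)"
        by (rule \<kappa>[OF x])
      also have "\<dots> = \<kappa> j x n"
        by (rule Suc.IH[OF j Suc.prems(2)])
      finally show ?thesis using j by simp
    qed simp
  qed simp
  have 1: "\<kappa> j x n = \<kappa> i x m" if "(j, n) \<in> colim_in M \<tau> i x m" for j n
  proof -
    have n: "n \<in> carrier (val (M j) x)" "colim_in M \<tau> j x n = colim_in M \<tau> i x m"
      using iffD1[OF mem_colim_in[OF x m] that] by blast+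
    then obtain k where "j \<le> k" "i \<le> k" "mtrans \<tau> x j k n = mtrans \<tau> x i k m"
      using colim_in_eq_iff[OF x n(1) m] n(2) by blast
    then show ?thesis
      using *[OF \<open>j \<le> k\<close> n(1)] *[OF \<open>i \<le> k\<close> m] by argo
  qed
  have 2: "(i, m) \<in> colim_in M \<tau> i x m"
    by (rule iffD2[OF mem_colim_in[OF x m]]) (use m in simp)
  show ?thesis
    unfolding colim_desc_def
  proof (rule the_equality)
    show "\<forall>(j, n) \<in> colim_in M \<tau> i x m. \<kappa> j x n = \<kappa> i x m"
      using 1 by blast
    show "p = \<kappa> i x m" if "\<forall>(j, n) \<in> colim_in M \<tau> i x m. \<kappa> j x n = p" for p
      using bspec[OF that 2] by simp
  qed
qed

theorem colim_universal:
  assumes N: "\<And>i. is_mod_map S (M i) N (\<kappa> i)"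
    and \<kappa>: "\<And>i x m. \<lbrakk>x \<in> Obj S; m \<in> carrier (val (M i) x)\<rbrakk> \<Longrightarrow> \<kappa> (Suc i) x (\<tau> i x m) = \<kappa> i x m"
  shows "is_mod_map S (colim S M \<tau>) N (colim_desc \<kappa>)"
    and "\<lbrakk>x \<in> Obj S; m \<in> carrier (val (M i) x)\<rbrakk> \<Longrightarrow>
      colim_desc \<kappa> x (colim_in M \<tau> i x m) = \<kappa> i x m"
    and "\<lbrakk>\<And>i x m. \<lbrakk>x \<in> Obj S; m \<in> carrier (val (M i) x)\<rbrakk> \<Longrightarrow>
        \<eta> x (colim_in M \<tau> i x m) = \<kappa> i x m;
      x \<in> Obj S; A \<in> carrier (val (colim S M \<tau>) x)\<rbrakk> \<Longrightarrow> \<eta> x A = colim_desc \<kappa> x A"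
proof -
  note [simp] = colim_desc_in[of N, OF N \<kappa>]
  show "is_mod_map S (colim S M \<tau>) N (colim_desc \<kappa>)"
    unfolding is_mod_map_def colim_val
  proof (intro conjI ballI allI)
    fix x assume x: "x \<in> Obj S"
    interpret G: comm_group "val (M j) x" for j using group_M x .
    have \<kappa>_hom: "\<kappa> i x \<in> hom (val (M i) x) (val N x)" for i
      using N x by (simp add: is_mod_map_def)
    show "colim_desc \<kappa> x \<in> hom (colim_group M \<tau> x) (val N x)"
    proof (rule homI)
      fix A assume A: "A \<in> carrier (colim_group M \<tau> x)"
      then show "colim_desc \<kappa> x A \<in> carrier (val N x)"
        using hom_in_carrier[OF \<kappa>_hom] x by (auto simp: carrier_colim_group)
      fix B assume B: "B \<in> carrier (colim_group M \<tau> x)"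
      obtain k a b where "a \<in> carrier (val (M k) x)" "b \<in> carrier (val (M k) x)"
        "A = colim_in M \<tau> k x a" "B = colim_in M \<tau> k x b"
        using colim_cases2[OF x A B] .
      then show "colim_desc \<kappa> x (A \<otimes>\<^bsub>colim_group M \<tau> x\<^esub> B) =
          colim_desc \<kappa> x A \<otimes>\<^bsub>val N x\<^esub> colim_desc \<kappa> x B"
        using hom_mult[OF \<kappa>_hom] x by (simp add: colim_mult)
    qed
  next
    fix x y f A assume f: "f \<in> Hom S x y" and A: "A \<in> carrier (colim_group M \<tau> y)"
    obtain k a where "a \<in> carrier (val (M k) y)" "A = colim_in M \<tau> k y a"
      using A by (auto simp: carrier_colim_group)
    then show "colim_desc \<kappa> x (res (colim S M \<tau>) f A) = res N f (colim_desc \<kappa> y A)"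
      using N[of k] f Hom_Obj[OF f] res_M[OF f] by (simp add: colim_res is_mod_map_def)
  qed
  show "\<lbrakk>x \<in> Obj S; m \<in> carrier (val (M i) x)\<rbrakk> \<Longrightarrow>
      colim_desc \<kappa> x (colim_in M \<tau> i x m) = \<kappa> i x m" by simp
  show "\<lbrakk>\<And>i x m. \<lbrakk>x \<in> Obj S; m \<in> carrier (val (M i) x)\<rbrakk> \<Longrightarrow>
        \<eta> x (colim_in M \<tau> i x m) = \<kappa> i x m;
      x \<in> Obj S; A \<in> carrier (val (colim S M \<tau>) x)\<rbrakk> \<Longrightarrow> \<eta> x A = colim_desc \<kappa> x A"
    by (auto simp: colim_val carrier_colim_group)
qed

end

subsection \<open>Triangles in Mod-S\<close>

text \<open>A sequence \<open>L \<rightarrow> M \<rightarrow> N \<rightarrow> \<Sigma>L\<close> in Mod-S is the tuple of its objects and its maps.\<close>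

type_synonym ('o, 'm, 'g) md_tri =
  "('o, 'm, 'g) md \<times> ('o, 'm, 'g) md \<times> ('o, 'm, 'g) md \<times>
   ('o \<Rightarrow> 'g \<Rightarrow> 'g) \<times> ('o \<Rightarrow> 'g \<Rightarrow> 'g) \<times> ('o \<Rightarrow> 'g \<Rightarrow> 'g)"

fun is_md_tri_iso ::
  "('o, 'm, 'z) tri_cat_scheme \<Rightarrow> ('o, 'm, 'g) md_tri \<Rightarrow> ('o, 'm, 'h) md_tri \<Rightarrow>
    ('o \<Rightarrow> 'g \<Rightarrow> 'h) \<Rightarrow> ('o \<Rightarrow> 'g \<Rightarrow> 'h) \<Rightarrow> ('o \<Rightarrow> 'g \<Rightarrow> 'h) \<Rightarrow> bool" where
  "is_md_tri_iso S (L, M, N, u, v, w) (L', M', N', u', v', w') p q r \<longleftrightarrow>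
     is_mod_iso S L L' p \<and> is_mod_iso S M M' q \<and> is_mod_iso S N N' r \<and>
     (\<forall>x \<in> Obj S.
        (\<forall>m \<in> carrier (val L x). q x (u x m) = u' x (p x m)) \<and>
        (\<forall>m \<in> carrier (val M x). r x (v x m) = v' x (q x m)) \<and>
        (\<forall>m \<in> carrier (val N x). md_shift_map S p x (w x m) = w' x (r x m)))"


section \<open>Yoneda maps\<close>

definition yon :: "('o, 'm, 'z) ab_cat_scheme \<Rightarrow> 'o \<Rightarrow> ('o, 'm, 'm) md" where
  "yon S s = \<lparr>val = (\<lambda>x. Hom_group S x s), res = (\<lambda>f g. g \<cdot>\<^bsub>S\<^esub> f)\<rparr>"

definition yon_map :: "('o, 'm, 'z) cat_scheme \<Rightarrow> 'm \<Rightarrow> 'o \<Rightarrow> 'm \<Rightarrow> 'm" where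
  "yon_map S f = (\<lambda>x g. f \<cdot>\<^bsub>S\<^esub> g)"

text \<open>For \<open>h : c \<rightarrow> \<Sigma>a\<close>, the map \<open>Y(c) \<rightarrow> Y(\<Sigma>a) = \<Sigma>Y(a)\<close>.\<close>

definition yon_bd :: "('o, 'm, 'z) tri_cat_scheme \<Rightarrow> 'm \<Rightarrow> 'o \<Rightarrow> 'm \<Rightarrow> 'm" where
  "yon_bd S h = (\<lambda>x g. UnshM S (h \<cdot>\<^bsub>S\<^esub> g))"

text \<open>The functor \<open>\<Y>(t) = Hom(F(-), t)\<close>.\<close>

definition ryon ::
  "('p, 'n, 'z) ab_cat_scheme \<Rightarrow> ('o, 'm, 'p, 'n) tri_fun \<Rightarrow> 'p \<Rightarrow> ('o, 'm, 'n) md" where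
  "ryon T F t = \<lparr>val = (\<lambda>x. Hom_group T (fob F x) t), res = (\<lambda>f g. g \<cdot>\<^bsub>T\<^esub> fmor F f)\<rparr>"

definition ryon_map :: "('p, 'n, 'z) cat_scheme \<Rightarrow> 'n \<Rightarrow> 'o \<Rightarrow> 'n \<Rightarrow> 'n" where
  "ryon_map T f = (\<lambda>x g. f \<cdot>\<^bsub>T\<^esub> g)"

text \<open>For \<open>w : C \<rightarrow> \<Sigma>A\<close>, the map \<open>\<Y>(C) \<rightarrow> \<Y>(\<Sigma>A) \<cong> \<Sigma>\<Y>(A)\<close>. The isomorphism
  \<open>\<Sigma>\<Y>(A) \<rightarrow> \<Y>(\<Sigma>A)\<close> sends \<open>k : F(\<Sigma>\<^sup>-\<^sup>1x) \<rightarrow> A\<close> to \<open>\<Sigma>k\<close> composed with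
  \<open>F(x) = F(\<Sigma>\<Sigma>\<^sup>-\<^sup>1x) \<rightarrow> \<Sigma>F(\<Sigma>\<^sup>-\<^sup>1x)\<close>.\<close>

definition ryon_bd ::
  "('o, 'm, 'y) tri_cat_scheme \<Rightarrow> ('p, 'n, 'z) tri_cat_scheme \<Rightarrow> ('o, 'm, 'p, 'n) tri_fun \<Rightarrow>
    'p \<Rightarrow> 'n \<Rightarrow> 'o \<Rightarrow> 'n \<Rightarrow> 'n" where
  "ryon_bd S T F A w = (\<lambda>x g.
     THE k. k \<in> Hom T (fob F (UnshO S x)) A \<and>
            ShM T k \<cdot>\<^bsub>T\<^esub> fsh F (UnshO S x) = w \<cdot>\<^bsub>T\<^esub> g)"

definition ryon_tri ::
  "('o, 'm, 'y) tri_cat_scheme \<Rightarrow> ('p, 'n, 'z) tri_cat_scheme \<Rightarrow> ('o, 'm, 'p, 'n) tri_fun \<Rightarrow>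
    'p \<Rightarrow> 'p \<Rightarrow> 'p \<Rightarrow> 'n \<Rightarrow> 'n \<Rightarrow> 'n \<Rightarrow> ('o, 'm, 'n) md_tri" where
  "ryon_tri S T F A B C u v w =
     (ryon T F A, ryon T F B, ryon T F C, ryon_map T u, ryon_map T v, ryon_bd S T F A w)"

definition ycolim ::
  "('o, 'm, 'z) ab_cat_scheme \<Rightarrow> ('o, 'm) sequence \<Rightarrow> ('o, 'm, (nat \<times> 'm) set) md" where
  "ycolim S E = colim S (\<lambda>n. yon S (sob E n)) (\<lambda>n. yon_map S (smap E n))"

definition ycolim_map ::
  "('o, 'm, 'z) ab_cat_scheme \<Rightarrow> ('o, 'm) sequence \<Rightarrow> (nat \<Rightarrow> 'm) \<Rightarrow>
    'o \<Rightarrow> (nat \<times> 'm) set \<Rightarrow> (nat \<times> 'm) set" where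
  "ycolim_map S E f =
     colim_map (\<lambda>n. yon S (sob E n)) (\<lambda>n. yon_map S (smap E n)) (\<lambda>n. yon_map S (f n))"

lemma (in additive_category) yon_module:
  assumes s: "s \<in> Obj C"
  shows "is_module C (yon C s)"
  unfolding is_module_def
proof (intro conjI ballI allI)
  fix x y f assume f: "f \<in> Hom C x y"
  show "res (yon C s) f \<in> hom (val (yon C s) y) (val (yon C s) x)"
    using f by (intro homI) (auto simp: yon_def Hom_group_def Comp_Hom Comp_Plus)
qed (auto simp: yon_def Hom_group_def Comp_Ident Comp_assoc Plus_Comp
      Hom_comm_group[OF _ s, unfolded Hom_group_def])

lemma (in additive_category) yon_map_mod_map:
  assumes f: "f \<in> Hom C s t"
  shows "is_mod_map C (yon C s) (yon C t) (yon_map C f)"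
  unfolding is_mod_map_def
proof (intro conjI ballI allI)
  fix x assume "x \<in> Obj C"
  show "yon_map C f x \<in> hom (val (yon C s) x) (val (yon C t) x)"
    using f by (intro homI) (auto simp: yon_def yon_map_def Hom_group_def Comp_Hom Plus_Comp)
qed (use f in \<open>auto simp: yon_def yon_map_def Hom_group_def Comp_assoc\<close>)

lemma (in additive_category) yon_md_sequence:
  assumes "is_sequence C E"
  shows "is_md_sequence C (\<lambda>n. yon C (sob E n)) (\<lambda>n. yon_map C (smap E n))"
  using assms by (auto simp: is_sequence_def is_md_sequence_def yon_module yon_map_mod_map)

text \<open>For \<open>h : c\<^sub>* \<rightarrow> \<Sigma>a\<^sub>*\<close>, the colimit of \<open>Y(c\<^sub>*) \<rightarrow> \<Sigma>Y(a\<^sub>*)\<close>; the target is the shift of the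
  colimit of \<open>Y(a\<^sub>*)\<close>, see \<open>colim_group_shift\<close>.\<close>

definition ycolim_bd ::
  "('o, 'm, 'z) tri_cat_scheme \<Rightarrow> ('o, 'm) sequence \<Rightarrow> (nat \<Rightarrow> 'm) \<Rightarrow>
    'o \<Rightarrow> (nat \<times> 'm) set \<Rightarrow> (nat \<times> 'm) set" where
  "ycolim_bd S a h =
     colim_map (\<lambda>n. md_shift S (yon S (sob a n))) (\<lambda>n. md_shift_map S (yon_map S (smap a n)))
       (\<lambda>n. yon_bd S (h n))"

text \<open>The colimit in Mod-S of the image of a sequence of triangles: a strong triangle if the
  sequence of triangles is Cauchy.\<close>

definition ycolim_tri ::
  "('o, 'm, 'z) tri_cat_scheme \<Rightarrow> ('o, 'm) sequence \<Rightarrow> ('o, 'm) sequence \<Rightarrow> ('o, 'm) sequence \<Rightarrow>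
    (nat \<Rightarrow> 'm) \<Rightarrow> (nat \<Rightarrow> 'm) \<Rightarrow> (nat \<Rightarrow> 'm) \<Rightarrow> ('o, 'm, (nat \<times> 'm) set) md_tri" where
  "ycolim_tri S a b c f g h =
     (ycolim S a, ycolim S b, ycolim S c, ycolim_map S b f, ycolim_map S c g, ycolim_bd S a h)"

text \<open>The natural map \<open>colim Y(E) \<rightarrow> \<Y>(X)\<close> induced by maps \<open>\<alpha> n : F(E\<^sub>n) \<rightarrow> X\<close>: it sends the class
  of \<open>g : x \<rightarrow> E\<^sub>n\<close> to \<open>\<alpha> n \<cdot> F(g)\<close>.\<close>

definition nat_map ::
  "('p, 'n, 'z) cat_scheme \<Rightarrow> ('o, 'm, 'p, 'n) tri_fun \<Rightarrow> (nat \<Rightarrow> 'n) \<Rightarrow>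
    'o \<Rightarrow> (nat \<times> 'm) set \<Rightarrow> 'n" where
  "nat_map T F \<alpha> = colim_desc (\<lambda>n x g. \<alpha> n \<cdot>\<^bsub>T\<^esub> fmor F g)"


section \<open>Good extensions\<close>

definition good_extension ::
  "('o, 'm, 'y) tri_cat_scheme \<Rightarrow> ('p, 'n, 'z) tri_cat_scheme \<Rightarrow> (nat \<Rightarrow> 'o set) \<Rightarrow>
    ('o, 'm, 'p, 'n) tri_fun \<Rightarrow> bool" where
  "good_extension S T M F \<longleftrightarrow>
     triangulated_functor S T F \<and> fully_faithful S T F \<and>
     (\<forall>a. is_Cauchy S M a \<longrightarrow>
        (\<exists>P i. is_coproduct T (\<lambda>n. fob F (sob a n)) P i) \<and>
        (\<forall>H \<iota>. is_hocolim T (image_seq F a) H \<iota> \<longrightarrow>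
           is_mod_iso S (ycolim S a) (ryon T F H) (nat_map T F \<iota>)))"

definition Lprime ::
  "('o, 'm, 'y) tri_cat_scheme \<Rightarrow> ('p, 'n, 'z) tri_cat_scheme \<Rightarrow> (nat \<Rightarrow> 'o set) \<Rightarrow>
    ('o, 'm, 'p, 'n) tri_fun \<Rightarrow> 'p set" where
  "Lprime S T M F =
     {X \<in> Obj T. \<exists>a \<alpha>. is_Cauchy S M a \<and> hocolim_presentation T (image_seq F a) X \<alpha>}"

text \<open>\<open>colim Y(f) = \<Y>(\<phi>)\<close> for a map of sequences \<open>f\<close> from \<open>a\<close> to \<open>b\<close>, where \<open>colim Y(a)\<close> and
  \<open>colim Y(b)\<close> are identified with \<open>\<Y>(A)\<close> and \<open>\<Y>(B)\<close> by means of \<open>\<alpha>\<close> and \<open>\<beta>\<close>.\<close>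

definition represents ::
  "('o, 'm, 'y) tri_cat_scheme \<Rightarrow> ('p, 'n, 'z) tri_cat_scheme \<Rightarrow> ('o, 'm, 'p, 'n) tri_fun \<Rightarrow>
    ('o, 'm) sequence \<Rightarrow> (nat \<Rightarrow> 'n) \<Rightarrow> ('o, 'm) sequence \<Rightarrow> (nat \<Rightarrow> 'n) \<Rightarrow>
    (nat \<Rightarrow> 'm) \<Rightarrow> 'n \<Rightarrow> bool" where
  "represents S T F a \<alpha> b \<beta> f \<phi> \<longleftrightarrow>
     (\<forall>x \<in> Obj S. \<forall>m \<in> carrier (val (ycolim S a) x).
        nat_map T F \<beta> x (ycolim_map S b f x m) = ryon_map T \<phi> x (nat_map T F \<alpha> x m))"

end

theory Submission
  imports Defs
begin

text \<open>
  Call the objects of \<open>\<^sup>\<bottom>M\<^sub>i\<close> test objects of level \<open>i\<close>. Sequences and their colimits are studied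
  through the functors \<open>Hom(F(x), -)\<close> for test objects \<open>x\<close>. Two facts make this
  enough inside \<open>S\<close>. First, every object of \<open>S\<close> is a test object of some level. Second, an
  object \<open>s\<close> that receives no nonzero map from the test objects of level \<open>n\<close> lies in \<open>M\<^sub>m\<close> for a suitable
  \<open>n\<close> depending on \<open>m\<close>: in the triangle \<open>E \<rightarrow> s \<rightarrow> D\<close> provided by the very good metric the first
  map vanishes, so \<open>s\<close> is a direct summand of \<open>D \<in> M\<^sub>m\<close> (\<open>M_if_orthogonal\<close>). Hence a sequence is
  Cauchy exactly when, for each level, its transition maps are eventually bijective on maps
  from test objects of that level.

  A cocone \<open>\<gamma>\<^sub>n : F(c\<^sub>n) \<rightarrow> X\<close> is an approximation of \<open>X\<close> if, for each level, \<open>\<gamma>\<^sub>n\<close> is eventually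
  bijective on maps from the test objects of that level. Homotopy colimits of Cauchy sequences are
  approximated by these sequences (\<open>presentation_approx\<close>), and an approximating sequence is
  Cauchy (\<open>approx_Cauchy\<close>). Approximations behave like colimits: a map \<open>F(x) \<rightarrow> X\<close> factors
  through \<open>F(c\<^sub>m)\<close> for all large \<open>m\<close>, and in only one way.

  Now let \<open>\<phi>\<^sub>* : a\<^sub>* \<rightarrow> b\<^sub>*\<close> lie over \<open>\<phi> : A \<rightarrow> B\<close>, and let \<open>A \<rightarrow> B \<rightarrow> C \<rightarrow> \<Sigma>A\<close> be distinguished.
  Complete each \<open>\<phi>\<^sub>n\<close> to a triangle with an arbitrary cone \<open>c\<^sub>n\<close> and an arbitrary fill-in
  \<open>\<gamma>\<^sub>n : F(c\<^sub>n) \<rightarrow> C\<close>. By the five lemma \<open>\<gamma>\<^sub>n\<close> is bijective on the test objects of a level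
  when \<open>\<alpha>\<^sub>n\<close> and \<open>\<beta>\<^sub>n\<close> are so at the next level; the extra level takes care of the shifts.
  So for \<open>m\<close> large there is exactly one \<open>\<kappa> : c\<^sub>n \<rightarrow> c\<^sub>m\<close> over \<open>C\<close>; the same uniqueness shows that
  \<open>\<kappa>\<close> commutes with the other maps of the triangles. A subsequence therefore carries a sequence
  of triangles, and \<open>c\<^sub>*\<close> is Cauchy because it approximates \<open>C\<close> (\<open>triangle_completion\<close>).

  Maps out of the \<open>F(x)\<close> cannot detect isomorphisms in \<open>T\<close> in general. They do so among the objects \<open>X\<close> with
  no nonzero map to any \<open>K\<close> for which \<open>Hom(F(-), K)\<close> vanishes: the cone of a map of such objects
  that is bijective on all \<open>Hom(F(x), -)\<close> is itself such a \<open>K\<close> and has no nonzero map to itself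
  (\<open>iso_if_visibly_iso\<close>). This class contains all homotopy colimits in question and
  is closed under cones, so it contains \<open>C\<close>, and the comparison map from the homotopy colimit of
  \<open>F(c\<^sub>*)\<close> to \<open>C\<close> is an isomorphism (\<open>hocolim_comparison\<close>). The closure properties of \<open>L'(S)\<close>
  follow, because its objects are exactly the objects of this class that have an approximation
  (\<open>Lprime_iff\<close>).
\<close>

section \<open>Arithmetic of morphisms in an additive category\<close>

context additive_category
begin

lemma Hom_objs:
  assumes "f \<in> Hom C a b"
  shows "a \<in> Obj C" "b \<in> Obj C"
  using assms Dom_closed Cod_closed by (auto simp: Hom_def)

lemma Hom_Dom_Cod:
  assumes "f \<in> Hom C a b"
  shows "Dom C f = a" "Cod C f = b"
  using assms by (auto simp: Hom_def)

lemma Hom_group_simps [simp]: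
  "carrier (Hom_group C a b) = Hom C a b"
  "mult (Hom_group C a b) = Plus C"
  "one (Hom_group C a b) = Zero C a b"
  by (simp_all add: Hom_group_def)

lemma Zero_Hom: "\<lbrakk>a \<in> Obj C; b \<in> Obj C\<rbrakk> \<Longrightarrow> Zero C a b \<in> Hom C a b"
  using monoid.one_closed[of "Hom_group C a b"] Hom_comm_group[of a b]
  by (simp add: comm_group_def group_def)

lemma Neg_eq_inv: "f \<in> Hom C a b \<Longrightarrow> Neg C f = inv\<^bsub>Hom_group C a b\<^esub> f"
  by (simp add: Neg_def Hom_Dom_Cod)

lemma Neg_Hom:
  assumes f: "f \<in> Hom C a b"
  shows "Neg C f \<in> Hom C a b"
proof -
  interpret G: comm_group "Hom_group C a b"
    using Hom_comm_group Hom_objs[OF f] by blast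
  show ?thesis using f G.inv_closed[of f] by (simp add: Neg_eq_inv[OF f])
qed

lemma Plus_Zero: "f \<in> Hom C a b \<Longrightarrow> Plus C f (Zero C a b) = f"
  and Zero_Plus: "f \<in> Hom C a b \<Longrightarrow> Plus C (Zero C a b) f = f"
  and Plus_Neg: "f \<in> Hom C a b \<Longrightarrow> Plus C f (Neg C f) = Zero C a b"
  and Neg_Neg: "f \<in> Hom C a b \<Longrightarrow> Neg C (Neg C f) = f"
  and Plus_commute: "\<lbrakk>f \<in> Hom C a b; g \<in> Hom C a b\<rbrakk> \<Longrightarrow> Plus C f g = Plus C g f"
  and Plus_assoc: "\<lbrakk>f \<in> Hom C a b; g \<in> Hom C a b; h \<in> Hom C a b\<rbrakk> \<Longrightarrow>
    Plus C (Plus C f g) h = Plus C f (Plus C g h)"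
proof -
  have G: "comm_group (Hom_group C a b)" if "f \<in> Hom C a b" for f
    using Hom_comm_group Hom_objs[OF that] by blast
  show "f \<in> Hom C a b \<Longrightarrow> Plus C f (Zero C a b) = f"
    using monoid.r_one[of "Hom_group C a b" f] G by (auto simp: comm_group_def group_def)
  show "f \<in> Hom C a b \<Longrightarrow> Plus C (Zero C a b) f = f"
    using monoid.l_one[of "Hom_group C a b" f] G by (auto simp: comm_group_def group_def)
  show "f \<in> Hom C a b \<Longrightarrow> Plus C f (Neg C f) = Zero C a b"
    using group.r_inv[of "Hom_group C a b" f] G by (auto simp: comm_group_def Neg_eq_inv)
  show "f \<in> Hom C a b \<Longrightarrow> Neg C (Neg C f) = f"
    using group.inv_inv[of "Hom_group C a b" f] G Neg_eq_inv[OF Neg_Hom, of f a b] Neg_eq_inv[of f a b]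
    by (auto simp: comm_group_def)
  show "\<lbrakk>f \<in> Hom C a b; g \<in> Hom C a b\<rbrakk> \<Longrightarrow> Plus C f g = Plus C g f"
    using comm_monoid.m_comm[of "Hom_group C a b" f g] G by (auto simp: comm_group_def)
  show "\<lbrakk>f \<in> Hom C a b; g \<in> Hom C a b; h \<in> Hom C a b\<rbrakk> \<Longrightarrow>
    Plus C (Plus C f g) h = Plus C f (Plus C g h)"
    using monoid.m_assoc[of "Hom_group C a b" f g h] G by (auto simp: comm_group_def group_def)
qed

lemma Plus_self_eq:
  assumes f: "f \<in> Hom C a b" and ff: "Plus C f f = f"
  shows "f = Zero C a b"
  by (metis Neg_Hom Plus_Neg Plus_Zero Plus_assoc f ff)

lemma Zero_Comp:
  assumes f: "f \<in> Hom C a b" and c: "c \<in> Obj C"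
  shows "Zero C b c \<cdot> f = Zero C a c"
proof (rule Plus_self_eq)
  have z: "Zero C b c \<in> Hom C b c" using Zero_Hom Hom_objs[OF f] c by blast
  then show "Zero C b c \<cdot> f \<in> Hom C a c" using Comp_Hom f by blast
  show "Plus C (Zero C b c \<cdot> f) (Zero C b c \<cdot> f) = Zero C b c \<cdot> f"
    using Comp_Plus[OF f z z] Plus_Zero[OF z] by simp
qed

lemma Comp_Zero:
  assumes f: "f \<in> Hom C b c" and a: "a \<in> Obj C"
  shows "f \<cdot> Zero C a b = Zero C a c"
proof (rule Plus_self_eq)
  have z: "Zero C a b \<in> Hom C a b" using Zero_Hom Hom_objs[OF f] a by blast
  then show "f \<cdot> Zero C a b \<in> Hom C a c" using Comp_Hom f by blast
  show "Plus C (f \<cdot> Zero C a b) (f \<cdot> Zero C a b) = f \<cdot> Zero C a b"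
    using Plus_Comp[OF z z f] Plus_Zero[OF z] by simp
qed

lemma Neg_unique:
  assumes f: "f \<in> Hom C a b" and g: "g \<in> Hom C a b" and fg: "Plus C f g = Zero C a b"
  shows "g = Neg C f"
proof -
  note n = Neg_Hom[OF f]
  have "g = Plus C (Plus C (Neg C f) f) g"
    using Zero_Plus[OF g] Plus_Neg[OF f] Plus_commute[OF f n] by simp
  also have "\<dots> = Neg C f"
    using Plus_assoc[OF n f g] fg Plus_Zero[OF n] by simp
  finally show ?thesis .
qed

lemma eq_iff_diff:
  assumes f: "f \<in> Hom C a b" and g: "g \<in> Hom C a b"
  shows "f = g \<longleftrightarrow> Plus C f (Neg C g) = Zero C a b"
  using Plus_Neg[OF g] Neg_unique[OF Neg_Hom[OF g] f] Plus_commute[OF f Neg_Hom[OF g]] Neg_Neg[OF g]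
  by auto

lemma Neg_Zero: "\<lbrakk>a \<in> Obj C; b \<in> Obj C\<rbrakk> \<Longrightarrow> Neg C (Zero C a b) = Zero C a b"
  by (metis Neg_Hom Plus_Neg Zero_Plus Zero_Hom)

lemma Comp_Neg:
  assumes f: "f \<in> Hom C a b" and g: "g \<in> Hom C b c"
  shows "g \<cdot> Neg C f = Neg C (g \<cdot> f)"
proof (rule Neg_unique)
  show "Plus C (g \<cdot> f) (g \<cdot> Neg C f) = Zero C a c"
    by (simp add: Plus_Comp[OF f Neg_Hom[OF f] g, symmetric] Comp_Zero[OF g] Hom_objs[OF f] Plus_Neg[OF f])
qed (rule Comp_Hom[OF f g], rule Comp_Hom[OF Neg_Hom[OF f] g])

lemma Neg_Comp:
  assumes f: "f \<in> Hom C a b" and g: "g \<in> Hom C b c"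
  shows "Neg C g \<cdot> f = Neg C (g \<cdot> f)"
proof (rule Neg_unique)
  show "Plus C (g \<cdot> f) (Neg C g \<cdot> f) = Zero C a c"
    by (simp add: Comp_Plus[OF f g Neg_Hom[OF g], symmetric] Zero_Comp[OF f] Hom_objs[OF g] Plus_Neg[OF g])
qed (rule Comp_Hom[OF f g], rule Comp_Hom[OF f Neg_Hom[OF g]])

lemma zero_object_Obj: "is_zero_object C z \<Longrightarrow> z \<in> Obj C"
  by (simp add: is_zero_object_def)

lemma zero_object_Hom_from:
  assumes "is_zero_object C z" "f \<in> Hom C z a"
  shows "f = Zero C z a"
proof -
  have "a \<in> Obj C" "z \<in> Obj C" using Hom_objs[OF assms(2)] by auto
  then show ?thesis using assms Zero_Hom[of z a] unfolding is_zero_object_def by blast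
qed

lemma zero_object_Hom_to:
  assumes "is_zero_object C z" "f \<in> Hom C a z"
  shows "f = Zero C a z"
proof -
  have "a \<in> Obj C" "z \<in> Obj C" using Hom_objs[OF assms(2)] by auto
  then show ?thesis using assms Zero_Hom[of a z] unfolding is_zero_object_def by blast
qed

lemma zero_objectI:
  assumes z: "z \<in> Obj C" and e: "Ident C z = Zero C z z"
  shows "is_zero_object C z"
  unfolding is_zero_object_def
proof (intro conjI ballI z)
  fix a assume a: "a \<in> Obj C"
  have "f = Zero C z a" if "f \<in> Hom C z a" for f
    by (metis that Comp_Ident Comp_Zero e z)
  then show "\<exists>!f. f \<in> Hom C z a" using Zero_Hom[OF z a] by blast
  have "f = Zero C a z" if "f \<in> Hom C a z" for f
    by (metis that Ident_Comp Zero_Comp e z)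
  then show "\<exists>!f. f \<in> Hom C a z" using Zero_Hom[OF a z] by blast
qed

lemma Comp_inj_onI:
  assumes u: "u \<in> Hom C a b"
    and ker: "\<And>g. \<lbrakk>g \<in> Hom C x a; u \<cdot> g = Zero C x b\<rbrakk> \<Longrightarrow> g = Zero C x a"
  shows "inj_on (\<lambda>g. u \<cdot> g) (Hom C x a)"
proof (rule inj_onI)
  fix g h assume g: "g \<in> Hom C x a" and h: "h \<in> Hom C x a" and e: "u \<cdot> g = u \<cdot> h"
  have "u \<cdot> Plus C g (Neg C h) = Plus C (u \<cdot> g) (Neg C (u \<cdot> h))"
    using Plus_Comp[OF g Neg_Hom[OF h] u] Comp_Neg[OF h u] by simp
  also have "\<dots> = Zero C x b"
    using Plus_Neg[OF Comp_Hom[OF h u]] e by simp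
  finally have "Plus C g (Neg C h) = Zero C x a"
    using ker[OF Plus_closed[OF g Neg_Hom[OF h]]] by blast
  then show "g = h" using eq_iff_diff[OF g h] by blast
qed

lemma is_iso_morE:
  assumes "is_iso_mor C f a b"
  obtains g where "f \<in> Hom C a b" "g \<in> Hom C b a" "g \<cdot> f = Ident C a" "f \<cdot> g = Ident C b"
  using assms by (auto simp: is_iso_mor_def)

lemma is_iso_mor_Ident: "a \<in> Obj C \<Longrightarrow> is_iso_mor C (Ident C a) a a"
  using Ident_Hom Comp_Ident unfolding is_iso_mor_def by blast

lemma iso_Comp_bij:
  assumes "is_iso_mor C f a b"
  shows "bij_betw (\<lambda>g. f \<cdot> g) (Hom C x a) (Hom C x b)"
proof -
  obtain f' where f': "f \<in> Hom C a b" "f' \<in> Hom C b a" "f' \<cdot> f = Ident C a" "f \<cdot> f' = Ident C b"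
    using is_iso_morE[OF assms] .
  show ?thesis
    by (rule bij_betwI[of _ _ _ "\<lambda>g. f' \<cdot> g"])
      (use f' Comp_Hom in \<open>auto simp: Comp_assoc[symmetric] Ident_Comp\<close>)
qed

lemma Comp_iso_bij:
  assumes "is_iso_mor C f a b"
  shows "bij_betw (\<lambda>g. g \<cdot> f) (Hom C b x) (Hom C a x)"
proof -
  obtain f' where f': "f \<in> Hom C a b" "f' \<in> Hom C b a" "f' \<cdot> f = Ident C a" "f \<cdot> f' = Ident C b"
    using is_iso_morE[OF assms] .
  show ?thesis
    by (rule bij_betwI[of _ _ _ "\<lambda>g. g \<cdot> f'"])
      (use f' Comp_Hom in \<open>auto simp: Comp_assoc Comp_Ident\<close>)
qed

lemma coproduct_ex:
  assumes "is_coproduct C E P i" "X \<in> Obj C" "\<And>n. e n \<in> Hom C (E n) X"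
  obtains g where "g \<in> Hom C P X" "\<And>n. g \<cdot> i n = e n"
proof -
  have "\<exists>!g. g \<in> Hom C P X \<and> (\<forall>n. g \<cdot> i n = e n)"
    using assms by (simp add: is_coproduct_def)
  then show thesis using that by blast
qed

lemma coproduct_ext:
  assumes P: "is_coproduct C E P i" and g: "g \<in> Hom C P X" and h: "h \<in> Hom C P X"
    and e: "\<And>n. g \<cdot> i n = h \<cdot> i n"
  shows "g = h"
proof -
  have "X \<in> Obj C" "\<And>n. g \<cdot> i n \<in> Hom C (E n) X"
    using P Hom_objs[OF g] Comp_Hom[OF _ g] by (auto simp: is_coproduct_def)
  then have "\<exists>!k. k \<in> Hom C P X \<and> (\<forall>n. k \<cdot> i n = g \<cdot> i n)"
    using P by (simp add: is_coproduct_def)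
  then show ?thesis using g h e by metis
qed

section \<open>Sequences and their subsequences\<close>

lemma strans_refl: "strans C E j j = Ident C (sob E j)"
  by (cases j) auto

lemma strans_Hom:
  assumes E: "is_sequence C E"
  shows "j \<le> k \<Longrightarrow> strans C E j k \<in> Hom C (sob E j) (sob E k)"
proof (induction k)
  case 0
  then show ?case using E Ident_Hom by (auto simp: is_sequence_def)
next
  case (Suc k)
  show ?case
  proof (cases "j = Suc k")
    case True
    then show ?thesis using E Ident_Hom strans_refl by (auto simp: is_sequence_def)
  next
    case False
    then show ?thesis using E Suc Comp_Hom by (auto simp: is_sequence_def)
  qed
qed

lemma is_sequence_subsequence:
  assumes "is_sequence C E" "strict_mono r"
  shows "is_sequence C (subsequence C r E)"
  using assms strans_Hom[OF assms(1)]
  by (auto simp: is_sequence_def subsequence_def strict_mono_less_eq)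

lemma seq_map_strans:
  assumes D: "is_sequence C D" and E: "is_sequence C E" and f: "seq_map C D E f"
  shows "j \<le> k \<Longrightarrow> f k \<cdot> strans C D j k = strans C E j k \<cdot> f j"
proof (induction k)
  case 0
  then show ?case using f Comp_Ident Ident_Comp unfolding seq_map_def by (metis strans.simps(1) le_0_eq)
next
  case (Suc k)
  show ?case
  proof (cases "j = Suc k")
    case True
    then show ?thesis
      using f Comp_Ident Ident_Comp unfolding seq_map_def by (metis strans_refl)
  next
    case False
    with Suc have jk: "j \<le> k" by simp
    have h: "smap D k \<in> Hom C (sob D k) (sob D (Suc k))" "smap E k \<in> Hom C (sob E k) (sob E (Suc k))"
      "\<And>n. f n \<in> Hom C (sob D n) (sob E n)" "f (Suc k) \<cdot> smap D k = smap E k \<cdot> f k"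
      using D E f by (auto simp: is_sequence_def seq_map_def)
    note sD = strans_Hom[OF D jk] and sE = strans_Hom[OF E jk]
    have "f (Suc k) \<cdot> (smap D k \<cdot> strans C D j k) = (f (Suc k) \<cdot> smap D k) \<cdot> strans C D j k"
      using Comp_assoc[OF sD h(1) h(3)] by simp
    also have "\<dots> = smap E k \<cdot> (f k \<cdot> strans C D j k)"
      using Comp_assoc[OF sD h(3) h(2)] h(4) by simp
    also have "\<dots> = smap E k \<cdot> (strans C E j k \<cdot> f j)" using Suc jk by simp
    also have "\<dots> = (smap E k \<cdot> strans C E j k) \<cdot> f j"
      using Comp_assoc[OF h(3) sE h(2)] by simp
    finally show ?thesis using jk by simp
  qed
qed

lemma seq_map_subsequence:
  assumes "is_sequence C D" "is_sequence C E" "seq_map C D E f" "strict_mono r"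
  shows "seq_map C (subsequence C r D) (subsequence C r E) (f \<circ> r)"
  using assms seq_map_strans[OF assms(1-3)]
  by (auto simp: seq_map_def subsequence_def strict_mono_less_eq)

end

section \<open>Exact sequences of morphisms in a triangulated category\<close>

context triangulated_category
begin

lemma ShO_Obj: "a \<in> Obj C \<Longrightarrow> ShO C a \<in> Obj C"
  using ShO_bij by (auto simp: bij_betw_def)

lemma UnshO_Obj: "a \<in> Obj C \<Longrightarrow> UnshO C a \<in> Obj C"
  and ShO_UnshO: "a \<in> Obj C \<Longrightarrow> ShO C (UnshO C a) = a"
  and UnshO_ShO: "a \<in> Obj C \<Longrightarrow> UnshO C (ShO C a) = a"
  using ShO_bij unfolding UnshO_def bij_betw_def
  by (auto simp: inv_into_into f_inv_into_f)

lemma Hom_Arr: "f \<in> Hom C a b \<Longrightarrow> f \<in> Arr C"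
  by (simp add: Hom_def)

lemma Arr_Hom: "f \<in> Arr C \<Longrightarrow> f \<in> Hom C (Dom C f) (Cod C f)"
  by (simp add: Hom_def)

lemma ShM_inject: "\<lbrakk>f \<in> Hom C a b; g \<in> Hom C c d\<rbrakk> \<Longrightarrow> ShM C f = ShM C g \<longleftrightarrow> f = g"
  using ShM_bij Hom_Arr unfolding bij_betw_def inj_on_def by blast

lemma ShM_UnshM: "f \<in> Hom C a b \<Longrightarrow> ShM C (UnshM C f) = f"
  and UnshM_ShM: "f \<in> Hom C a b \<Longrightarrow> UnshM C (ShM C f) = f"
  using ShM_bij Hom_Arr[of f] unfolding UnshM_def bij_betw_def
  by (auto simp: f_inv_into_f)

lemma UnshM_Hom:
  assumes f: "f \<in> Hom C a b"
  shows "UnshM C f \<in> Hom C (UnshO C a) (UnshO C b)"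
proof -
  let ?g = "UnshM C f"
  have g: "?g \<in> Arr C"
    using ShM_bij Hom_Arr[OF f] unfolding UnshM_def bij_betw_def by (auto simp: inv_into_into)
  then have "f \<in> Hom C (ShO C (Dom C ?g)) (ShO C (Cod C ?g))"
    using ShM_Hom[OF Arr_Hom] ShM_UnshM[OF f] by metis
  then have "ShO C (Dom C ?g) = a" "ShO C (Cod C ?g) = b"
    using Hom_Dom_Cod[OF f] Hom_Dom_Cod by metis+
  then have "Dom C ?g = UnshO C a" "Cod C ?g = UnshO C b"
    using UnshO_ShO Dom_closed Cod_closed g by metis+
  with g show ?thesis by (simp add: Hom_def)
qed

lemma UnshM_Hom_ShO:
  "\<lbrakk>f \<in> Hom C (ShO C a) (ShO C b); a \<in> Obj C; b \<in> Obj C\<rbrakk> \<Longrightarrow> UnshM C f \<in> Hom C a b"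
  using UnshM_Hom UnshO_ShO by metis

lemma ShM_Hom_bij:
  assumes "a \<in> Obj C" "b \<in> Obj C"
  shows "bij_betw (ShM C) (Hom C a b) (Hom C (ShO C a) (ShO C b))"
proof (rule bij_betwI[of _ _ _ "UnshM C"])
  show "ShM C \<in> Hom C a b \<rightarrow> Hom C (ShO C a) (ShO C b)" using ShM_Hom by blast
  show "UnshM C \<in> Hom C (ShO C a) (ShO C b) \<rightarrow> Hom C a b" using UnshM_Hom_ShO assms by blast
qed (use UnshM_ShM ShM_UnshM in blast)+

lemma UnshM_Comp:
  assumes f: "f \<in> Hom C a b" and g: "g \<in> Hom C b c"
  shows "UnshM C (g \<cdot> f) = UnshM C g \<cdot> UnshM C f"
  using ShM_Comp[OF UnshM_Hom[OF f] UnshM_Hom[OF g]] ShM_UnshM[OF f] ShM_UnshM[OF g]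
    UnshM_ShM[OF Comp_Hom[OF UnshM_Hom[OF f] UnshM_Hom[OF g]]] by simp

lemma UnshM_Plus:
  assumes f: "f \<in> Hom C a b" and g: "g \<in> Hom C a b"
  shows "UnshM C (Plus C f g) = Plus C (UnshM C f) (UnshM C g)"
  using ShM_Plus[OF UnshM_Hom[OF f] UnshM_Hom[OF g]] ShM_UnshM[OF f] ShM_UnshM[OF g]
    UnshM_ShM[OF Plus_closed[OF UnshM_Hom[OF f] UnshM_Hom[OF g]]] by simp

lemma ShM_Zero:
  assumes "a \<in> Obj C" "b \<in> Obj C"
  shows "ShM C (Zero C a b) = Zero C (ShO C a) (ShO C b)"
proof -
  note z = Zero_Hom[OF assms]
  show ?thesis
    using Plus_self_eq[OF ShM_Hom[OF z]] ShM_Plus[OF z z] Zero_Plus[OF z] by simp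
qed

lemma ShM_eq_Zero:
  assumes f: "f \<in> Hom C a b"
  shows "ShM C f = Zero C (ShO C a) (ShO C b) \<longleftrightarrow> f = Zero C a b"
  using ShM_inject[OF f Zero_Hom[OF Hom_objs[OF f]]] ShM_Zero[OF Hom_objs[OF f]] by simp

lemma Neg_eq_Zero: "f \<in> Hom C a b \<Longrightarrow> Neg C f = Zero C a b \<longleftrightarrow> f = Zero C a b"
  using Neg_Neg[of f a b] Neg_Zero[of a b] Hom_objs[of f a b] by auto

lemma ShO_zero_object:
  assumes z: "is_zero_object C z"
  shows "is_zero_object C (ShO C z)"
proof (rule zero_objectI)
  note o = zero_object_Obj[OF z]
  show "ShO C z \<in> Obj C" using ShO_Obj[OF o] .
  show "Ident C (ShO C z) = Zero C (ShO C z) (ShO C z)"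
    using zero_object_Hom_from[OF z Ident_Hom[OF o]] ShM_Ident[OF o] ShM_Zero[OF o o] by simp
qed

lemma Dist_rotate:
  assumes "f \<in> Hom C a b" "g \<in> Hom C b c" "h \<in> Hom C c (ShO C a)" "Dist C f g h"
  shows "Dist C g h (Neg C (ShM C f))" "Neg C (ShM C f) \<in> Hom C (ShO C a) (ShO C b)"
  using assms TR2 Neg_Hom ShM_Hom by blast+

lemma Dist_comp_zero:
  assumes f: "f \<in> Hom C a b" and g: "g \<in> Hom C b c" and h: "h \<in> Hom C c (ShO C a)"
    and d: "Dist C f g h"
  shows "g \<cdot> f = Zero C a c"
proof -
  obtain z where z: "is_zero_object C z" using ex_zero_object by blast
  note o = Hom_objs[OF f] Hom_objs[OF g] zero_object_Obj[OF z]
  have "\<exists>w \<in> Hom C z c. g \<cdot> f = w \<cdot> Zero C a z \<and> h \<cdot> w = ShM C (Ident C a) \<cdot> Zero C z (ShO C a)"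
    by (rule TR3[OF TR1_Ident[OF o(1) z] Ident_Hom[OF o(1)] Zero_Hom Zero_Hom d f g h Ident_Hom[OF o(1)] f])
      (use o ShO_Obj in auto)
  then show ?thesis using Comp_Zero o by metis
qed

text \<open>Mapping the triangle \<open>x \<rightarrow> 0 \<rightarrow> \<Sigma>x \<rightarrow> \<Sigma>x\<close> to the rotated triangle \<open>b \<rightarrow> c \<rightarrow> \<Sigma>a \<rightarrow> \<Sigma>b\<close>,
  with \<open>u\<close> as the first component, gives a fill-in \<open>\<Sigma>x \<rightarrow> \<Sigma>a\<close> whose desuspension is the
  required \<open>u'\<close>. The last maps of both triangles carry a sign, and these two signs cancel.\<close>

lemma Dist_exact:
  assumes f: "f \<in> Hom C a b" and g: "g \<in> Hom C b c" and h: "h \<in> Hom C c (ShO C a)"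
    and d: "Dist C f g h" and u: "u \<in> Hom C x b" and gu: "g \<cdot> u = Zero C x c"
  obtains u' where "u' \<in> Hom C x a" "u = f \<cdot> u'"
proof -
  obtain z where z: "is_zero_object C z" using ex_zero_object by blast
  note o = Hom_objs[OF f] Hom_objs[OF g] Hom_objs[OF u] zero_object_Obj[OF z]
  note sx = ShO_Obj[OF o(5)]
  have t: "Dist C (Zero C x z) (Zero C z (ShO C x)) (Neg C (ShM C (Ident C x)))"
    "Neg C (ShM C (Ident C x)) \<in> Hom C (ShO C x) (ShO C x)"
    using Dist_rotate[OF Ident_Hom[OF o(5)] Zero_Hom Zero_Hom TR1_Ident[OF o(5) z]] o sx by auto
  have "\<exists>w \<in> Hom C (ShO C x) (ShO C a). h \<cdot> Zero C z c = w \<cdot> Zero C z (ShO C x) \<and>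
      Neg C (ShM C f) \<cdot> w = ShM C u \<cdot> Neg C (ShM C (Ident C x))"
  proof (rule TR3[OF t(1) Zero_Hom Zero_Hom t(2) Dist_rotate(1)[OF f g h d] g h
      Dist_rotate(2)[OF f g h d] u Zero_Hom])
    show "g \<cdot> u = Zero C z c \<cdot> Zero C x z"
      using gu Zero_Comp[OF Zero_Hom] o by simp
  qed (use o sx in auto)
  then obtain w where w: "w \<in> Hom C (ShO C x) (ShO C a)"
    "Neg C (ShM C f) \<cdot> w = ShM C u \<cdot> Neg C (ShM C (Ident C x))" by blast
  let ?w = "UnshM C w"
  have w': "?w \<in> Hom C x a" using UnshM_Hom_ShO w(1) o by blast
  have "Neg C (ShM C f \<cdot> w) = Neg C (ShM C u)"
    using w(2) Neg_Comp[OF w(1) ShM_Hom[OF f]] Comp_Neg[OF ShM_Hom[OF Ident_Hom] ShM_Hom[OF u]]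
      ShM_Comp[OF Ident_Hom u] Comp_Ident[OF u] o by metis
  then have "ShM C f \<cdot> w = ShM C u"
    using Neg_Neg Comp_Hom[OF w(1) ShM_Hom[OF f]] ShM_Hom[OF u] by metis
  then have "ShM C (f \<cdot> ?w) = ShM C u"
    using ShM_Comp[OF w' f] ShM_UnshM[OF w(1)] by simp
  then have "u = f \<cdot> ?w"
    using ShM_inject[OF Comp_Hom[OF w' f] u] by simp
  with w' show thesis using that by blast
qed

text \<open>Dually, map the given triangle to \<open>z \<rightarrow> x \<rightarrow> x \<rightarrow> \<Sigma>z\<close> for a zero object \<open>z\<close>; this is the
  rotation back of the triangle on the identity of \<open>x\<close> whose cone is \<open>\<Sigma>z\<close>.\<close>

lemma Dist_coexact:
  assumes f: "f \<in> Hom C a b" and g: "g \<in> Hom C b c" and h: "h \<in> Hom C c (ShO C a)"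
    and d: "Dist C f g h" and k: "k \<in> Hom C b x" and kf: "k \<cdot> f = Zero C a x"
  obtains k' where "k' \<in> Hom C c x" "k = k' \<cdot> g"
proof -
  obtain z where z: "is_zero_object C z" using ex_zero_object by blast
  note o = Hom_objs[OF f] Hom_objs[OF g] Hom_objs[OF k] zero_object_Obj[OF z]
  note sz = ShO_Obj[OF o(7)] and sx = ShO_Obj[OF o(6)]
  have "Neg C (ShM C (Zero C z x)) = Zero C (ShO C z) (ShO C x)"
    using ShM_Zero Neg_Zero o sz sx by simp
  then have t: "Dist C (Zero C z x) (Ident C x) (Zero C x (ShO C z))"
    using TR2[OF Zero_Hom[OF o(7) o(6)] Ident_Hom[OF o(6)] Zero_Hom[OF o(6) sz]]
      TR1_Ident[OF o(6) ShO_zero_object[OF z]] by simp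
  have "\<exists>w \<in> Hom C c x. Ident C x \<cdot> k = w \<cdot> g \<and> Zero C x (ShO C z) \<cdot> w = ShM C (Zero C a z) \<cdot> h"
  proof (rule TR3[OF d f g h t Zero_Hom Ident_Hom Zero_Hom Zero_Hom k])
    show "Zero C z x \<cdot> Zero C a z = k \<cdot> f"
      using kf Zero_Comp[OF Zero_Hom] o by simp
  qed (use o sz in auto)
  then show thesis using that Ident_Comp[OF k] by metis
qed

lemma Dist_exact_shift:
  assumes f: "f \<in> Hom C a b" and g: "g \<in> Hom C b c" and h: "h \<in> Hom C c (ShO C a)"
    and d: "Dist C f g h" and u: "u \<in> Hom C x (ShO C a)"
    and fu: "ShM C f \<cdot> u = Zero C x (ShO C b)"
  obtains u' where "u' \<in> Hom C x c" "u = h \<cdot> u'"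
proof -
  have "Neg C (ShM C f) \<cdot> u = Zero C x (ShO C b)"
    using Neg_Comp[OF u ShM_Hom[OF f]] fu Neg_Zero Hom_objs[OF u] Hom_objs[OF ShM_Hom[OF f]] by simp
  then show thesis
    using Dist_exact[OF h Dist_rotate(2)[OF f g h d] _ _ u, of "Neg C (ShM C g)"]
      that TR2[OF g h Dist_rotate(2)[OF f g h d]] Dist_rotate(1)[OF f g h d]
      Neg_Hom[OF ShM_Hom[OF g]] by blast
qed

lemma Dist_comp_zero':
  assumes f: "f \<in> Hom C a b" and g: "g \<in> Hom C b c" and h: "h \<in> Hom C c (ShO C a)"
    and d: "Dist C f g h"
  shows "h \<cdot> g = Zero C b (ShO C a)" "ShM C f \<cdot> h = Zero C c (ShO C b)"
proof -
  note r = Dist_rotate[OF f g h d]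
  show "h \<cdot> g = Zero C b (ShO C a)"
    using Dist_comp_zero[OF g h r(2) r(1)] .
  have "Neg C (ShM C f) \<cdot> h = Zero C c (ShO C b)"
    using Dist_comp_zero[OF h r(2) _ iffD1[OF TR2[OF g h r(2)] r(1)]] Neg_Hom ShM_Hom[OF g] by blast
  then show "ShM C f \<cdot> h = Zero C c (ShO C b)"
    using Neg_Comp[OF h ShM_Hom[OF f]] Neg_eq_Zero[OF Comp_Hom[OF h ShM_Hom[OF f]]] by simp
qed

lemma cone_exists:
  assumes f: "f \<in> Hom C a b"
  obtains c g h where "Dist C f g h" "g \<in> Hom C b c" "h \<in> Hom C c (ShO C a)"
proof -
  obtain g h where d: "Dist C f g h" using TR1_cone Hom_Arr[OF f] by blast
  obtain a' b' c where "f \<in> Hom C a' b'" "g \<in> Hom C b' c" "h \<in> Hom C c (ShO C a')"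
    using Dist_typed[OF d] by blast
  with f d that show thesis using Hom_Dom_Cod by metis
qed

lemma Dist_types:
  assumes d: "Dist C f g h"
  obtains "f \<in> Hom C (Dom C f) (Cod C f)" "g \<in> Hom C (Cod C f) (Cod C g)"
    "h \<in> Hom C (Cod C g) (ShO C (Dom C f))"
proof -
  obtain a b c where "f \<in> Hom C a b" "g \<in> Hom C b c" "h \<in> Hom C c (ShO C a)"
    using Dist_typed[OF d] by blast
  then show thesis using that by (simp add: Hom_Dom_Cod)
qed

text \<open>The five lemma for the functor \<open>Hom(x, -)\<close> at the third objects of two triangles. The fifth
  term of the exact sequence is \<open>Hom(x, \<Sigma>b)\<close>, which is why bijectivity on the shifts is assumed.\<close>

lemma five_lemma:
  assumes d: "Dist C f g h" "f \<in> Hom C a b" "g \<in> Hom C b c" "h \<in> Hom C c (ShO C a)"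
    and d': "Dist C f' g' h'" "f' \<in> Hom C a' b'" "g' \<in> Hom C b' c'" "h' \<in> Hom C c' (ShO C a')"
    and u: "u \<in> Hom C a a'" and v: "v \<in> Hom C b b'" and w: "w \<in> Hom C c c'"
    and uv: "f' \<cdot> u = v \<cdot> f" and vw: "g' \<cdot> v = w \<cdot> g" and wu: "h' \<cdot> w = ShM C u \<cdot> h"
    and bu: "bij_betw (\<lambda>k. u \<cdot> k) (Hom C x a) (Hom C x a')"
    and bv: "bij_betw (\<lambda>k. v \<cdot> k) (Hom C x b) (Hom C x b')"
    and bsu: "bij_betw (\<lambda>k. ShM C u \<cdot> k) (Hom C x (ShO C a)) (Hom C x (ShO C a'))"
    and bsv: "bij_betw (\<lambda>k. ShM C v \<cdot> k) (Hom C x (ShO C b)) (Hom C x (ShO C b'))"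
    and x: "x \<in> Obj C"
  shows "bij_betw (\<lambda>k. w \<cdot> k) (Hom C x c) (Hom C x c')"
proof -
  note o = Hom_objs[OF u] Hom_objs[OF v] Hom_objs[OF w]
  have inj: "k = Zero C x p"
    if "bij_betw (\<lambda>k. t \<cdot> k) (Hom C x p) (Hom C x q)" "t \<in> Hom C p q" "k \<in> Hom C x p"
      "t \<cdot> k = Zero C x q" for t p q k
  proof -
    have "t \<cdot> k = t \<cdot> Zero C x p" using that Comp_Zero x by simp
    then show ?thesis
      using that Zero_Hom[OF x] Hom_objs[OF that(2)] unfolding bij_betw_def inj_on_def by blast
  qed
  have surj: "\<exists>k' \<in> Hom C x p. t \<cdot> k' = k"
    if "bij_betw (\<lambda>k. t \<cdot> k) (Hom C x p) (Hom C x q)" "k \<in> Hom C x q" for t p q k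
    using that by (metis (no_types, lifting) bij_betw_imp_surj_on imageE)
  have wk: "w \<cdot> k \<in> Hom C x c'" if "k \<in> Hom C x c" for k using Comp_Hom[OF that w] .
  have "inj_on (\<lambda>k. w \<cdot> k) (Hom C x c)"
  proof (rule Comp_inj_onI[OF w])
    fix q assume q: "q \<in> Hom C x c" and wq: "w \<cdot> q = Zero C x c'"
    have "ShM C u \<cdot> (h \<cdot> q) = h' \<cdot> (w \<cdot> q)"
      using Comp_assoc[OF q d(4) ShM_Hom[OF u]] Comp_assoc[OF q w d'(4)] wu by simp
    also have "\<dots> = Zero C x (ShO C a')" using wq Comp_Zero[OF d'(4) x] by simp
    finally have "h \<cdot> q = Zero C x (ShO C a)"
      using inj[OF bsu ShM_Hom[OF u] Comp_Hom[OF q d(4)]] by simp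
    then obtain y where y: "y \<in> Hom C x b" "q = g \<cdot> y"
      using Dist_exact[OF d(3,4) Dist_rotate(2)[OF d(2-4,1)] Dist_rotate(1)[OF d(2-4,1)] q] by blast
    have "g' \<cdot> (v \<cdot> y) = Zero C x c'"
      using Comp_assoc[OF y(1) v d'(3)] Comp_assoc[OF y(1) d(3) w] vw wq y(2) by simp
    then obtain z' where z': "z' \<in> Hom C x a'" "v \<cdot> y = f' \<cdot> z'"
      using Dist_exact[OF d'(2-4,1) Comp_Hom[OF y(1) v]] by blast
    obtain z where z: "z \<in> Hom C x a" "u \<cdot> z = z'" using surj[OF bu z'(1)] by blast
    have "v \<cdot> y = v \<cdot> (f \<cdot> z)"
      using z z' Comp_assoc[OF z(1) u d'(2)] Comp_assoc[OF z(1) d(2) v] uv by simp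
    then have "y = f \<cdot> z"
      using bv y(1) Comp_Hom[OF z(1) d(2)] unfolding bij_betw_def inj_on_def by blast
    then have "q = (g \<cdot> f) \<cdot> z" using y(2) Comp_assoc[OF z(1) d(2,3)] by simp
    then show "q = Zero C x c"
      using Dist_comp_zero[OF d(2-4,1)] Zero_Comp[OF z(1)] o by simp
  qed
  moreover have "k \<in> (\<lambda>k. w \<cdot> k) ` Hom C x c" if k: "k \<in> Hom C x c'" for k
  proof -
    obtain p where p: "p \<in> Hom C x (ShO C a)" "ShM C u \<cdot> p = h' \<cdot> k"
      using surj[OF bsu Comp_Hom[OF k d'(4)]] by blast
    have s: "ShM C v \<cdot> ShM C f = ShM C f' \<cdot> ShM C u"
      using ShM_Comp[OF d(2) v] ShM_Comp[OF u d'(2)] uv by simp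
    have "ShM C v \<cdot> (ShM C f \<cdot> p) = ShM C f' \<cdot> (h' \<cdot> k)"
      using Comp_assoc[OF p(1) ShM_Hom[OF d(2)] ShM_Hom[OF v]]
        Comp_assoc[OF p(1) ShM_Hom[OF u] ShM_Hom[OF d'(2)]] s p(2) by simp
    also have "\<dots> = Zero C x (ShO C b')"
      using Comp_assoc[OF k d'(4) ShM_Hom[OF d'(2)]] Dist_comp_zero'(2)[OF d'(2-4,1)]
        Zero_Comp[OF k] ShO_Obj o by simp
    finally have "ShM C f \<cdot> p = Zero C x (ShO C b)"
      using inj[OF bsv ShM_Hom[OF v] Comp_Hom[OF p(1) ShM_Hom[OF d(2)]]] by simp
    then obtain q where q: "q \<in> Hom C x c" "p = h \<cdot> q"
      using Dist_exact_shift[OF d(2-4,1) p(1)] by blast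
    have hq: "h' \<cdot> (w \<cdot> q) = h' \<cdot> k"
      using Comp_assoc[OF q(1) w d'(4)] Comp_assoc[OF q(1) d(4) ShM_Hom[OF u]] wu q(2) p(2) by simp
    \<comment> \<open>\<open>w \<cdot> q\<close> and \<open>k\<close> agree after \<open>h'\<close>; their difference comes from \<open>b'\<close> and corrects \<open>q\<close>\<close>
    let ?e = "Plus C k (Neg C (w \<cdot> q))"
    have e: "?e \<in> Hom C x c'" using Plus_closed[OF k Neg_Hom[OF wk[OF q(1)]]] .
    have "h' \<cdot> ?e = Plus C (h' \<cdot> k) (Neg C (h' \<cdot> (w \<cdot> q)))"
      using Plus_Comp[OF k Neg_Hom[OF wk[OF q(1)]] d'(4)] Comp_Neg[OF wk[OF q(1)] d'(4)] by simp
    also have "\<dots> = Zero C x (ShO C a')" using hq Plus_Neg[OF Comp_Hom[OF k d'(4)]] by simp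
    finally obtain y' where y': "y' \<in> Hom C x b'" "?e = g' \<cdot> y'"
      using Dist_exact[OF d'(3,4) Dist_rotate(2)[OF d'(2-4,1)] Dist_rotate(1)[OF d'(2-4,1)] e] by blast
    obtain y where y: "y \<in> Hom C x b" "v \<cdot> y = y'" using surj[OF bv y'(1)] by blast
    have gy: "g \<cdot> y \<in> Hom C x c" using Comp_Hom[OF y(1) d(3)] .
    have "?e = w \<cdot> (g \<cdot> y)"
      using y' y Comp_assoc[OF y(1) v d'(3)] Comp_assoc[OF y(1) d(3) w] vw by simp
    then have "Plus C (w \<cdot> (g \<cdot> y)) (w \<cdot> q) = Plus C ?e (w \<cdot> q)" by simp
    also have "\<dots> = k"
      using Plus_assoc[OF k Neg_Hom[OF wk[OF q(1)]] wk[OF q(1)]] Plus_Neg[OF wk[OF q(1)]]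
        Plus_commute[OF wk[OF q(1)] Neg_Hom[OF wk[OF q(1)]]] Plus_Zero[OF k] by simp
    finally have "k = w \<cdot> Plus C (g \<cdot> y) q" using Plus_Comp[OF gy q(1) w] by simp
    then show ?thesis using Plus_closed[OF gy q(1)] by blast
  qed
  ultimately show ?thesis using wk unfolding bij_betw_def by blast
qed

text \<open>\<open>Hom(x, c)\<close> sits between the cokernel of \<open>Hom(x, a) \<rightarrow> Hom(x, b)\<close> and the kernel of
  \<open>Hom(x, \<Sigma>a) \<rightarrow> Hom(x, \<Sigma>b)\<close>. This and the next lemma translate between membership of a cone
  in a right orthogonal and bijectivity of a map on test objects.\<close>

lemma cone_Hom_zero:
  assumes f: "f \<in> Hom C a b" and g: "g \<in> Hom C b c" and h: "h \<in> Hom C c (ShO C a)"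
    and d: "Dist C f g h"
    and surj: "\<And>k. k \<in> Hom C x b \<Longrightarrow> \<exists>l \<in> Hom C x a. f \<cdot> l = k"
    and inj: "\<And>k. \<lbrakk>k \<in> Hom C x (ShO C a); ShM C f \<cdot> k = Zero C x (ShO C b)\<rbrakk> \<Longrightarrow> k = Zero C x (ShO C a)"
    and u: "u \<in> Hom C x c"
  shows "u = Zero C x c"
proof -
  note o = Hom_objs[OF f] Hom_objs[OF g]
  have "ShM C f \<cdot> (h \<cdot> u) = Zero C x (ShO C b)"
    using Comp_assoc[OF u h ShM_Hom[OF f]] Dist_comp_zero'(2)[OF f g h d] Zero_Comp[OF u] ShO_Obj o
    by simp
  then have "h \<cdot> u = Zero C x (ShO C a)" using inj Comp_Hom[OF u h] by blast
  then obtain y where y: "y \<in> Hom C x b" "u = g \<cdot> y"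
    using Dist_exact[OF g h Dist_rotate(2)[OF f g h d] Dist_rotate(1)[OF f g h d] u] by blast
  obtain l where l: "l \<in> Hom C x a" "f \<cdot> l = y" using surj[OF y(1)] by blast
  have "u = (g \<cdot> f) \<cdot> l" using y l Comp_assoc[OF l(1) f g] by simp
  then show ?thesis using Dist_comp_zero[OF f g h d] Zero_Comp[OF l(1)] o by simp
qed

text \<open>The kernel of \<open>Hom(x, a) \<rightarrow> Hom(x, b)\<close> is controlled by \<open>Hom(x, \<Sigma>\<^sup>-\<^sup>1c)\<close>, which is
  \<open>Hom(\<Sigma>x, c)\<close>.\<close>

lemma bij_if_cone_Hom_zero:
  assumes f: "f \<in> Hom C a b" and g: "g \<in> Hom C b c" and h: "h \<in> Hom C c (ShO C a)"
    and d: "Dist C f g h"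
    and z: "Hom C x c = {Zero C x c}" and sz: "Hom C (ShO C x) c = {Zero C (ShO C x) c}"
  shows "bij_betw (\<lambda>k. f \<cdot> k) (Hom C x a) (Hom C x b)"
proof -
  have "inj_on (\<lambda>k. f \<cdot> k) (Hom C x a)"
  proof (rule Comp_inj_onI[OF f])
    fix u assume u: "u \<in> Hom C x a" and fu: "f \<cdot> u = Zero C x b"
    have "ShM C f \<cdot> ShM C u = Zero C (ShO C x) (ShO C b)"
      using ShM_Comp[OF u f] fu ShM_Zero Hom_objs[OF f] Hom_objs[OF u] by simp
    then obtain y where y: "y \<in> Hom C (ShO C x) c" "ShM C u = h \<cdot> y"
      using Dist_exact_shift[OF f g h d ShM_Hom[OF u]] by blast
    then have "ShM C u = Zero C (ShO C x) (ShO C a)"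
      using sz Comp_Zero[OF h] ShO_Obj Hom_objs[OF u] by auto
    then show "u = Zero C x a" using ShM_eq_Zero[OF u] by blast
  qed
  moreover have "k \<in> (\<lambda>k. f \<cdot> k) ` Hom C x a" if k: "k \<in> Hom C x b" for k
    using Dist_exact[OF f g h d k] z Comp_Hom[OF k g] by blast
  ultimately show ?thesis using Comp_Hom[OF _ f] unfolding bij_betw_def by blast
qed

lemma iso_if_cone_zero:
  assumes f: "f \<in> Hom C a b" and g: "g \<in> Hom C b c" and h: "h \<in> Hom C c (ShO C a)"
    and d: "Dist C f g h" and c: "is_zero_object C c"
  shows "is_iso_mor C f a b"
proof -
  have b: "bij_betw (\<lambda>k. f \<cdot> k) (Hom C x a) (Hom C x b)" if "x \<in> Obj C" for x
    by (rule bij_if_cone_Hom_zero[OF f g h d])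
      (use that c zero_object_Hom_to Zero_Hom zero_object_Obj ShO_Obj in blast)+
  note o = Hom_objs[OF f]
  have i: "Ident C a \<in> Hom C a a" "Ident C b \<in> Hom C b b" using Ident_Hom o by auto
  obtain k where k: "k \<in> Hom C b a" "f \<cdot> k = Ident C b"
    using b[OF o(2)] i(2) unfolding bij_betw_def by (metis (no_types, lifting) imageE)
  have "f \<cdot> (k \<cdot> f) = f \<cdot> Ident C a"
    using Comp_assoc[OF f k(1) f] k(2) Ident_Comp[OF f] Comp_Ident[OF f] by simp
  then have "k \<cdot> f = Ident C a"
    using b[OF o(1)] i(1) Comp_Hom[OF f k(1)] unfolding bij_betw_def inj_on_def by blast
  then show ?thesis using f k unfolding is_iso_mor_def by blast
qed

text \<open>A retraction \<open>p\<close> of \<open>g\<close> and a section \<open>j\<close> of \<open>h\<close> exist by exactness; they need not satisfy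
  \<open>p \<cdot> j = 0\<close>, so the section is corrected. Thus a cone of a zero map is a biproduct.\<close>

lemma cone_of_zero_biproduct:
  assumes f: "a \<in> Obj C" "b \<in> Obj C" and g: "g \<in> Hom C b c" and h: "h \<in> Hom C c (ShO C a)"
    and d: "Dist C (Zero C a b) g h"
  obtains p j where "p \<in> Hom C c b" "j \<in> Hom C (ShO C a) c" "p \<cdot> g = Ident C b"
    "h \<cdot> j = Ident C (ShO C a)" "h \<cdot> g = Zero C b (ShO C a)" "p \<cdot> j = Zero C (ShO C a) b"
    "Plus C (g \<cdot> p) (j \<cdot> h) = Ident C c"
proof -
  let ?a = "ShO C a"
  note z = Zero_Hom[OF f]
  have sa: "?a \<in> Obj C" and c: "c \<in> Obj C" using ShO_Obj f Hom_objs[OF g] by auto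
  have "Ident C b \<cdot> Zero C a b = Zero C a b" using Ident_Comp[OF z] .
  then obtain p where p: "p \<in> Hom C c b" "p \<cdot> g = Ident C b"
    using Dist_coexact[OF z g h d Ident_Hom[OF f(2)]] by metis
  have "ShM C (Zero C a b) \<cdot> Ident C ?a = Zero C ?a (ShO C b)"
    using ShM_Zero[OF f] Zero_Comp[OF Ident_Hom[OF sa]] ShO_Obj f by simp
  then obtain j where j: "j \<in> Hom C ?a c" "h \<cdot> j = Ident C ?a"
    using Dist_exact_shift[OF z g h d Ident_Hom[OF sa]] by metis
  have hg: "h \<cdot> g = Zero C b ?a" using Dist_comp_zero'(1)[OF z g h d] .
  have pj: "p \<cdot> j \<in> Hom C ?a b" using Comp_Hom j p by blast
  have gpj: "g \<cdot> (p \<cdot> j) \<in> Hom C ?a c" using Comp_Hom[OF pj g] .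
  \<comment> \<open>the component of \<open>j\<close> in \<open>b\<close> is removed; \<open>h\<close> does not see it\<close>
  define j' where "j' = Plus C j (Neg C (g \<cdot> (p \<cdot> j)))"
  have j': "j' \<in> Hom C ?a c" unfolding j'_def using Plus_closed[OF j(1) Neg_Hom[OF gpj]] .
  have "h \<cdot> (g \<cdot> (p \<cdot> j)) = Zero C ?a ?a"
    using Comp_assoc[OF pj g h] hg Zero_Comp[OF pj sa] by simp
  then have hj': "h \<cdot> j' = Ident C ?a"
    unfolding j'_def using Plus_Comp[OF j(1) Neg_Hom[OF gpj] h] Comp_Neg[OF gpj h] j(2)
      Neg_Zero[OF sa sa] Plus_Zero[OF Ident_Hom[OF sa]] by simp
  have "p \<cdot> (g \<cdot> (p \<cdot> j)) = p \<cdot> j"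
    using Comp_assoc[OF pj g p(1)] p(2) Ident_Comp[OF pj] by simp
  then have pj': "p \<cdot> j' = Zero C ?a b"
    unfolding j'_def using Plus_Comp[OF j(1) Neg_Hom[OF gpj] p(1)] Comp_Neg[OF gpj p(1)]
      Plus_Neg[OF pj] by simp
  let ?e = "Plus C (g \<cdot> p) (j' \<cdot> h)"
  have gp: "g \<cdot> p \<in> Hom C c c" and jh: "j' \<cdot> h \<in> Hom C c c" and i: "Ident C c \<in> Hom C c c"
    using Comp_Hom[OF p(1) g] Comp_Hom[OF h j'] Ident_Hom[OF c] by auto
  have e: "?e \<in> Hom C c c" using Plus_closed[OF gp jh] .
  have he: "h \<cdot> ?e = h"
    using Plus_Comp[OF gp jh h] Comp_assoc[OF p(1) g h] Comp_assoc[OF h j' h] hg hj'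
      Zero_Comp[OF p(1) sa] Ident_Comp[OF h] Zero_Plus[OF h] by simp
  have pe: "p \<cdot> ?e = p"
    using Plus_Comp[OF gp jh p(1)] Comp_assoc[OF p(1) g p(1)] Comp_assoc[OF h j' p(1)] p(2) pj'
      Zero_Comp[OF h f(2)] Ident_Comp[OF p(1)] Plus_Zero[OF p(1)] by simp
  \<comment> \<open>the defect \<open>?r\<close> is killed by \<open>h\<close>, so it factors through \<open>g\<close>, and the factor is \<open>p \<cdot> ?r = 0\<close>\<close>
  let ?r = "Plus C (Ident C c) (Neg C ?e)"
  have r: "?r \<in> Hom C c c" using Plus_closed[OF i Neg_Hom[OF e]] .
  have "h \<cdot> ?r = Zero C c ?a"
    using Plus_Comp[OF i Neg_Hom[OF e] h] Comp_Neg[OF e h] he Comp_Ident[OF h] Plus_Neg[OF h] by simp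
  then obtain k where k: "k \<in> Hom C c b" "?r = g \<cdot> k"
    using Dist_exact[OF g h Dist_rotate(2)[OF z g h d] Dist_rotate(1)[OF z g h d] r] by blast
  have "k = p \<cdot> ?r" using k Comp_assoc[OF k(1) g p(1)] p(2) Ident_Comp[OF k(1)] by simp
  also have "\<dots> = Zero C c b"
    using Plus_Comp[OF i Neg_Hom[OF e] p(1)] Comp_Neg[OF e p(1)] pe Comp_Ident[OF p(1)]
      Plus_Neg[OF p(1)] by simp
  finally have "?r = Zero C c c" using k(2) Comp_Zero[OF g c] by simp
  then have "?e = Ident C c" using eq_iff_diff[OF i e] by simp
  then show thesis using that p j' hj' pj' hg by blast
qed

lemma biproduct_unique:
  assumes s: "i \<in> Hom C a s" "j \<in> Hom C b s" "p \<in> Hom C s a" "q \<in> Hom C s b"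
      "p \<cdot> i = Ident C a" "q \<cdot> j = Ident C b" "p \<cdot> j = Zero C b a" "q \<cdot> i = Zero C a b"
      "Plus C (i \<cdot> p) (j \<cdot> q) = Ident C s"
    and t: "i' \<in> Hom C a t" "j' \<in> Hom C b t" "p' \<in> Hom C t a" "q' \<in> Hom C t b"
      "p' \<cdot> i' = Ident C a" "q' \<cdot> j' = Ident C b" "p' \<cdot> j' = Zero C b a" "q' \<cdot> i' = Zero C a b"
      "Plus C (i' \<cdot> p') (j' \<cdot> q') = Ident C t"
  shows "is_iso_mor C (Plus C (i' \<cdot> p) (j' \<cdot> q)) s t"
proof -
  \<comment> \<open>stated for arbitrary data, since it is used a second time with \<open>s\<close> and \<open>t\<close> exchanged\<close>
  have *: "Plus C (i \<cdot> p') (j \<cdot> q') \<cdot> Plus C (i' \<cdot> p) (j' \<cdot> q) = Ident C s"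
    if s: "i \<in> Hom C a s" "j \<in> Hom C b s" "p \<in> Hom C s a" "q \<in> Hom C s b"
      "Plus C (i \<cdot> p) (j \<cdot> q) = Ident C s"
    and t: "i' \<in> Hom C a t" "j' \<in> Hom C b t" "p' \<in> Hom C t a" "q' \<in> Hom C t b"
      "p' \<cdot> i' = Ident C a" "q' \<cdot> j' = Ident C b" "p' \<cdot> j' = Zero C b a" "q' \<cdot> i' = Zero C a b"
    for i j p q s i' j' p' q' t
  proof -
    note o = Hom_objs[OF s(1)] Hom_objs[OF s(2)]
    have pjq: "p' \<cdot> (j' \<cdot> q) = Zero C s a"
      using Comp_assoc[OF s(4) t(2,3)] t(7) Zero_Comp[OF s(4) o(1)] by simp
    have qip: "q' \<cdot> (i' \<cdot> p) = Zero C s b"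
      using Comp_assoc[OF s(3) t(1,4)] t(8) Zero_Comp[OF s(3) o(3)] by simp
    have ip: "i' \<cdot> p \<in> Hom C s t" and jq: "j' \<cdot> q \<in> Hom C s t"
      and ip': "i \<cdot> p' \<in> Hom C t s" and jq': "j \<cdot> q' \<in> Hom C t s"
      using Comp_Hom s t by blast+
    have "(i \<cdot> p') \<cdot> (i' \<cdot> p) = i \<cdot> p"
      using Comp_assoc[OF ip t(3) s(1)] Comp_assoc[OF s(3) t(1) t(3)] t(5) Ident_Comp[OF s(3)] by simp
    moreover have "(i \<cdot> p') \<cdot> (j' \<cdot> q) = Zero C s s"
      using Comp_assoc[OF jq t(3) s(1)] pjq Comp_Zero[OF s(1) o(2)] by simp
    moreover have "(j \<cdot> q') \<cdot> (i' \<cdot> p) = Zero C s s"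
      using Comp_assoc[OF ip t(4) s(2)] qip Comp_Zero[OF s(2) o(2)] by simp
    moreover have "(j \<cdot> q') \<cdot> (j' \<cdot> q) = j \<cdot> q"
      using Comp_assoc[OF jq t(4) s(2)] Comp_assoc[OF s(4) t(2) t(4)] t(6) Ident_Comp[OF s(4)] by simp
    ultimately show ?thesis
      using Plus_Comp[OF ip jq Plus_closed[OF ip' jq']] Comp_Plus[OF ip ip' jq']
        Comp_Plus[OF jq ip' jq'] s(5) Plus_Zero[OF Comp_Hom[OF s(3,1)]] Zero_Plus[OF Comp_Hom[OF s(4,2)]]
      by simp
  qed
  have "Plus C (i' \<cdot> p) (j' \<cdot> q) \<in> Hom C s t" "Plus C (i \<cdot> p') (j \<cdot> q') \<in> Hom C t s"
    using Plus_closed Comp_Hom s t by blast+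
  then show ?thesis
    unfolding is_iso_mor_def using *[OF s(1-4,9) t(1-8)] *[OF t(1-4,9) s(1-8)] by blast
qed

end

section \<open>The functor of a good extension\<close>

locale very_good_extension = S: triangulated_category S + T: triangulated_category T
  for S :: "('o, 'm) tri_cat" and T :: "('p, 'n) tri_cat" +
  fixes M :: "nat \<Rightarrow> 'o set" and F :: "('o, 'm, 'p, 'n) tri_fun"
  assumes metric: "very_good_metric S M"
    and summands: "\<forall>i. closed_under_summands S (M i)"
    and ext: "good_extension S T M F"
begin

lemma F_tri: "triangulated_functor S T F" and F_ff: "fully_faithful S T F"
  using ext by (auto simp: good_extension_def)

lemma F_Obj: "a \<in> Obj S \<Longrightarrow> fob F a \<in> Obj T"
  and F_Hom: "f \<in> Hom S a b \<Longrightarrow> fmor F f \<in> Hom T (fob F a) (fob F b)"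
  and F_Ident: "a \<in> Obj S \<Longrightarrow> fmor F (Ident S a) = Ident T (fob F a)"
  and F_Comp: "\<lbrakk>f \<in> Hom S a b; g \<in> Hom S b c\<rbrakk> \<Longrightarrow> fmor F (g \<cdot>\<^bsub>S\<^esub> f) = fmor F g \<cdot>\<^bsub>T\<^esub> fmor F f"
  and F_Plus: "\<lbrakk>f \<in> Hom S a b; h \<in> Hom S a b\<rbrakk> \<Longrightarrow>
    fmor F (Plus S f h) = Plus T (fmor F f) (fmor F h)"
  and fsh_iso: "a \<in> Obj S \<Longrightarrow> is_iso_mor T (fsh F a) (fob F (ShO S a)) (ShO T (fob F a))"
  and fsh_nat: "f \<in> Hom S a b \<Longrightarrow>
    fsh F b \<cdot>\<^bsub>T\<^esub> fmor F (ShM S f) = ShM T (fmor F f) \<cdot>\<^bsub>T\<^esub> fsh F a"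
  and F_Dist: "Dist S f g' h' \<Longrightarrow>
    Dist T (fmor F f) (fmor F g') (fsh F (Dom S f) \<cdot>\<^bsub>T\<^esub> fmor F h')"
  using F_tri unfolding triangulated_functor_def by simp_all

lemma F_bij: "\<lbrakk>a \<in> Obj S; b \<in> Obj S\<rbrakk> \<Longrightarrow> bij_betw (fmor F) (Hom S a b) (Hom T (fob F a) (fob F b))"
  using F_ff by (simp add: fully_faithful_def)

lemma fsh_Hom: "a \<in> Obj S \<Longrightarrow> fsh F a \<in> Hom T (fob F (ShO S a)) (ShO T (fob F a))"
  using fsh_iso by (auto simp: is_iso_mor_def)

lemma F_Zero:
  assumes "a \<in> Obj S" "b \<in> Obj S"
  shows "fmor F (Zero S a b) = Zero T (fob F a) (fob F b)"
  using T.Plus_self_eq[OF F_Hom[OF S.Zero_Hom[OF assms]]]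
    F_Plus[OF S.Zero_Hom[OF assms] S.Zero_Hom[OF assms]] S.Zero_Plus[OF S.Zero_Hom[OF assms]] by simp

text \<open>Up to the isomorphism \<open>F(\<Sigma>y) \<cong> \<Sigma>F(y)\<close> this is the full faithfulness of the shift. It is the
  identification \<open>\<Sigma>\<Y>(A) \<cong> \<Y>(\<Sigma>A)\<close> that underlies the boundary map of the strong triangle.\<close>

lemma shift_transport:
  assumes y: "y \<in> Obj S" and A: "A \<in> Obj T"
  shows "bij_betw (\<lambda>k. ShM T k \<cdot>\<^bsub>T\<^esub> fsh F y) (Hom T (fob F y) A) (Hom T (fob F (ShO S y)) (ShO T A))"
proof -
  from bij_betw_trans[OF T.ShM_Hom_bij[OF F_Obj[OF y] A] T.Comp_iso_bij[OF fsh_iso[OF y]]] show ?thesis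
    by (simp add: comp_def)
qed

lemma bij_ShM:
  assumes y: "y \<in> Obj S" and u: "u \<in> Hom T A B"
    and b: "bij_betw (\<lambda>k. u \<cdot>\<^bsub>T\<^esub> k) (Hom T (fob F y) A) (Hom T (fob F y) B)"
  shows "bij_betw (\<lambda>k. ShM T u \<cdot>\<^bsub>T\<^esub> k) (Hom T (fob F (ShO S y)) (ShO T A))
    (Hom T (fob F (ShO S y)) (ShO T B))"
proof -
  note o = T.Hom_objs[OF u]
  have "bij_betw ((\<lambda>k. ShM T k \<cdot>\<^bsub>T\<^esub> fsh F y) \<circ> (\<lambda>k. u \<cdot>\<^bsub>T\<^esub> k)) (Hom T (fob F y) A)
      (Hom T (fob F (ShO S y)) (ShO T B))"
    using bij_betw_trans[OF b shift_transport[OF y o(2)]] .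
  then have "bij_betw ((\<lambda>k. ShM T u \<cdot>\<^bsub>T\<^esub> k) \<circ> (\<lambda>k. ShM T k \<cdot>\<^bsub>T\<^esub> fsh F y)) (Hom T (fob F y) A)
      (Hom T (fob F (ShO S y)) (ShO T B))"
  proof (rule iffD1[OF bij_betw_cong, rotated])
    fix k assume k: "k \<in> Hom T (fob F y) A"
    show "((\<lambda>k. ShM T k \<cdot>\<^bsub>T\<^esub> fsh F y) \<circ> (\<lambda>k. u \<cdot>\<^bsub>T\<^esub> k)) k =
        ((\<lambda>k. ShM T u \<cdot>\<^bsub>T\<^esub> k) \<circ> (\<lambda>k. ShM T k \<cdot>\<^bsub>T\<^esub> fsh F y)) k"
      using T.ShM_Comp[OF k u] T.Comp_assoc[OF fsh_Hom[OF y] T.ShM_Hom[OF k] T.ShM_Hom[OF u]] by simp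
  qed
  then show ?thesis using bij_betw_comp_iff[OF shift_transport[OF y o(1)]] by blast
qed

section \<open>Test objects of a very good metric\<close>

abbreviation "test i \<equiv> left_perp S (M i)"

lemma good: "good_metric S M"
  using metric by (simp add: very_good_metric_def)

lemma M_Obj: "M i \<subseteq> Obj S"
  and M_Suc: "M (Suc i) \<subseteq> M i"
  and M_UnshO: "a \<in> M (Suc i) \<Longrightarrow> UnshO S a \<in> M i"
  and M_ShO: "a \<in> M (Suc i) \<Longrightarrow> ShO S a \<in> M i"
  using good unfolding good_metric_def by blast+

lemma test_Obj: "x \<in> test i \<Longrightarrow> x \<in> Obj S"
  by (simp add: left_perp_def)

lemma test_zero: "\<lbrakk>x \<in> test i; c \<in> M i\<rbrakk> \<Longrightarrow> Hom S x c = {Zero S x c}"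
  by (simp add: left_perp_def)

lemma test_Suc: "test i \<subseteq> test (Suc i)"
  using M_Suc unfolding left_perp_def by blast

lemma ex_test: "x \<in> Obj S \<Longrightarrow> \<exists>i. x \<in> test i"
  using metric unfolding very_good_metric_def by blast

text \<open>\<open>Hom(\<Sigma>x, a) = Hom(x, \<Sigma>\<^sup>-\<^sup>1a)\<close>, and for \<open>a\<close> in \<open>M\<^sub>i\<^sub>+\<^sub>1\<close> its
  desuspension is only known to lie in \<open>M\<^sub>i\<close>. The level lost here is the reason for the indices \<open>Suc i\<close> in the arguments with shifts below.\<close>

lemma test_ShO:
  assumes x: "x \<in> test i"
  shows "ShO S x \<in> test (Suc i)"
  unfolding left_perp_def
proof (intro CollectI conjI ballI)
  show "ShO S x \<in> Obj S" using S.ShO_Obj test_Obj x by blast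
  fix a assume a: "a \<in> M (Suc i)"
  have o: "a \<in> Obj S" "x \<in> Obj S" "UnshO S a \<in> Obj S"
    using a M_Obj x test_Obj S.UnshO_Obj by blast+
  have "g = Zero S (ShO S x) a" if g: "g \<in> Hom S (ShO S x) a" for g
  proof -
    have "UnshM S g \<in> Hom S x (UnshO S a)" using S.UnshM_Hom[OF g] S.UnshO_ShO o by simp
    then have "UnshM S g = Zero S x (UnshO S a)" using test_zero[OF x M_UnshO[OF a]] by blast
    then show ?thesis
      using S.ShM_UnshM[OF g] S.ShM_Zero[OF o(2,3)] S.ShO_UnshO[OF o(1)] by simp
  qed
  then show "Hom S (ShO S x) a = {Zero S (ShO S x) a}" using S.Zero_Hom S.ShO_Obj o by blast
qed

lemma test_UnshO:
  assumes x: "x \<in> test i"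
  shows "UnshO S x \<in> test (Suc i)"
  unfolding left_perp_def
proof (intro CollectI conjI ballI)
  show "UnshO S x \<in> Obj S" using S.UnshO_Obj test_Obj x by blast
  fix a assume a: "a \<in> M (Suc i)"
  have o: "a \<in> Obj S" "x \<in> Obj S" "UnshO S x \<in> Obj S"
    using a M_Obj x test_Obj S.UnshO_Obj by blast+
  have "g = Zero S (UnshO S x) a" if g: "g \<in> Hom S (UnshO S x) a" for g
  proof -
    have "ShM S g \<in> Hom S x (ShO S a)" using S.ShM_Hom[OF g] S.ShO_UnshO o by simp
    then have "ShM S g = Zero S x (ShO S a)" using test_zero[OF x M_ShO[OF a]] by blast
    then show ?thesis using S.ShM_eq_Zero[OF g] S.ShO_UnshO o by simp
  qed
  then show "Hom S (UnshO S x) a = {Zero S (UnshO S x) a}" using S.Zero_Hom o by blast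
qed

text \<open>The objects orthogonal to the test objects lie deep in the metric: decomposing such an
  object \<open>s\<close> by a triangle \<open>E \<rightarrow> s \<rightarrow> D\<close>, the map from the test object \<open>E\<close> vanishes, so \<open>s\<close>
  is a direct summand of \<open>D\<close>.\<close>

lemma M_if_orthogonal:
  "\<exists>n. \<forall>s \<in> Obj S. (\<forall>x \<in> test n. \<forall>u \<in> Hom S x s. u = Zero S x s) \<longrightarrow> s \<in> M m"
proof -
  obtain n where n: "Obj S = star S (test n) (M m)"
    using metric unfolding very_good_metric_def by blast
  have "s \<in> M m"
    if s: "s \<in> Obj S" and z: "\<And>x u. \<lbrakk>x \<in> test n; u \<in> Hom S x s\<rbrakk> \<Longrightarrow> u = Zero S x s" for s
  proof -
    obtain f g h where d: "Dist S f g h" "Dom S f \<in> test n" "Cod S f = s" "Cod S g \<in> M m"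
      using s n unfolding star_def by blast
    let ?e = "Dom S f" and ?c = "Cod S g"
    have t: "f \<in> Hom S ?e s" "g \<in> Hom S s ?c" "h \<in> Hom S ?c (ShO S ?e)"
      using S.Dist_types[OF d(1)] d(3) by auto
    have "f = Zero S ?e s" using z[OF d(2) t(1)] .
    then have "Dist S (Zero S ?e s) g h" using d(1) by simp
    then obtain p j where "p \<in> Hom S ?c s" "j \<in> Hom S (ShO S ?e) ?c" "p \<cdot>\<^bsub>S\<^esub> g = Ident S s"
      "h \<cdot>\<^bsub>S\<^esub> j = Ident S (ShO S ?e)" "h \<cdot>\<^bsub>S\<^esub> g = Zero S s (ShO S ?e)" "p \<cdot>\<^bsub>S\<^esub> j = Zero S (ShO S ?e) s"
      "Plus S (g \<cdot>\<^bsub>S\<^esub> p) (j \<cdot>\<^bsub>S\<^esub> h) = Ident S ?c"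
      using S.cone_of_zero_biproduct[OF _ s t(2,3)] S.Hom_objs[OF t(1)] by blast
    then have "is_biproduct S ?c s (ShO S ?e)"
      unfolding is_biproduct_def using t by blast
    then show ?thesis
      using summands d(4) s S.ShO_Obj S.Hom_objs[OF t(1)] unfolding closed_under_summands_def by blast
  qed
  then show ?thesis by blast
qed

section \<open>Approximation by sequences\<close>

text \<open>The sequence \<open>c\<close> computes \<open>Hom(F(x), X)\<close> at a finite stage, uniformly over the test objects
  \<open>x\<close> of each level. Uniformity is what makes \<open>c\<close> Cauchy.\<close>

definition approx :: "('o, 'm) sequence \<Rightarrow> 'p \<Rightarrow> (nat \<Rightarrow> 'n) \<Rightarrow> bool" where
  "approx c X \<gamma> \<longleftrightarrow> is_sequence S c \<and> seq_cocone T (image_seq F c) X \<gamma> \<and>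
     (\<forall>i. \<exists>N. \<forall>n\<ge>N. \<forall>x \<in> test i.
        bij_betw (\<lambda>g. \<gamma> n \<cdot>\<^bsub>T\<^esub> g) (Hom T (fob F x) (fob F (sob c n))) (Hom T (fob F x) X))"

lemma cocone_Hom: "seq_cocone T (image_seq F c) X \<gamma> \<Longrightarrow> \<gamma> n \<in> Hom T (fob F (sob c n)) X"
  by (simp add: seq_cocone_def image_seq_def)

lemma cocone_strans:
  assumes c: "is_sequence S c" and \<gamma>: "seq_cocone T (image_seq F c) X \<gamma>"
  shows "j \<le> k \<Longrightarrow> \<gamma> k \<cdot>\<^bsub>T\<^esub> fmor F (strans S c j k) = \<gamma> j"
proof (induction k rule: dec_induct)
  case base
  have "sob c j \<in> Obj S" using c by (simp add: is_sequence_def)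
  then show ?case
    using S.strans_refl[of c j] F_Ident T.Comp_Ident[OF cocone_Hom[OF \<gamma>]] by simp
next
  case (step k)
  have s: "smap c k \<in> Hom S (sob c k) (sob c (Suc k))" using c by (simp add: is_sequence_def)
  note t = S.strans_Hom[OF c step(1)]
  have "\<gamma> (Suc k) \<cdot>\<^bsub>T\<^esub> fmor F (strans S c j (Suc k)) =
      \<gamma> (Suc k) \<cdot>\<^bsub>T\<^esub> (fmor F (smap c k) \<cdot>\<^bsub>T\<^esub> fmor F (strans S c j k))"
    using step(1) F_Comp[OF t s] by simp
  also have "\<dots> = \<gamma> k \<cdot>\<^bsub>T\<^esub> fmor F (strans S c j k)"
    using T.Comp_assoc[OF F_Hom[OF t] F_Hom[OF s] cocone_Hom[OF \<gamma>]] \<gamma>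
    by (simp add: seq_cocone_def image_seq_def)
  finally show ?case using step by simp
qed

lemma cocone_strans_Comp:
  assumes c: "is_sequence S c" and \<gamma>: "seq_cocone T (image_seq F c) X \<gamma>"
    and jk: "j \<le> k" and g: "g \<in> Hom S x (sob c j)"
  shows "\<gamma> k \<cdot>\<^bsub>T\<^esub> fmor F (strans S c j k \<cdot>\<^bsub>S\<^esub> g) = \<gamma> j \<cdot>\<^bsub>T\<^esub> fmor F g"
  using cocone_strans[OF c \<gamma> jk] F_Comp[OF g S.strans_Hom[OF c jk]]
    T.Comp_assoc[OF F_Hom[OF g] F_Hom[OF S.strans_Hom[OF c jk]] cocone_Hom[OF \<gamma>]] by simp

lemma approxE:
  assumes "approx c X \<gamma>"
  shows "is_sequence S c" "seq_cocone T (image_seq F c) X \<gamma>"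
    "\<gamma> n \<in> Hom T (fob F (sob c n)) X" "sob c n \<in> Obj S" "X \<in> Obj T"
  using assms cocone_Hom[of c X \<gamma> n] T.Hom_objs(2)[of "\<gamma> n"]
  by (auto simp: approx_def is_sequence_def)

text \<open>Since \<open>F\<close> is fully faithful, bijectivity of \<open>\<gamma>\<close> on maps from \<open>F(x)\<close> can be stated with maps of
  \<open>S\<close> on one side. The form inside \<open>T\<close> suits the five lemma, the other one the construction of
  maps in \<open>S\<close>.\<close>

lemma full_bij_iff:
  assumes \<gamma>: "\<gamma> \<in> Hom T (fob F a) X" and x: "x \<in> Obj S" and a: "a \<in> Obj S"
  shows "bij_betw (\<lambda>g. \<gamma> \<cdot>\<^bsub>T\<^esub> g) (Hom T (fob F x) (fob F a)) (Hom T (fob F x) X) \<longleftrightarrow>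
    bij_betw (\<lambda>g. \<gamma> \<cdot>\<^bsub>T\<^esub> fmor F g) (Hom S x a) (Hom T (fob F x) X)"
  using bij_betw_comp_iff[OF F_bij[OF x a], of "\<lambda>g. \<gamma> \<cdot>\<^bsub>T\<^esub> g"] by (simp add: comp_def)

lemma approx_bij_T:
  assumes \<gamma>: "approx c X \<gamma>"
  shows "\<exists>N. \<forall>n\<ge>N. \<forall>x \<in> test i.
    bij_betw (\<lambda>g. \<gamma> n \<cdot>\<^bsub>T\<^esub> g) (Hom T (fob F x) (fob F (sob c n))) (Hom T (fob F x) X)"
  using \<gamma> unfolding approx_def by blast

lemma approx_bij:
  assumes \<gamma>: "approx c X \<gamma>"
  shows "\<exists>N. \<forall>n\<ge>N. \<forall>x \<in> test i.
    bij_betw (\<lambda>g. \<gamma> n \<cdot>\<^bsub>T\<^esub> fmor F g) (Hom S x (sob c n)) (Hom T (fob F x) X)"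
  using approx_bij_T[OF \<gamma>, of i] full_bij_iff[OF approxE(3)[OF \<gamma>] test_Obj approxE(4)[OF \<gamma>]] by simp

lemma approx_strans_bij:
  assumes \<gamma>: "approx c X \<gamma>" and jk: "j \<le> k" and x: "x \<in> Obj S"
    and bj: "bij_betw (\<lambda>g. \<gamma> j \<cdot>\<^bsub>T\<^esub> fmor F g) (Hom S x (sob c j)) (Hom T (fob F x) X)"
    and bk: "bij_betw (\<lambda>g. \<gamma> k \<cdot>\<^bsub>T\<^esub> fmor F g) (Hom S x (sob c k)) (Hom T (fob F x) X)"
  shows "bij_betw (\<lambda>g. strans S c j k \<cdot>\<^bsub>S\<^esub> g) (Hom S x (sob c j)) (Hom S x (sob c k))"
proof (rule iffD2[OF bij_betw_comp_iff2[OF bk]])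
  note t = S.strans_Hom[OF approxE(1)[OF \<gamma>] jk]
  show "(\<lambda>g. strans S c j k \<cdot>\<^bsub>S\<^esub> g) ` Hom S x (sob c j) \<subseteq> Hom S x (sob c k)"
    using S.Comp_Hom[OF _ t] by blast
  show "bij_betw ((\<lambda>g. \<gamma> k \<cdot>\<^bsub>T\<^esub> fmor F g) \<circ> (\<lambda>g. strans S c j k \<cdot>\<^bsub>S\<^esub> g)) (Hom S x (sob c j))
      (Hom T (fob F x) X)"
    by (rule iffD1[OF bij_betw_cong bj])
      (simp add: cocone_strans_Comp[OF approxE(1,2)[OF \<gamma>] jk])
qed

text \<open>Both \<open>\<gamma>\<^sub>j\<close> and \<open>\<gamma>\<^sub>k\<close> are bijective on test objects, hence so is \<open>c\<^sub>j \<rightarrow> c\<^sub>k\<close>; therefore its cone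
  receives no nonzero maps from test objects and lies deep in the metric.\<close>

lemma approx_Cauchy:
  assumes \<gamma>: "approx c X \<gamma>"
  shows "is_Cauchy S M c"
  unfolding is_Cauchy_def
proof (intro conjI allI)
  show c: "is_sequence S c" using approxE(1)[OF \<gamma>] .
  fix i
  obtain n where n: "\<And>s. \<lbrakk>s \<in> Obj S; \<And>x u. \<lbrakk>x \<in> test n; u \<in> Hom S x s\<rbrakk> \<Longrightarrow> u = Zero S x s\<rbrakk> \<Longrightarrow> s \<in> M i"
    using M_if_orthogonal[of i] by blast
  obtain N where N: "\<And>k x. \<lbrakk>N \<le> k; x \<in> test (Suc n)\<rbrakk> \<Longrightarrow>
      bij_betw (\<lambda>g. \<gamma> k \<cdot>\<^bsub>T\<^esub> fmor F g) (Hom S x (sob c k)) (Hom T (fob F x) X)"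
    using approx_bij[OF \<gamma>, of "Suc n"] by blast
  have "\<exists>g h. Dist S (strans S c j k) g h \<and> Cod S g \<in> M i" if "N \<le> j" "j < k" for j k
  proof -
    note t = S.strans_Hom[OF c less_imp_le[OF \<open>j < k\<close>]]
    have b: "bij_betw (\<lambda>g. strans S c j k \<cdot>\<^bsub>S\<^esub> g) (Hom S x (sob c j)) (Hom S x (sob c k))"
      if "x \<in> test (Suc n)" for x
      using approx_strans_bij[OF \<gamma> _ test_Obj[OF that] N N] that \<open>N \<le> j\<close> \<open>j < k\<close> by simp
    obtain d g h where d: "Dist S (strans S c j k) g h" "g \<in> Hom S (sob c k) d"
      "h \<in> Hom S d (ShO S (sob c j))"
      using S.cone_exists[OF t] .
    have "u = Zero S x d" if x: "x \<in> test n" and u: "u \<in> Hom S x d" for x u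
    proof (rule S.cone_Hom_zero[OF t d(2,3,1) _ _ u])
      fix l assume "l \<in> Hom S x (sob c k)"
      then show "\<exists>l' \<in> Hom S x (sob c j). strans S c j k \<cdot>\<^bsub>S\<^esub> l' = l"
        using b x test_Suc by (metis (no_types, lifting) bij_betw_imp_surj_on imageE subsetD)
    next
      let ?y = "UnshO S x"
      have y: "?y \<in> test (Suc n)" "?y \<in> Obj S" using test_UnshO[OF x] test_Obj by blast+
      have xy: "ShO S ?y = x" using S.ShO_UnshO test_Obj x by blast
      fix l assume l: "l \<in> Hom S x (ShO S (sob c j))"
        and z: "ShM S (strans S c j k) \<cdot>\<^bsub>S\<^esub> l = Zero S x (ShO S (sob c k))"
      let ?l = "UnshM S l"
      have l': "?l \<in> Hom S ?y (sob c j)"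
        using S.UnshM_Hom[OF l] S.UnshO_ShO S.Hom_objs[OF t] by simp
      have "ShM S (strans S c j k \<cdot>\<^bsub>S\<^esub> ?l) = Zero S (ShO S ?y) (ShO S (sob c k))"
        using S.ShM_Comp[OF l' t] S.ShM_UnshM[OF l] z xy by simp
      then have "strans S c j k \<cdot>\<^bsub>S\<^esub> ?l = Zero S ?y (sob c k)"
        using S.ShM_eq_Zero[OF S.Comp_Hom[OF l' t]] by blast
      also have "\<dots> = strans S c j k \<cdot>\<^bsub>S\<^esub> Zero S ?y (sob c j)" using S.Comp_Zero[OF t y(2)] by simp
      finally have "?l = Zero S ?y (sob c j)"
        using b[OF y(1)] l' S.Zero_Hom[OF y(2) S.Hom_objs(1)[OF t]]
        unfolding bij_betw_def inj_on_def by blast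
      then show "l = Zero S x (ShO S (sob c j))"
        using S.ShM_UnshM[OF l] S.ShM_Zero[OF y(2) S.Hom_objs(1)[OF t]] xy by simp
    qed
    then have "d \<in> M i" using n S.Hom_objs[OF d(2)] by blast
    then show ?thesis using d S.Hom_Dom_Cod by metis
  qed
  then show "\<exists>N. \<forall>j k. N \<le> j \<and> j < k \<longrightarrow> (\<exists>g h. Dist S (strans S c j k) g h \<and> Cod S g \<in> M i)"
    by blast
qed

text \<open>The converse of the previous argument: a cone in \<open>M\<^sub>i\<^sub>+\<^sub>1\<close> receives no nonzero map from
  \<open>x\<close> or \<open>\<Sigma>x\<close> for any test object \<open>x\<close> of level \<open>i\<close>.\<close>

lemma Cauchy_strans_bij:
  assumes c: "is_Cauchy S M c"
  shows "\<exists>N. \<forall>j\<ge>N. \<forall>k\<ge>j. \<forall>x \<in> test i.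
    bij_betw (\<lambda>g. strans S c j k \<cdot>\<^bsub>S\<^esub> g) (Hom S x (sob c j)) (Hom S x (sob c k))"
proof -
  have s: "is_sequence S c" using c by (simp add: is_Cauchy_def)
  obtain N where N: "\<And>j k. \<lbrakk>N \<le> j; j < k\<rbrakk> \<Longrightarrow> \<exists>g h. Dist S (strans S c j k) g h \<and> Cod S g \<in> M (Suc i)"
    using c unfolding is_Cauchy_def by blast
  have "bij_betw (\<lambda>g. strans S c j k \<cdot>\<^bsub>S\<^esub> g) (Hom S x (sob c j)) (Hom S x (sob c k))"
    if "N \<le> j" "j \<le> k" and x: "x \<in> test i" for j k x
  proof (cases "j = k")
    case True
    have "sob c j \<in> Obj S" using s by (simp add: is_sequence_def)
    then show ?thesis using True S.iso_Comp_bij[OF S.is_iso_mor_Ident] S.strans_refl[of c j] by simp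
  next
    case False
    with that have "j < k" by simp
    then obtain g h where d: "Dist S (strans S c j k) g h" "Cod S g \<in> M (Suc i)"
      using N[OF \<open>N \<le> j\<close>] by blast
    note t = S.strans_Hom[OF s \<open>j \<le> k\<close>]
    have "g \<in> Hom S (sob c k) (Cod S g)" "h \<in> Hom S (Cod S g) (ShO S (sob c j))"
      using S.Dist_types[OF d(1)] S.Hom_Dom_Cod[OF t] by auto
    then show ?thesis
      using S.bij_if_cone_Hom_zero[OF t _ _ d(1)] test_zero[OF _ d(2)] test_ShO[OF x] test_Suc x by blast
  qed
  then show ?thesis by blast
qed

section \<open>Colimits of representable functors and homotopy colimits\<close>

abbreviation ycls :: "('o, 'm) sequence \<Rightarrow> nat \<Rightarrow> 'o \<Rightarrow> 'm \<Rightarrow> (nat \<times> 'm) set" where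
  "ycls c \<equiv> colim_in (\<lambda>n. yon S (sob c n)) (\<lambda>n. yon_map S (smap c n))"

lemma S_additive: "additive_category S"
  by unfold_locales

lemma yon_carrier [simp]: "carrier (val (yon S s) x) = Hom S x s"
  by (simp add: yon_def)

lemma ycolim_carrier:
  assumes c: "is_sequence S c"
  shows "carrier (val (ycolim S c) x) = {ycls c n x k |n k. k \<in> Hom S x (sob c n)}"
  by (simp add: ycolim_def colim_def carrier_colim_group[OF S_additive S.yon_md_sequence[OF c]])

lemma mtrans_yon:
  assumes c: "is_sequence S c" and g: "g \<in> Hom S x (sob c j)"
  shows "j \<le> k \<Longrightarrow> mtrans (\<lambda>n. yon_map S (smap c n)) x j k g = strans S c j k \<cdot>\<^bsub>S\<^esub> g"
proof (induction k rule: dec_induct)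
  case base
  then show ?case
    using S.strans_refl[of c j] S.Ident_Comp[OF g] by (cases j) auto
next
  case (step k)
  have s: "smap c k \<in> Hom S (sob c k) (sob c (Suc k))" using c by (simp add: is_sequence_def)
  show ?case
    using step S.Comp_assoc[OF g S.strans_Hom[OF c step(1)] s] by (simp add: yon_map_def)
qed

lemma ycls_eq_iff:
  assumes c: "is_sequence S c" and x: "x \<in> Obj S" and g: "g \<in> Hom S x (sob c i)" and h: "h \<in> Hom S x (sob c j)"
  shows "ycls c i x g = ycls c j x h \<longleftrightarrow>
    (\<exists>k. i \<le> k \<and> j \<le> k \<and> strans S c i k \<cdot>\<^bsub>S\<^esub> g = strans S c j k \<cdot>\<^bsub>S\<^esub> h)"
proof -
  have "ycls c i x g = ycls c j x h \<longleftrightarrow> (\<exists>k. i \<le> k \<and> j \<le> k \<and>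
      mtrans (\<lambda>n. yon_map S (smap c n)) x i k g = mtrans (\<lambda>n. yon_map S (smap c n)) x j k h)"
    by (rule colim_in_eq_iff[OF S_additive S.yon_md_sequence[OF c] x]) (use g h in simp_all)
  then show ?thesis using mtrans_yon[OF c g] mtrans_yon[OF c h] by auto
qed

lemma cocone_mod_map:
  assumes \<gamma>: "\<gamma> \<in> Hom T (fob F s) X"
  shows "is_mod_map S (yon S s) (ryon T F X) (\<lambda>x g. \<gamma> \<cdot>\<^bsub>T\<^esub> fmor F g)"
  unfolding is_mod_map_def
proof (intro conjI ballI allI)
  fix x assume "x \<in> Obj S"
  show "(\<lambda>g. \<gamma> \<cdot>\<^bsub>T\<^esub> fmor F g) \<in> hom (val (yon S s) x) (val (ryon T F X) x)"
    by (rule homI)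
      (auto simp: ryon_def yon_def T.Comp_Hom[OF F_Hom \<gamma>] F_Plus T.Plus_Comp[OF F_Hom F_Hom \<gamma>])
next
  fix x y f m assume f: "f \<in> Hom S x y" and "m \<in> carrier (val (yon S s) y)"
  then have m: "m \<in> Hom S y s" by simp
  show "\<gamma> \<cdot>\<^bsub>T\<^esub> fmor F (res (yon S s) f m) = res (ryon T F X) f (\<gamma> \<cdot>\<^bsub>T\<^esub> fmor F m)"
    using F_Comp[OF f m] T.Comp_assoc[OF F_Hom[OF f] F_Hom[OF m] \<gamma>] by (simp add: yon_def ryon_def)
qed

lemma nat_map_facts:
  assumes c: "is_sequence S c" and \<gamma>: "seq_cocone T (image_seq F c) X \<gamma>"
  shows nat_map_mod_map: "is_mod_map S (ycolim S c) (ryon T F X) (nat_map T F \<gamma>)"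
    and nat_map_ycls: "\<lbrakk>x \<in> Obj S; k \<in> Hom S x (sob c n)\<rbrakk> \<Longrightarrow>
      nat_map T F \<gamma> x (ycls c n x k) = \<gamma> n \<cdot>\<^bsub>T\<^esub> fmor F k"
proof -
  have s: "smap c i \<in> Hom S (sob c i) (sob c (Suc i))" for i using c by (simp add: is_sequence_def)
  have 1: "is_mod_map S (yon S (sob c i)) (ryon T F X) (\<lambda>x g. \<gamma> i \<cdot>\<^bsub>T\<^esub> fmor F g)" for i
    using cocone_mod_map[OF cocone_Hom[OF \<gamma>]] .
  have 2: "\<gamma> (Suc i) \<cdot>\<^bsub>T\<^esub> fmor F (yon_map S (smap c i) x m) = \<gamma> i \<cdot>\<^bsub>T\<^esub> fmor F m"
    if "m \<in> carrier (val (yon S (sob c i)) x)" for i x m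
    using cocone_strans_Comp[OF c \<gamma>, of i "Suc i" m x] that S.Comp_Ident[OF s] S.strans_refl
    by (simp add: yon_map_def)
  show "is_mod_map S (ycolim S c) (ryon T F X) (nat_map T F \<gamma>)"
    unfolding ycolim_def nat_map_def
    by (rule colim_universal(1)[OF S_additive S.yon_md_sequence[OF c] 1]) (use 2 in simp)
  show "nat_map T F \<gamma> x (ycls c n x k) = \<gamma> n \<cdot>\<^bsub>T\<^esub> fmor F k"
    if "x \<in> Obj S" "k \<in> Hom S x (sob c n)"
    unfolding nat_map_def
    by (rule colim_desc_in[OF S_additive S.yon_md_sequence[OF c] 1]) (use 2 that in simp_all)
qed

text \<open>An approximation computes \<open>\<Y>(X)\<close> as a colimit, because every object is a test object
  at some level.\<close>

lemma approx_nat_map_iso: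
  assumes \<gamma>: "approx c X \<gamma>"
  shows "is_mod_iso S (ycolim S c) (ryon T F X) (nat_map T F \<gamma>)"
  unfolding is_mod_iso_def
proof (intro conjI ballI)
  note c = approxE(1)[OF \<gamma>] and co = approxE(2)[OF \<gamma>]
  note m = nat_map_mod_map[OF c co] and [simp] = nat_map_ycls[OF c co]
  show "is_mod_map S (ycolim S c) (ryon T F X) (nat_map T F \<gamma>)" using m .
  fix x assume x: "x \<in> Obj S"
  obtain i where i: "x \<in> test i" using ex_test[OF x] by blast
  obtain N where "\<And>n x. \<lbrakk>N \<le> n; x \<in> test i\<rbrakk> \<Longrightarrow>
      bij_betw (\<lambda>g. \<gamma> n \<cdot>\<^bsub>T\<^esub> fmor F g) (Hom S x (sob c n)) (Hom T (fob F x) X)"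
    using approx_bij[OF \<gamma>, of i] by blast
  then have N: "bij_betw (\<lambda>g. \<gamma> n \<cdot>\<^bsub>T\<^esub> fmor F g) (Hom S x (sob c n)) (Hom T (fob F x) X)"
    if "N \<le> n" for n using that i by blast
  have "inj_on (nat_map T F \<gamma> x) (carrier (val (ycolim S c) x))"
  proof (rule inj_onI)
    fix u v assume "u \<in> carrier (val (ycolim S c) x)" "v \<in> carrier (val (ycolim S c) x)"
    then obtain j g k h where g: "u = ycls c j x g" "g \<in> Hom S x (sob c j)"
      and h: "v = ycls c k x h" "h \<in> Hom S x (sob c k)"
      unfolding ycolim_carrier[OF c] by blast
    assume "nat_map T F \<gamma> x u = nat_map T F \<gamma> x v"
    then have e: "\<gamma> j \<cdot>\<^bsub>T\<^esub> fmor F g = \<gamma> k \<cdot>\<^bsub>T\<^esub> fmor F h" using g h x by simp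
    define p where "p = max N (max j k)"
    have p: "N \<le> p" "j \<le> p" "k \<le> p" by (auto simp: p_def)
    have "\<gamma> p \<cdot>\<^bsub>T\<^esub> fmor F (strans S c j p \<cdot>\<^bsub>S\<^esub> g) = \<gamma> p \<cdot>\<^bsub>T\<^esub> fmor F (strans S c k p \<cdot>\<^bsub>S\<^esub> h)"
      using e cocone_strans_Comp[OF c co p(2) g(2)] cocone_strans_Comp[OF c co p(3) h(2)] by simp
    then have "strans S c j p \<cdot>\<^bsub>S\<^esub> g = strans S c k p \<cdot>\<^bsub>S\<^esub> h"
      using N[OF p(1)] S.Comp_Hom[OF g(2) S.strans_Hom[OF c p(2)]]
        S.Comp_Hom[OF h(2) S.strans_Hom[OF c p(3)]] unfolding bij_betw_def inj_on_def by blast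
    then show "u = v" using ycls_eq_iff[OF c x g(2) h(2)] g(1) h(1) p by blast
  qed
  moreover have "nat_map T F \<gamma> x ` carrier (val (ycolim S c) x) = carrier (val (ryon T F X) x)"
  proof
    show "nat_map T F \<gamma> x ` carrier (val (ycolim S c) x) \<subseteq> carrier (val (ryon T F X) x)"
      using m x unfolding is_mod_map_def hom_def by blast
    show "carrier (val (ryon T F X) x) \<subseteq> nat_map T F \<gamma> x ` carrier (val (ycolim S c) x)"
    proof
      fix g assume "g \<in> carrier (val (ryon T F X) x)"
      then have "g \<in> Hom T (fob F x) X" by (simp add: ryon_def)
      then obtain h where h: "h \<in> Hom S x (sob c N)" "\<gamma> N \<cdot>\<^bsub>T\<^esub> fmor F h = g"
        using N[of N] by (metis (no_types, lifting) bij_betw_imp_surj_on imageE order_refl)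
      then show "g \<in> nat_map T F \<gamma> x ` carrier (val (ycolim S c) x)"
        unfolding ycolim_carrier[OF c] using x by (auto intro!: image_eqI[of _ _ "ycls c N x h"])
    qed
  qed
  ultimately show "nat_map T F \<gamma> x \<in> Group.iso (val (ycolim S c) x) (val (ryon T F X) x)"
    using m x unfolding is_mod_map_def iso_def bij_betw_def by blast
qed

lemma hocolim_cocone:
  assumes c: "is_sequence S c" and H: "is_hocolim T (image_seq F c) H \<iota>"
  shows "seq_cocone T (image_seq F c) H \<iota>"
proof -
  obtain P i d q w where P: "is_coproduct T (\<lambda>n. fob F (sob c n)) P i" "d \<in> Hom T P P"
    "\<And>n. d \<cdot>\<^bsub>T\<^esub> i n = Plus T (i n) (Neg T (i (Suc n) \<cdot>\<^bsub>T\<^esub> fmor F (smap c n)))"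
    "q \<in> Hom T P H" "Dist T d q w" "\<And>n. \<iota> n = q \<cdot>\<^bsub>T\<^esub> i n"
    using H unfolding is_hocolim_def image_seq_def by auto
  have w: "w \<in> Hom T H (ShO T P)"
    using T.Dist_types[OF P(5)] T.Hom_Dom_Cod[OF P(2)] T.Hom_Dom_Cod[OF P(4)] by metis
  have "\<iota> n \<in> Hom T (fob F (sob c n)) H \<and> \<iota> (Suc n) \<cdot>\<^bsub>T\<^esub> fmor F (smap c n) = \<iota> n" for n
  proof -
    have i: "i n \<in> Hom T (fob F (sob c n)) P" for n using P(1) unfolding is_coproduct_def by blast
    have s: "fmor F (smap c n) \<in> Hom T (fob F (sob c n)) (fob F (sob c (Suc n)))"
      using c F_Hom by (simp add: is_sequence_def)
    let ?j = "i (Suc n) \<cdot>\<^bsub>T\<^esub> fmor F (smap c n)"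
    have j: "?j \<in> Hom T (fob F (sob c n)) P" using T.Comp_Hom[OF s i] .
    have "q \<cdot>\<^bsub>T\<^esub> (d \<cdot>\<^bsub>T\<^esub> i n) = Zero T (fob F (sob c n)) H"
      using T.Comp_assoc[OF i P(2,4)] T.Dist_comp_zero[OF P(2,4) w P(5)]
        T.Zero_Comp[OF i] T.Hom_objs[OF P(4)] by simp
    moreover have "q \<cdot>\<^bsub>T\<^esub> (d \<cdot>\<^bsub>T\<^esub> i n) = Plus T (\<iota> n) (Neg T (q \<cdot>\<^bsub>T\<^esub> ?j))"
      using P(3,6) T.Plus_Comp[OF i T.Neg_Hom[OF j] P(4)] T.Comp_Neg[OF j P(4)] by simp
    moreover have \<iota>: "\<iota> n \<in> Hom T (fob F (sob c n)) H" using T.Comp_Hom[OF i P(4)] P(6) by simp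
    ultimately have "\<iota> n = q \<cdot>\<^bsub>T\<^esub> ?j" using T.eq_iff_diff[OF \<iota> T.Comp_Hom[OF j P(4)]] by simp
    then show ?thesis using \<iota> P(6) T.Comp_assoc[OF s i P(4)] by simp
  qed
  then show ?thesis by (simp add: seq_cocone_def image_seq_def)
qed

lemma approx_iso:
  assumes \<gamma>: "approx c X \<gamma>" and u: "is_iso_mor T u X Y"
  shows "approx c Y (\<lambda>n. u \<cdot>\<^bsub>T\<^esub> \<gamma> n)"
  unfolding approx_def
proof (intro conjI allI)
  have uH: "u \<in> Hom T X Y" using u by (simp add: is_iso_mor_def)
  note c = approxE(1,2)[OF \<gamma>] and \<gamma>H = approxE(3)[OF \<gamma>]
  show "is_sequence S c" using c(1) .
  show "seq_cocone T (image_seq F c) Y (\<lambda>n. u \<cdot>\<^bsub>T\<^esub> \<gamma> n)"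
    unfolding seq_cocone_def
  proof (intro allI conjI)
    fix n
    have s: "fmor F (smap c n) \<in> Hom T (fob F (sob c n)) (fob F (sob c (Suc n)))"
      using c(1) F_Hom by (simp add: is_sequence_def)
    show "u \<cdot>\<^bsub>T\<^esub> \<gamma> n \<in> Hom T (sob (image_seq F c) n) Y"
      using T.Comp_Hom[OF \<gamma>H uH] by (simp add: image_seq_def)
    show "(u \<cdot>\<^bsub>T\<^esub> \<gamma> (Suc n)) \<cdot>\<^bsub>T\<^esub> smap (image_seq F c) n = u \<cdot>\<^bsub>T\<^esub> \<gamma> n"
      using c(2) T.Comp_assoc[OF s \<gamma>H uH] by (simp add: image_seq_def seq_cocone_def)
  qed
  fix i
  obtain N where N: "\<forall>n\<ge>N. \<forall>x \<in> test i.
      bij_betw (\<lambda>g. \<gamma> n \<cdot>\<^bsub>T\<^esub> g) (Hom T (fob F x) (fob F (sob c n))) (Hom T (fob F x) X)"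
    using approx_bij_T[OF \<gamma>] by blast
  have "bij_betw (\<lambda>g. (u \<cdot>\<^bsub>T\<^esub> \<gamma> n) \<cdot>\<^bsub>T\<^esub> g) (Hom T (fob F x) (fob F (sob c n))) (Hom T (fob F x) Y)"
    if "N \<le> n" "x \<in> test i" for n x
  proof -
    have "bij_betw (\<lambda>g. \<gamma> n \<cdot>\<^bsub>T\<^esub> g) (Hom T (fob F x) (fob F (sob c n))) (Hom T (fob F x) X)"
      using N that by blast
    from bij_betw_trans[OF this T.iso_Comp_bij[OF u]] show ?thesis
      by (rule iffD1[OF bij_betw_cong, rotated]) (simp add: T.Comp_assoc[OF _ \<gamma>H uH])
  qed
  then show "\<exists>N. \<forall>n\<ge>N. \<forall>x \<in> test i. bij_betw (\<lambda>g. (u \<cdot>\<^bsub>T\<^esub> \<gamma> n) \<cdot>\<^bsub>T\<^esub> g)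
      (Hom T (fob F x) (fob F (sob c n))) (Hom T (fob F x) Y)" by blast
qed

text \<open>A good extension identifies maps from \<open>F(x)\<close> to the homotopy colimit with the colimit of the groups \<open>Hom(x, c\<^sub>n)\<close>. The
  transition maps of this colimit are bijective from a stage on that depends only on the level of
  the test object \<open>x\<close>, so \<open>Hom(x, c\<^sub>n)\<close> is already the colimit.\<close>

lemma presentation_approx:
  assumes c: "is_Cauchy S M c" and X: "hocolim_presentation T (image_seq F c) X \<alpha>"
  shows "approx c X \<alpha>"
proof -
  have s: "is_sequence S c" using c by (simp add: is_Cauchy_def)
  obtain H \<iota> u where H: "is_hocolim T (image_seq F c) H \<iota>" "is_iso_mor T u H X" "\<And>n. \<alpha> n = u \<cdot>\<^bsub>T\<^esub> \<iota> n"
    using X unfolding hocolim_presentation_def by blast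
  note co = hocolim_cocone[OF s H(1)]
  have iso: "is_mod_iso S (ycolim S c) (ryon T F H) (nat_map T F \<iota>)"
    using ext c H(1) unfolding good_extension_def by blast
  have \<iota>: "\<iota> n \<in> Hom T (fob F (sob c n)) H" for n using cocone_Hom[OF co] .
  have o: "sob c n \<in> Obj S" for n using s by (simp add: is_sequence_def)
  have "\<exists>N. \<forall>n\<ge>N. \<forall>x \<in> test i.
      bij_betw (\<lambda>g. \<iota> n \<cdot>\<^bsub>T\<^esub> g) (Hom T (fob F x) (fob F (sob c n))) (Hom T (fob F x) H)" for i
  proof -
    obtain N where N: "\<And>j k x. \<lbrakk>N \<le> j; j \<le> k; x \<in> test i\<rbrakk> \<Longrightarrow>
        bij_betw (\<lambda>g. strans S c j k \<cdot>\<^bsub>S\<^esub> g) (Hom S x (sob c j)) (Hom S x (sob c k))"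
      using Cauchy_strans_bij[OF c, of i] by blast
    have "bij_betw (\<lambda>g. \<iota> n \<cdot>\<^bsub>T\<^esub> g) (Hom T (fob F x) (fob F (sob c n))) (Hom T (fob F x) H)"
      if n: "N \<le> n" and xi: "x \<in> test i" for n x
    proof -
      have x: "x \<in> Obj S" using test_Obj[OF xi] .
      have b: "bij_betw (nat_map T F \<iota> x) (carrier (val (ycolim S c) x)) (Hom T (fob F x) H)"
        using iso x unfolding is_mod_iso_def iso_def by (simp add: ryon_def)
      have "inj_on (\<lambda>g. \<iota> n \<cdot>\<^bsub>T\<^esub> fmor F g) (Hom S x (sob c n))"
      proof (rule inj_onI)
        fix g h assume g: "g \<in> Hom S x (sob c n)" and h: "h \<in> Hom S x (sob c n)"
          and e: "\<iota> n \<cdot>\<^bsub>T\<^esub> fmor F g = \<iota> n \<cdot>\<^bsub>T\<^esub> fmor F h"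
        have "nat_map T F \<iota> x (ycls c n x g) = nat_map T F \<iota> x (ycls c n x h)"
          using e nat_map_ycls[OF s co x g] nat_map_ycls[OF s co x h] by simp
        then have "ycls c n x g = ycls c n x h"
          using b g h unfolding bij_betw_def inj_on_def ycolim_carrier[OF s] by blast
        then obtain k where "n \<le> k" "strans S c n k \<cdot>\<^bsub>S\<^esub> g = strans S c n k \<cdot>\<^bsub>S\<^esub> h"
          using ycls_eq_iff[OF s x g h] by blast
        then show "g = h" using N[OF n _ xi] g h unfolding bij_betw_def inj_on_def by blast
      qed
      moreover have "l \<in> (\<lambda>g. \<iota> n \<cdot>\<^bsub>T\<^esub> fmor F g) ` Hom S x (sob c n)" if l: "l \<in> Hom T (fob F x) H" for l
      proof -
        have "l \<in> nat_map T F \<iota> x ` {ycls c n x k |n k. k \<in> Hom S x (sob c n)}"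
          using bij_betw_imp_surj_on[OF b] l by (simp add: ycolim_carrier[OF s])
        then obtain m g where g: "g \<in> Hom S x (sob c m)" "nat_map T F \<iota> x (ycls c m x g) = l"
          by blast
        \<comment> \<open>push \<open>g\<close> forward to a common stage and pull it back to stage \<open>n\<close>\<close>
        let ?p = "max m n"
        have "strans S c m ?p \<cdot>\<^bsub>S\<^esub> g \<in> Hom S x (sob c ?p)"
          using S.Comp_Hom[OF g(1) S.strans_Hom[OF s]] by simp
        then obtain h where h: "h \<in> Hom S x (sob c n)" "strans S c n ?p \<cdot>\<^bsub>S\<^esub> h = strans S c m ?p \<cdot>\<^bsub>S\<^esub> g"
          using N[OF n _ xi, of ?p] by (metis (no_types, lifting) bij_betw_imp_surj_on imageE max.cobounded2)
        have "\<iota> n \<cdot>\<^bsub>T\<^esub> fmor F h = \<iota> m \<cdot>\<^bsub>T\<^esub> fmor F g"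
          using cocone_strans_Comp[OF s co _ h(1), of ?p] cocone_strans_Comp[OF s co _ g(1), of ?p] h(2) by simp
        also have "\<dots> = l" using g(2) nat_map_ycls[OF s co x g(1)] by simp
        finally show ?thesis using h(1) by blast
      qed
      ultimately have "bij_betw (\<lambda>g. \<iota> n \<cdot>\<^bsub>T\<^esub> fmor F g) (Hom S x (sob c n)) (Hom T (fob F x) H)"
        using T.Comp_Hom[OF F_Hom \<iota>] unfolding bij_betw_def by blast
      then show ?thesis using full_bij_iff[OF \<iota> x o] by blast
    qed
    then show ?thesis by blast
  qed
  then have "approx c H \<iota>" using s co unfolding approx_def by blast
  then show ?thesis using approx_iso[OF _ H(2)] H(3) by presburger
qed

section \<open>Objects detected by the image of the functor\<close>

text \<open>The right orthogonal of the image of \<open>F\<close>, and the left orthogonal of that. Among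
  objects of the latter, a map is an isomorphism if the functors \<open>Hom(F(s), -)\<close> say so.\<close>

definition invisible :: "'p \<Rightarrow> bool" where
  "invisible K \<longleftrightarrow> K \<in> Obj T \<and> (\<forall>s \<in> Obj S. \<forall>g \<in> Hom T (fob F s) K. g = Zero T (fob F s) K)"

definition visible :: "'p set" where
  "visible = {X \<in> Obj T. \<forall>K. invisible K \<longrightarrow> (\<forall>g \<in> Hom T X K. g = Zero T X K)}"

lemma visibleD: "\<lbrakk>X \<in> visible; invisible K; g \<in> Hom T X K\<rbrakk> \<Longrightarrow> g = Zero T X K"
  and visible_Obj: "X \<in> visible \<Longrightarrow> X \<in> Obj T"
  by (auto simp: visible_def)

lemma invisible_UnshO:
  assumes K: "invisible K"
  shows "invisible (UnshO T K)"
  unfolding invisible_def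
proof (intro conjI ballI)
  have KO: "K \<in> Obj T" using K by (simp add: invisible_def)
  show U: "UnshO T K \<in> Obj T" using T.UnshO_Obj[OF KO] .
  fix s g assume s: "s \<in> Obj S" and g: "g \<in> Hom T (fob F s) (UnshO T K)"
  let ?z = "Zero T (fob F s) (UnshO T K)"
  have b: "bij_betw (\<lambda>k. ShM T k \<cdot>\<^bsub>T\<^esub> fsh F s) (Hom T (fob F s) (UnshO T K)) (Hom T (fob F (ShO S s)) K)"
    using shift_transport[OF s U] T.ShO_UnshO[OF KO] by simp
  have z: "k = Zero T (fob F (ShO S s)) K" if "k \<in> Hom T (fob F (ShO S s)) K" for k
    using K S.ShO_Obj[OF s] that unfolding invisible_def by blast
  have zz: "?z \<in> Hom T (fob F s) (UnshO T K)" using T.Zero_Hom[OF F_Obj[OF s] U] .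
  have "ShM T g \<cdot>\<^bsub>T\<^esub> fsh F s = ShM T ?z \<cdot>\<^bsub>T\<^esub> fsh F s"
    using z[of "ShM T g \<cdot>\<^bsub>T\<^esub> fsh F s"] z[of "ShM T ?z \<cdot>\<^bsub>T\<^esub> fsh F s"] bij_betwE[OF b] g zz by simp
  then show "g = ?z" using b g zz unfolding bij_betw_def inj_on_def by blast
qed

lemma visible_ShO_zero:
  assumes X: "X \<in> visible" and K: "invisible K" and g: "g \<in> Hom T (ShO T X) K"
  shows "g = Zero T (ShO T X) K"
proof -
  have o: "X \<in> Obj T" "K \<in> Obj T" "UnshO T K \<in> Obj T"
    using visible_Obj[OF X] K T.UnshO_Obj by (auto simp: invisible_def)
  have "UnshM T g \<in> Hom T X (UnshO T K)" using T.UnshM_Hom[OF g] T.UnshO_ShO[OF o(1)] by simp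
  then have "UnshM T g = Zero T X (UnshO T K)" using visibleD[OF X invisible_UnshO[OF K]] by blast
  then show ?thesis
    using T.ShM_UnshM[OF g] T.ShM_Zero[OF o(1,3)] T.ShO_UnshO[OF o(2)] by simp
qed

text \<open>A map from the cone to an invisible object vanishes on \<open>B\<close>, hence comes from \<open>\<Sigma>A\<close>, where it
  vanishes because invisible objects are closed under \<open>\<Sigma>\<^sup>-\<^sup>1\<close>.\<close>

lemma visible_cone:
  assumes d: "Dist T f g h" and f: "f \<in> Hom T A B" and g: "g \<in> Hom T B X" and h: "h \<in> Hom T X (ShO T A)"
    and A: "A \<in> visible" and B: "B \<in> visible"
  shows "X \<in> visible"
  unfolding visible_def
proof (intro CollectI conjI allI impI ballI)
  show X: "X \<in> Obj T" using T.Hom_objs[OF h] by simp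
  fix K k assume K: "invisible K" and k: "k \<in> Hom T X K"
  have KO: "K \<in> Obj T" using K by (simp add: invisible_def)
  have "k \<cdot>\<^bsub>T\<^esub> g = Zero T B K" using visibleD[OF B K T.Comp_Hom[OF g k]] .
  then obtain l where l: "l \<in> Hom T (ShO T A) K" "k = l \<cdot>\<^bsub>T\<^esub> h"
    using T.Dist_coexact[OF g h T.Dist_rotate(2)[OF f g h d] T.Dist_rotate(1)[OF f g h d] k] by blast
  then show "k = Zero T X K" using visible_ShO_zero[OF A K l(1)] T.Zero_Comp[OF h KO] by simp
qed

lemma visible_iso:
  assumes u: "is_iso_mor T u H X" and H: "H \<in> visible"
  shows "X \<in> visible"
  unfolding visible_def
proof (intro CollectI conjI allI impI ballI)
  obtain u' where u': "u \<in> Hom T H X" "u' \<in> Hom T X H" "u \<cdot>\<^bsub>T\<^esub> u' = Ident T X"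
    using T.is_iso_morE[OF u] .
  show X: "X \<in> Obj T" using T.Hom_objs[OF u'(1)] by simp
  fix K k assume K: "invisible K" and k: "k \<in> Hom T X K"
  have KO: "K \<in> Obj T" using K by (simp add: invisible_def)
  have "k = (k \<cdot>\<^bsub>T\<^esub> u) \<cdot>\<^bsub>T\<^esub> u'"
    using T.Comp_assoc[OF u'(2,1) k] u'(3) T.Comp_Ident[OF k] by simp
  then show "k = Zero T X K"
    using visibleD[OF H K T.Comp_Hom[OF u'(1) k]] T.Zero_Comp[OF u'(2) KO] by simp
qed

lemma F_visible: "s \<in> Obj S \<Longrightarrow> fob F s \<in> visible"
  using F_Obj by (auto simp: visible_def invisible_def)

text \<open>The coproduct of the \<open>F(c\<^sub>n)\<close> has no nonzero maps to invisible objects, and the homotopy colimit is a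
  cone of an endomorphism of it.\<close>

lemma hocolim_visible:
  assumes c: "is_sequence S c" and H: "is_hocolim T (image_seq F c) H \<iota>"
  shows "H \<in> visible"
proof -
  obtain P i d q w where P: "is_coproduct T (\<lambda>n. fob F (sob c n)) P i" "d \<in> Hom T P P"
    "q \<in> Hom T P H" "Dist T d q w"
    using H unfolding is_hocolim_def image_seq_def by auto
  have w: "w \<in> Hom T H (ShO T P)"
    using T.Dist_types[OF P(4)] T.Hom_Dom_Cod[OF P(2)] T.Hom_Dom_Cod[OF P(3)] by metis
  have i: "\<And>n. i n \<in> Hom T (fob F (sob c n)) P" and PO: "P \<in> Obj T"
    using P(1) unfolding is_coproduct_def by blast+
  have "g = Zero T P K" if K: "invisible K" and g: "g \<in> Hom T P K" for K g
  proof -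
    have KO: "K \<in> Obj T" using K by (simp add: invisible_def)
    have z: "k \<cdot>\<^bsub>T\<^esub> i n = Zero T (fob F (sob c n)) K" if "k \<in> Hom T P K" for k n
      using K T.Comp_Hom[OF i that] c unfolding invisible_def is_sequence_def by blast
    show ?thesis
      using T.coproduct_ext[OF P(1) g T.Zero_Hom[OF PO KO]] z[OF g] z[OF T.Zero_Hom[OF PO KO]] by simp
  qed
  then have "P \<in> visible" using PO by (simp add: visible_def)
  then show ?thesis using visible_cone[OF P(4,2,3) w] by blast
qed

lemma presentation_visible:
  assumes "is_Cauchy S M c" "hocolim_presentation T (image_seq F c) X \<alpha>"
  shows "X \<in> visible"
proof -
  obtain H \<iota> u where H: "is_hocolim T (image_seq F c) H \<iota>" "is_iso_mor T u H X"
    using assms(2) unfolding hocolim_presentation_def by blast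
  have "is_sequence S c" using assms(1) by (simp add: is_Cauchy_def)
  then show ?thesis using visible_iso[OF H(2) hocolim_visible[OF _ H(1)]] by blast
qed

lemma zero_if_invisible_visible:
  assumes K: "invisible K" "K \<in> visible"
  shows "is_zero_object T K"
  using T.zero_objectI[OF visible_Obj[OF K(2)] visibleD[OF K(2,1) T.Ident_Hom[OF visible_Obj[OF K(2)]]]] .

text \<open>The cone of \<open>\<psi>\<close> is invisible because \<open>\<psi>\<close> is bijective on all \<open>Hom(F(s), -)\<close>, and it is
  visible because \<open>H\<close> and \<open>X\<close> are. So the identity of the cone is zero. The injectivity needed on
  \<open>Hom(F(s), \<Sigma>H)\<close> is the hypothesis for \<open>\<Sigma>\<^sup>-\<^sup>1s\<close>.\<close>

lemma iso_if_visibly_iso: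
  assumes \<psi>: "\<psi> \<in> Hom T H X" and H: "H \<in> visible" and X: "X \<in> visible"
    and b: "\<And>s. s \<in> Obj S \<Longrightarrow> bij_betw (\<lambda>g. \<psi> \<cdot>\<^bsub>T\<^esub> g) (Hom T (fob F s) H) (Hom T (fob F s) X)"
  shows "is_iso_mor T \<psi> H X"
proof -
  obtain K k l where K: "Dist T \<psi> k l" "k \<in> Hom T X K" "l \<in> Hom T K (ShO T H)"
    using T.cone_exists[OF \<psi>] .
  have o: "H \<in> Obj T" "X \<in> Obj T" using T.Hom_objs[OF \<psi>] by auto
  have "u = Zero T (fob F s) K" if s: "s \<in> Obj S" and u: "u \<in> Hom T (fob F s) K" for s u
  proof (rule T.cone_Hom_zero[OF \<psi> K(2,3,1) _ _ u])
    show "\<exists>m \<in> Hom T (fob F s) H. \<psi> \<cdot>\<^bsub>T\<^esub> m = m'" if "m' \<in> Hom T (fob F s) X" for m'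
      using b[OF s] that by (metis (no_types, lifting) bij_betw_imp_surj_on imageE)
    fix m assume m: "m \<in> Hom T (fob F s) (ShO T H)"
      and z: "ShM T \<psi> \<cdot>\<^bsub>T\<^esub> m = Zero T (fob F s) (ShO T X)"
    let ?z = "Zero T (fob F s) (ShO T H)"
    have "ShM T \<psi> \<cdot>\<^bsub>T\<^esub> ?z = Zero T (fob F s) (ShO T X)"
      using T.Comp_Zero[OF T.ShM_Hom[OF \<psi>] F_Obj[OF s]] .
    then have e: "ShM T \<psi> \<cdot>\<^bsub>T\<^esub> m = ShM T \<psi> \<cdot>\<^bsub>T\<^esub> ?z" using z by simp
    have zz: "?z \<in> Hom T (fob F s) (ShO T H)" using T.Zero_Hom[OF F_Obj[OF s] T.ShO_Obj[OF o(1)]] .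
    have "inj_on (\<lambda>k. ShM T \<psi> \<cdot>\<^bsub>T\<^esub> k) (Hom T (fob F s) (ShO T H))"
      using bij_ShM[OF S.UnshO_Obj[OF s] \<psi> b[OF S.UnshO_Obj[OF s]]] S.ShO_UnshO[OF s]
      by (simp add: bij_betw_def)
    from inj_onD[OF this e m zz] show "m = ?z" .
  qed
  then have "invisible K" using T.Hom_objs[OF K(2)] unfolding invisible_def by blast
  then have "is_zero_object T K"
    using zero_if_invisible_visible visible_cone[OF K(1) \<psi> K(2,3) H X] by blast
  then show ?thesis using T.iso_if_cone_zero[OF \<psi> K(2,3,1)] by blast
qed

section \<open>Comparison with homotopy colimits\<close>

lemma hocolim_exists:
  assumes c: "is_Cauchy S M c"
  obtains H \<kappa> where "is_hocolim T (image_seq F c) H \<kappa>"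
proof -
  have s: "is_sequence S c" using c by (simp add: is_Cauchy_def)
  obtain P i where P: "is_coproduct T (\<lambda>n. fob F (sob c n)) P i"
    using ext c unfolding good_extension_def by blast
  have i: "\<And>n. i n \<in> Hom T (fob F (sob c n)) P" and PO: "P \<in> Obj T"
    using P unfolding is_coproduct_def by blast+
  let ?e = "\<lambda>n. Plus T (i n) (Neg T (i (Suc n) \<cdot>\<^bsub>T\<^esub> fmor F (smap c n)))"
  have "?e n \<in> Hom T (fob F (sob c n)) P" for n
  proof -
    have "smap c n \<in> Hom S (sob c n) (sob c (Suc n))" using s by (simp add: is_sequence_def)
    then show ?thesis using T.Plus_closed[OF i T.Neg_Hom[OF T.Comp_Hom[OF F_Hom i]]] by blast
  qed
  then obtain d where d: "d \<in> Hom T P P" "\<And>n. d \<cdot>\<^bsub>T\<^esub> i n = ?e n"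
    using T.coproduct_ex[OF P PO, of ?e] by metis
  obtain H q w where "Dist T d q w" "q \<in> Hom T P H" using T.cone_exists[OF d(1)] .
  with P d have "is_hocolim T (image_seq F c) H (\<lambda>n. q \<cdot>\<^bsub>T\<^esub> i n)"
    unfolding is_hocolim_def image_seq_def
    by (intro exI[of _ P] exI[of _ i] exI[of _ d] exI[of _ q] exI[of _ w]) simp
  then show thesis using that by blast
qed

text \<open>The cocone \<open>\<gamma>\<close> extends, in general not uniquely, to a map \<open>\<psi>\<close> on the homotopy colimit. Any
  extension will do: \<open>\<psi>\<close> is bijective on all \<open>Hom(F(s), -)\<close> because \<open>\<kappa>\<close> and \<open>\<gamma>\<close> both are
  approximations.\<close>

lemma hocolim_comparison:
  assumes \<gamma>: "approx c X \<gamma>" and X: "X \<in> visible" and H: "is_hocolim T (image_seq F c) H \<kappa>"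
  shows "\<exists>\<psi>. is_iso_mor T \<psi> H X \<and> (\<forall>n. \<psi> \<cdot>\<^bsub>T\<^esub> \<kappa> n = \<gamma> n)"
proof -
  note c = approxE(1)[OF \<gamma>]
  note \<gamma>H = approxE(3)[OF \<gamma>]
  have XO: "X \<in> Obj T" using visible_Obj[OF X] .
  obtain P i d q w where P: "is_coproduct T (\<lambda>n. fob F (sob c n)) P i" "d \<in> Hom T P P"
    "\<And>n. d \<cdot>\<^bsub>T\<^esub> i n = Plus T (i n) (Neg T (i (Suc n) \<cdot>\<^bsub>T\<^esub> fmor F (smap c n)))"
    "q \<in> Hom T P H" "Dist T d q w" "\<And>n. \<kappa> n = q \<cdot>\<^bsub>T\<^esub> i n"
    using H unfolding is_hocolim_def image_seq_def by auto
  have w: "w \<in> Hom T H (ShO T P)"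
    using T.Dist_types[OF P(5)] T.Hom_Dom_Cod[OF P(2)] T.Hom_Dom_Cod[OF P(4)] by metis
  have i: "\<And>n. i n \<in> Hom T (fob F (sob c n)) P" and PO: "P \<in> Obj T"
    using P(1) unfolding is_coproduct_def by blast+
  obtain k where k: "k \<in> Hom T P X" "\<And>n. k \<cdot>\<^bsub>T\<^esub> i n = \<gamma> n"
    using T.coproduct_ex[OF P(1) XO, of \<gamma>, OF \<gamma>H] by metis
  have "(k \<cdot>\<^bsub>T\<^esub> d) \<cdot>\<^bsub>T\<^esub> i n = Zero T (fob F (sob c n)) X" for n
  proof -
    have s: "fmor F (smap c n) \<in> Hom T (fob F (sob c n)) (fob F (sob c (Suc n)))"
      using c F_Hom by (simp add: is_sequence_def)
    let ?j = "i (Suc n) \<cdot>\<^bsub>T\<^esub> fmor F (smap c n)"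
    have j: "?j \<in> Hom T (fob F (sob c n)) P" using T.Comp_Hom[OF s i] .
    have kj: "k \<cdot>\<^bsub>T\<^esub> ?j = \<gamma> n"
      using T.Comp_assoc[OF s i k(1)] k(2) approxE(2)[OF \<gamma>] by (simp add: seq_cocone_def image_seq_def)
    have "(k \<cdot>\<^bsub>T\<^esub> d) \<cdot>\<^bsub>T\<^esub> i n = Plus T (\<gamma> n) (Neg T (k \<cdot>\<^bsub>T\<^esub> ?j))"
      using T.Comp_assoc[OF i P(2) k(1)] P(3) T.Plus_Comp[OF i T.Neg_Hom[OF j] k(1)]
        T.Comp_Neg[OF j k(1)] k(2) by simp
    then show ?thesis using kj T.Plus_Neg[OF \<gamma>H] by simp
  qed
  moreover have "Zero T P X \<cdot>\<^bsub>T\<^esub> i n = Zero T (fob F (sob c n)) X" for n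
    using T.Zero_Comp[OF i XO] .
  ultimately have "k \<cdot>\<^bsub>T\<^esub> d = Zero T P X"
    using T.coproduct_ext[OF P(1) T.Comp_Hom[OF P(2) k(1)] T.Zero_Hom[OF PO XO]] by simp
  then obtain \<psi> where \<psi>: "\<psi> \<in> Hom T H X" "k = \<psi> \<cdot>\<^bsub>T\<^esub> q"
    using T.Dist_coexact[OF P(2,4) w P(5) k(1)] by blast
  have \<psi>\<kappa>: "\<psi> \<cdot>\<^bsub>T\<^esub> \<kappa> n = \<gamma> n" for n
    using k(2) \<psi>(2) P(6) T.Comp_assoc[OF i P(4) \<psi>(1)] by simp
  have HO: "H \<in> Obj T" using T.Hom_objs[OF P(4)] by simp
  have "hocolim_presentation T (image_seq F c) H \<kappa>"
    unfolding hocolim_presentation_def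
  proof (intro exI conjI allI)
    show "is_hocolim T (image_seq F c) H \<kappa>" using H .
    show "is_iso_mor T (Ident T H) H H" using T.is_iso_mor_Ident[OF HO] .
    show "\<kappa> n = Ident T H \<cdot>\<^bsub>T\<^esub> \<kappa> n" for n using P(6) T.Ident_Comp[OF T.Comp_Hom[OF i P(4)]] by simp
  qed
  then have \<kappa>: "approx c H \<kappa>" using presentation_approx approx_Cauchy[OF \<gamma>] by blast
  have "is_iso_mor T \<psi> H X"
  proof (rule iso_if_visibly_iso[OF \<psi>(1) hocolim_visible[OF c H] X])
    fix s assume "s \<in> Obj S"
    then obtain j where j: "s \<in> test j" using ex_test by blast
    obtain N where N: "\<forall>n\<ge>N. \<forall>x \<in> test j.
        bij_betw (\<lambda>g. \<gamma> n \<cdot>\<^bsub>T\<^esub> g) (Hom T (fob F x) (fob F (sob c n))) (Hom T (fob F x) X)"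
      using approx_bij_T[OF \<gamma>] by blast
    obtain N' where N': "\<forall>n\<ge>N'. \<forall>x \<in> test j.
        bij_betw (\<lambda>g. \<kappa> n \<cdot>\<^bsub>T\<^esub> g) (Hom T (fob F x) (fob F (sob c n))) (Hom T (fob F x) H)"
      using approx_bij_T[OF \<kappa>] by blast
    let ?n = "max N N'"
    have 1: "bij_betw (\<lambda>g. \<gamma> ?n \<cdot>\<^bsub>T\<^esub> g) (Hom T (fob F s) (fob F (sob c ?n))) (Hom T (fob F s) X)"
      and 2: "bij_betw (\<lambda>g. \<kappa> ?n \<cdot>\<^bsub>T\<^esub> g) (Hom T (fob F s) (fob F (sob c ?n))) (Hom T (fob F s) H)"
      using N N' j by simp_all
    have "bij_betw ((\<lambda>g. \<psi> \<cdot>\<^bsub>T\<^esub> g) \<circ> (\<lambda>g. \<kappa> ?n \<cdot>\<^bsub>T\<^esub> g)) (Hom T (fob F s) (fob F (sob c ?n)))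
        (Hom T (fob F s) X)"
      by (rule iffD1[OF bij_betw_cong 1]) (simp add: T.Comp_assoc[OF _ approxE(3)[OF \<kappa>] \<psi>(1), symmetric] \<psi>\<kappa>)
    then show "bij_betw (\<lambda>g. \<psi> \<cdot>\<^bsub>T\<^esub> g) (Hom T (fob F s) H) (Hom T (fob F s) X)"
      using bij_betw_comp_iff[OF 2] by blast
  qed
  then show ?thesis using \<psi>\<kappa> by blast
qed

lemma Lprime_iff: "X \<in> Lprime S T M F \<longleftrightarrow> X \<in> visible \<and> (\<exists>c \<gamma>. approx c X \<gamma>)"
proof
  assume "X \<in> Lprime S T M F"
  then obtain a \<alpha> where "is_Cauchy S M a" "hocolim_presentation T (image_seq F a) X \<alpha>"
    unfolding Lprime_def by blast
  then show "X \<in> visible \<and> (\<exists>c \<gamma>. approx c X \<gamma>)"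
    using presentation_visible presentation_approx by blast
next
  assume "X \<in> visible \<and> (\<exists>c \<gamma>. approx c X \<gamma>)"
  then obtain c \<gamma> where X: "X \<in> visible" and \<gamma>: "approx c X \<gamma>" by blast
  obtain H \<kappa> where H: "is_hocolim T (image_seq F c) H \<kappa>"
    using hocolim_exists[OF approx_Cauchy[OF \<gamma>]] .
  obtain \<psi> where "is_iso_mor T \<psi> H X" "\<And>n. \<psi> \<cdot>\<^bsub>T\<^esub> \<kappa> n = \<gamma> n"
    using hocolim_comparison[OF \<gamma> X H] by blast
  then have "hocolim_presentation T (image_seq F c) X \<gamma>"
    unfolding hocolim_presentation_def using H by metis
  then show "X \<in> Lprime S T M F"
    unfolding Lprime_def using visible_Obj[OF X] approx_Cauchy[OF \<gamma>] by blast
qed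

section \<open>Completion to a Cauchy sequence of triangles\<close>

lemma approx_subsequence:
  assumes \<gamma>: "approx c X \<gamma>" and r: "strict_mono r"
  shows "approx (subsequence S r c) X (\<gamma> \<circ> r)"
  unfolding approx_def
proof (intro conjI allI)
  note c = approxE(1,2)[OF \<gamma>]
  show "is_sequence S (subsequence S r c)" using S.is_sequence_subsequence[OF c(1) r] .
  have "r n \<le> r (Suc n)" for n using r by (simp add: strict_mono_less_eq)
  then show "seq_cocone T (image_seq F (subsequence S r c)) X (\<gamma> \<circ> r)"
    using cocone_strans[OF c] approxE(3)[OF \<gamma>]
    by (simp add: seq_cocone_def image_seq_def subsequence_def)
  fix i
  obtain N where "\<forall>n\<ge>N. \<forall>x \<in> test i.
      bij_betw (\<lambda>g. \<gamma> n \<cdot>\<^bsub>T\<^esub> g) (Hom T (fob F x) (fob F (sob c n))) (Hom T (fob F x) X)"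
    using approx_bij_T[OF \<gamma>] by blast
  moreover have "N \<le> r n" if "N \<le> n" for n
    using strict_mono_imp_increasing[OF r, of n] that by simp
  ultimately show "\<exists>N. \<forall>n\<ge>N. \<forall>x \<in> test i.
      bij_betw (\<lambda>g. (\<gamma> \<circ> r) n \<cdot>\<^bsub>T\<^esub> g) (Hom T (fob F x) (fob F (sob (subsequence S r c) n))) (Hom T (fob F x) X)"
    by (auto simp: subsequence_def intro!: exI[of _ N])
qed

lemma F_cone_types:
  assumes d: "Dist S f g h" and f: "f \<in> Hom S a b" and g: "g \<in> Hom S b c" and h: "h \<in> Hom S c (ShO S a)"
  shows "Dist T (fmor F f) (fmor F g) (fsh F a \<cdot>\<^bsub>T\<^esub> fmor F h)"
    "fsh F a \<cdot>\<^bsub>T\<^esub> fmor F h \<in> Hom T (fob F c) (ShO T (fob F a))"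
  using F_Dist[OF d] S.Hom_Dom_Cod[OF f] T.Comp_Hom[OF F_Hom[OF h] fsh_Hom] S.Hom_objs[OF f] by auto

text \<open>Fill-ins of triangles are not unique, so cones chosen stage by stage need not form a sequence.
  Here the fixed target \<open>C\<close> restores uniqueness: a map into \<open>c\<^sub>m\<close> from a given object is determined
  by its composite with \<open>\<gamma>\<^sub>m\<close> once \<open>m\<close> is large, so the transition maps and their compatibility with
  the triangles can be read off in \<open>T\<close>.\<close>

lemma triangle_completion:
  assumes \<alpha>: "approx a A \<alpha>" and \<beta>: "approx b B \<beta>" and f: "seq_map S a b f"
    and \<phi>: "\<phi> \<in> Hom T A B" and v: "v \<in> Hom T B C" and w: "w \<in> Hom T C (ShO T A)" and d: "Dist T \<phi> v w"
    and sq: "\<And>n. \<phi> \<cdot>\<^bsub>T\<^esub> \<alpha> n = \<beta> n \<cdot>\<^bsub>T\<^esub> fmor F (f n)"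
  obtains t c g h \<gamma> where "strict_mono t" "approx c C \<gamma>"
    "seq_map S (subsequence S t b) c g" "seq_map S c (shift_seq S (subsequence S t a)) h"
    "\<And>n. Dist S (f (t n)) (g n) (h n)"
    "\<And>n. v \<cdot>\<^bsub>T\<^esub> \<beta> (t n) = \<gamma> n \<cdot>\<^bsub>T\<^esub> fmor F (g n)"
    "\<And>n. w \<cdot>\<^bsub>T\<^esub> \<gamma> n = ShM T (\<alpha> (t n)) \<cdot>\<^bsub>T\<^esub> (fsh F (sob a (t n)) \<cdot>\<^bsub>T\<^esub> fmor F (h n))"
proof -
  note a = approxE(1,2)[OF \<alpha>] and \<alpha>H = approxE(3)[OF \<alpha>] and aO = approxE(4)[OF \<alpha>]
  note b = approxE(1,2)[OF \<beta>] and \<beta>H = approxE(3)[OF \<beta>] and bO = approxE(4)[OF \<beta>]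
  have fH: "f n \<in> Hom S (sob a n) (sob b n)" for n using f by (simp add: seq_map_def)
  have "\<exists>c g h \<gamma>. Dist S (f n) g h \<and> g \<in> Hom S (sob b n) c \<and> h \<in> Hom S c (ShO S (sob a n)) \<and>
      \<gamma> \<in> Hom T (fob F c) C \<and> v \<cdot>\<^bsub>T\<^esub> \<beta> n = \<gamma> \<cdot>\<^bsub>T\<^esub> fmor F g \<and>
      w \<cdot>\<^bsub>T\<^esub> \<gamma> = ShM T (\<alpha> n) \<cdot>\<^bsub>T\<^esub> (fsh F (sob a n) \<cdot>\<^bsub>T\<^esub> fmor F h)" for n
  proof -
    obtain c g h where c: "Dist S (f n) g h" "g \<in> Hom S (sob b n) c" "h \<in> Hom S c (ShO S (sob a n))"
      using S.cone_exists[OF fH] .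
    note Fc = F_cone_types[OF c(1) fH c(2,3)]
    show ?thesis
      using T.TR3[OF Fc(1) F_Hom[OF fH] F_Hom[OF c(2)] Fc(2) d \<phi> v w \<alpha>H \<beta>H sq] c by blast
  qed
  then obtain c0 g0 h0 \<gamma>0 where c0: "\<And>n. Dist S (f n) (g0 n) (h0 n)"
    "\<And>n. g0 n \<in> Hom S (sob b n) (c0 n)" "\<And>n. h0 n \<in> Hom S (c0 n) (ShO S (sob a n))"
    "\<And>n. \<gamma>0 n \<in> Hom T (fob F (c0 n)) C" "\<And>n. v \<cdot>\<^bsub>T\<^esub> \<beta> n = \<gamma>0 n \<cdot>\<^bsub>T\<^esub> fmor F (g0 n)"
    "\<And>n. w \<cdot>\<^bsub>T\<^esub> \<gamma>0 n = ShM T (\<alpha> n) \<cdot>\<^bsub>T\<^esub> (fsh F (sob a n) \<cdot>\<^bsub>T\<^esub> fmor F (h0 n))"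
    by metis
  have c0O: "c0 n \<in> Obj S" for n using S.Hom_objs[OF c0(2)] by blast
  have bij: "\<exists>N. \<forall>n\<ge>N. \<forall>x \<in> test i.
      bij_betw (\<lambda>g. \<gamma>0 n \<cdot>\<^bsub>T\<^esub> g) (Hom T (fob F x) (fob F (c0 n))) (Hom T (fob F x) C)" for i
  proof -
    obtain N1 where N1: "\<forall>n\<ge>N1. \<forall>x \<in> test (Suc i).
        bij_betw (\<lambda>g. \<alpha> n \<cdot>\<^bsub>T\<^esub> g) (Hom T (fob F x) (fob F (sob a n))) (Hom T (fob F x) A)"
      using approx_bij_T[OF \<alpha>] by blast
    obtain N2 where N2: "\<forall>n\<ge>N2. \<forall>x \<in> test (Suc i).
        bij_betw (\<lambda>g. \<beta> n \<cdot>\<^bsub>T\<^esub> g) (Hom T (fob F x) (fob F (sob b n))) (Hom T (fob F x) B)"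
      using approx_bij_T[OF \<beta>] by blast
    have "bij_betw (\<lambda>g. \<gamma>0 n \<cdot>\<^bsub>T\<^esub> g) (Hom T (fob F x) (fob F (c0 n))) (Hom T (fob F x) C)"
      if n: "max N1 N2 \<le> n" and x: "x \<in> test i" for n x
    proof -
      note Fc = F_cone_types[OF c0(1) fH c0(2,3)]
      have xO: "x \<in> Obj S" and x': "x \<in> test (Suc i)" using test_Obj x test_Suc by blast+
      note y = test_UnshO[OF x] and yx = S.ShO_UnshO[OF xO]
      have b1: "bij_betw (\<lambda>g. \<alpha> n \<cdot>\<^bsub>T\<^esub> g) (Hom T (fob F z) (fob F (sob a n))) (Hom T (fob F z) A)"
        and b2: "bij_betw (\<lambda>g. \<beta> n \<cdot>\<^bsub>T\<^esub> g) (Hom T (fob F z) (fob F (sob b n))) (Hom T (fob F z) B)"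
        if "z \<in> test (Suc i)" for z using N1 N2 n that by simp_all
      show ?thesis
        using T.five_lemma[OF Fc(1) F_Hom[OF fH] F_Hom[OF c0(2)] Fc(2) d \<phi> v w \<alpha>H \<beta>H c0(4) sq c0(5,6)
            b1[OF x'] b2[OF x'] _ _ F_Obj[OF xO]]
          bij_ShM[OF test_Obj[OF y] \<alpha>H b1[OF y]] bij_ShM[OF test_Obj[OF y] \<beta>H b2[OF y]]
        unfolding yx by blast
    qed
    then show ?thesis by blast
  qed
  \<comment> \<open>a stage from which on maps from \<open>c\<^sub>n\<close> and \<open>b\<^sub>n\<close> to \<open>c\<^sub>m\<close>, and from \<open>c\<^sub>n\<close> to \<open>\<Sigma>a\<^sub>m\<close>, are determined in \<open>T\<close>\<close>
  have "\<exists>K>n. \<forall>m\<ge>K.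
      bij_betw (\<lambda>g. \<gamma>0 m \<cdot>\<^bsub>T\<^esub> fmor F g) (Hom S (c0 n) (c0 m)) (Hom T (fob F (c0 n)) C) \<and>
      bij_betw (\<lambda>g. \<gamma>0 m \<cdot>\<^bsub>T\<^esub> fmor F g) (Hom S (sob b n) (c0 m)) (Hom T (fob F (sob b n)) C) \<and>
      bij_betw (\<lambda>k. ShM T (\<alpha> m) \<cdot>\<^bsub>T\<^esub> k) (Hom T (fob F (c0 n)) (ShO T (fob F (sob a m))))
        (Hom T (fob F (c0 n)) (ShO T A))" for n
  proof -
    obtain i j k where i: "c0 n \<in> test i" and j: "sob b n \<in> test j" and k: "UnshO S (c0 n) \<in> test k"
      using ex_test[OF c0O] ex_test[OF bO] ex_test[OF S.UnshO_Obj[OF c0O]] by metis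
    obtain Ni where Ni: "\<forall>n\<ge>Ni. \<forall>x \<in> test i.
        bij_betw (\<lambda>g. \<gamma>0 n \<cdot>\<^bsub>T\<^esub> g) (Hom T (fob F x) (fob F (c0 n))) (Hom T (fob F x) C)"
      using bij by blast
    obtain Nj where Nj: "\<forall>n\<ge>Nj. \<forall>x \<in> test j.
        bij_betw (\<lambda>g. \<gamma>0 n \<cdot>\<^bsub>T\<^esub> g) (Hom T (fob F x) (fob F (c0 n))) (Hom T (fob F x) C)"
      using bij by blast
    obtain Nk where Nk: "\<forall>n\<ge>Nk. \<forall>x \<in> test k.
        bij_betw (\<lambda>g. \<alpha> n \<cdot>\<^bsub>T\<^esub> g) (Hom T (fob F x) (fob F (sob a n))) (Hom T (fob F x) A)"
      using approx_bij_T[OF \<alpha>] by blast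
    define K where "K = Max {Suc n, Ni, Nj, Nk}"
    have K: "Suc n \<le> K" "Ni \<le> K" "Nj \<le> K" "Nk \<le> K" by (auto simp: K_def)
    have "bij_betw (\<lambda>g. \<gamma>0 m \<cdot>\<^bsub>T\<^esub> fmor F g) (Hom S (c0 n) (c0 m)) (Hom T (fob F (c0 n)) C) \<and>
      bij_betw (\<lambda>g. \<gamma>0 m \<cdot>\<^bsub>T\<^esub> fmor F g) (Hom S (sob b n) (c0 m)) (Hom T (fob F (sob b n)) C) \<and>
      bij_betw (\<lambda>k. ShM T (\<alpha> m) \<cdot>\<^bsub>T\<^esub> k) (Hom T (fob F (c0 n)) (ShO T (fob F (sob a m))))
        (Hom T (fob F (c0 n)) (ShO T A))" if m: "K \<le> m" for m
    proof (intro conjI)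
      show "bij_betw (\<lambda>g. \<gamma>0 m \<cdot>\<^bsub>T\<^esub> fmor F g) (Hom S (c0 n) (c0 m)) (Hom T (fob F (c0 n)) C)"
        using full_bij_iff[OF c0(4) c0O c0O, of m n] Ni i K m by simp
      show "bij_betw (\<lambda>g. \<gamma>0 m \<cdot>\<^bsub>T\<^esub> fmor F g) (Hom S (sob b n) (c0 m)) (Hom T (fob F (sob b n)) C)"
        using full_bij_iff[OF c0(4) bO c0O, of m n] Nj j K m by simp
      have "bij_betw (\<lambda>g. \<alpha> m \<cdot>\<^bsub>T\<^esub> g) (Hom T (fob F (UnshO S (c0 n))) (fob F (sob a m)))
          (Hom T (fob F (UnshO S (c0 n))) A)" using Nk k K m by simp
      from bij_ShM[OF S.UnshO_Obj[OF c0O] \<alpha>H this]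
      show "bij_betw (\<lambda>k. ShM T (\<alpha> m) \<cdot>\<^bsub>T\<^esub> k) (Hom T (fob F (c0 n)) (ShO T (fob F (sob a m))))
          (Hom T (fob F (c0 n)) (ShO T A))" unfolding S.ShO_UnshO[OF c0O] .
    qed
    then show ?thesis using K(1) Suc_le_lessD by blast
  qed
  then obtain K where K: "\<And>n. n < K n"
    "\<And>n m. K n \<le> m \<Longrightarrow>
      bij_betw (\<lambda>g. \<gamma>0 m \<cdot>\<^bsub>T\<^esub> fmor F g) (Hom S (c0 n) (c0 m)) (Hom T (fob F (c0 n)) C)"
    "\<And>n m. K n \<le> m \<Longrightarrow>
      bij_betw (\<lambda>g. \<gamma>0 m \<cdot>\<^bsub>T\<^esub> fmor F g) (Hom S (sob b n) (c0 m)) (Hom T (fob F (sob b n)) C)"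
    "\<And>n m. K n \<le> m \<Longrightarrow>
      bij_betw (\<lambda>k. ShM T (\<alpha> m) \<cdot>\<^bsub>T\<^esub> k) (Hom T (fob F (c0 n)) (ShO T (fob F (sob a m))))
        (Hom T (fob F (c0 n)) (ShO T A))"
    by metis
  have "\<exists>\<kappa> \<in> Hom S (c0 n) (c0 m). \<gamma>0 m \<cdot>\<^bsub>T\<^esub> fmor F \<kappa> = \<gamma>0 n \<and>
      g0 m \<cdot>\<^bsub>S\<^esub> strans S b n m = \<kappa> \<cdot>\<^bsub>S\<^esub> g0 n \<and>
      h0 m \<cdot>\<^bsub>S\<^esub> \<kappa> = ShM S (strans S a n m) \<cdot>\<^bsub>S\<^esub> h0 n" if m: "K n \<le> m" for n m
  proof -
    have nm: "n \<le> m" using K(1)[of n] m by simp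
    note ta = S.strans_Hom[OF a(1) nm] and tb = S.strans_Hom[OF b(1) nm]
    obtain \<kappa> where \<kappa>: "\<kappa> \<in> Hom S (c0 n) (c0 m)" "\<gamma>0 m \<cdot>\<^bsub>T\<^esub> fmor F \<kappa> = \<gamma>0 n"
      using K(2)[OF m] c0(4)[of n] by (metis (no_types, lifting) bij_betw_imp_surj_on imageE)
    have gt: "g0 m \<cdot>\<^bsub>S\<^esub> strans S b n m \<in> Hom S (sob b n) (c0 m)" and
      \<kappa>g: "\<kappa> \<cdot>\<^bsub>S\<^esub> g0 n \<in> Hom S (sob b n) (c0 m)"
      using S.Comp_Hom[OF tb c0(2)] S.Comp_Hom[OF c0(2) \<kappa>(1)] by auto
    have "\<gamma>0 m \<cdot>\<^bsub>T\<^esub> fmor F (g0 m \<cdot>\<^bsub>S\<^esub> strans S b n m) = v \<cdot>\<^bsub>T\<^esub> (\<beta> m \<cdot>\<^bsub>T\<^esub> fmor F (strans S b n m))"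
      using F_Comp[OF tb c0(2)] T.Comp_assoc[OF F_Hom[OF tb] F_Hom[OF c0(2)] c0(4)] c0(5)[of m]
        T.Comp_assoc[OF F_Hom[OF tb] \<beta>H v] by simp
    also have "\<dots> = \<gamma>0 n \<cdot>\<^bsub>T\<^esub> fmor F (g0 n)"
      using cocone_strans[OF b nm] c0(5)[of n] by simp
    also have "\<dots> = \<gamma>0 m \<cdot>\<^bsub>T\<^esub> fmor F (\<kappa> \<cdot>\<^bsub>S\<^esub> g0 n)"
      using F_Comp[OF c0(2) \<kappa>(1)] T.Comp_assoc[OF F_Hom[OF c0(2)] F_Hom[OF \<kappa>(1)] c0(4)] \<kappa>(2) by simp
    finally have 1: "g0 m \<cdot>\<^bsub>S\<^esub> strans S b n m = \<kappa> \<cdot>\<^bsub>S\<^esub> g0 n"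
      using bij_betw_imp_inj_on[OF K(3)[OF m]] gt \<kappa>g by (simp add: inj_on_def)
    \<comment> \<open>the map \<open>Hom(c\<^sub>n, \<Sigma>a\<^sub>m) \<rightarrow> Hom(F(c\<^sub>n), \<Sigma>A)\<close> induced by \<open>\<Sigma>\<alpha>\<^sub>m\<close>\<close>
    let ?\<Theta> = "\<lambda>u. ShM T (\<alpha> m) \<cdot>\<^bsub>T\<^esub> (fsh F (sob a m) \<cdot>\<^bsub>T\<^esub> fmor F u)"
    have inj: "inj_on ?\<Theta> (Hom S (c0 n) (ShO S (sob a m)))"
      using bij_betw_imp_inj_on[OF bij_betw_trans[OF bij_betw_trans[OF F_bij[OF c0O S.ShO_Obj[OF aO]]
        T.iso_Comp_bij[OF fsh_iso[OF aO]]] K(4)[OF m]]] by (simp add: comp_def)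
    note F\<kappa> = F_Hom[OF \<kappa>(1)] and Fh = F_Hom[OF c0(3)] and fa = fsh_Hom[OF aO]
    note \<alpha>s = T.ShM_Hom[OF \<alpha>H]
    have h\<kappa>: "h0 m \<cdot>\<^bsub>S\<^esub> \<kappa> \<in> Hom S (c0 n) (ShO S (sob a m))"
      and th: "ShM S (strans S a n m) \<cdot>\<^bsub>S\<^esub> h0 n \<in> Hom S (c0 n) (ShO S (sob a m))"
      using S.Comp_Hom[OF \<kappa>(1) c0(3)] S.Comp_Hom[OF c0(3) S.ShM_Hom[OF ta]] by auto
    have "?\<Theta> (h0 m \<cdot>\<^bsub>S\<^esub> \<kappa>) = ?\<Theta> (h0 m) \<cdot>\<^bsub>T\<^esub> fmor F \<kappa>"
      using F_Comp[OF \<kappa>(1) c0(3)] T.Comp_assoc[OF F\<kappa> Fh fa]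
        T.Comp_assoc[OF F\<kappa> T.Comp_Hom[OF Fh fa] \<alpha>s] by simp
    also have "\<dots> = w \<cdot>\<^bsub>T\<^esub> \<gamma>0 n"
      using T.Comp_assoc[OF F\<kappa> c0(4) w] \<kappa>(2) c0(6)[of m] by simp
    also have "\<dots> = ShM T (\<alpha> m \<cdot>\<^bsub>T\<^esub> fmor F (strans S a n m)) \<cdot>\<^bsub>T\<^esub> (fsh F (sob a n) \<cdot>\<^bsub>T\<^esub> fmor F (h0 n))"
      using cocone_strans[OF a nm] c0(6)[of n] by simp
    also have "\<dots> = ShM T (\<alpha> m) \<cdot>\<^bsub>T\<^esub> (ShM T (fmor F (strans S a n m)) \<cdot>\<^bsub>T\<^esub> (fsh F (sob a n) \<cdot>\<^bsub>T\<^esub> fmor F (h0 n)))"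
      using T.ShM_Comp[OF F_Hom[OF ta] \<alpha>H]
        T.Comp_assoc[OF T.Comp_Hom[OF Fh fa] T.ShM_Hom[OF F_Hom[OF ta]] \<alpha>s] by simp
    also have "ShM T (fmor F (strans S a n m)) \<cdot>\<^bsub>T\<^esub> (fsh F (sob a n) \<cdot>\<^bsub>T\<^esub> fmor F (h0 n)) =
        fsh F (sob a m) \<cdot>\<^bsub>T\<^esub> (fmor F (ShM S (strans S a n m)) \<cdot>\<^bsub>T\<^esub> fmor F (h0 n))"
      using T.Comp_assoc[OF Fh fa T.ShM_Hom[OF F_Hom[OF ta]]] fsh_nat[OF ta]
        T.Comp_assoc[OF Fh F_Hom[OF S.ShM_Hom[OF ta]] fa] by simp
    also have "fmor F (ShM S (strans S a n m)) \<cdot>\<^bsub>T\<^esub> fmor F (h0 n) = fmor F (ShM S (strans S a n m) \<cdot>\<^bsub>S\<^esub> h0 n)"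
      using F_Comp[OF c0(3) S.ShM_Hom[OF ta]] by simp
    finally have "h0 m \<cdot>\<^bsub>S\<^esub> \<kappa> = ShM S (strans S a n m) \<cdot>\<^bsub>S\<^esub> h0 n"
      using inj_onD[OF inj _ h\<kappa> th] by blast
    with 1 \<kappa> show ?thesis by blast
  qed
  then obtain \<kappa> where \<kappa>: "\<And>n m. K n \<le> m \<Longrightarrow> \<kappa> n m \<in> Hom S (c0 n) (c0 m)"
    "\<And>n m. K n \<le> m \<Longrightarrow> \<gamma>0 m \<cdot>\<^bsub>T\<^esub> fmor F (\<kappa> n m) = \<gamma>0 n"
    "\<And>n m. K n \<le> m \<Longrightarrow> g0 m \<cdot>\<^bsub>S\<^esub> strans S b n m = \<kappa> n m \<cdot>\<^bsub>S\<^esub> g0 n"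
    "\<And>n m. K n \<le> m \<Longrightarrow> h0 m \<cdot>\<^bsub>S\<^esub> \<kappa> n m = ShM S (strans S a n m) \<cdot>\<^bsub>S\<^esub> h0 n"
    by metis
  define t where "t = rec_nat 0 (\<lambda>_. K)"
  have t_Suc: "t (Suc n) = K (t n)" for n by (simp add: t_def)
  have t: "strict_mono t" using K(1) by (simp add: strict_mono_Suc_iff t_Suc)
  define c where "c = \<lparr>sob = (\<lambda>n. c0 (t n)), smap = (\<lambda>n. \<kappa> (t n) (t (Suc n)))\<rparr>"
  have tK: "K (t n) \<le> t (Suc n)" for n by (simp add: t_Suc)
  have \<gamma>: "approx c C (\<gamma>0 \<circ> t)"
    unfolding approx_def
  proof (intro conjI allI)
    show "is_sequence S c" using c0O \<kappa>(1)[OF tK] by (simp add: is_sequence_def c_def)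
    show "seq_cocone T (image_seq F c) C (\<gamma>0 \<circ> t)"
      using c0(4) \<kappa>(2)[OF tK] by (simp add: seq_cocone_def image_seq_def c_def)
    fix i
    obtain N where "\<forall>n\<ge>N. \<forall>x \<in> test i.
        bij_betw (\<lambda>g. \<gamma>0 n \<cdot>\<^bsub>T\<^esub> g) (Hom T (fob F x) (fob F (c0 n))) (Hom T (fob F x) C)"
      using bij by blast
    moreover have "N \<le> t n" if "N \<le> n" for n
      using strict_mono_imp_increasing[OF t, of n] that by simp
    ultimately show "\<exists>N. \<forall>n\<ge>N. \<forall>x \<in> test i.
        bij_betw (\<lambda>g. (\<gamma>0 \<circ> t) n \<cdot>\<^bsub>T\<^esub> g) (Hom T (fob F x) (fob F (sob c n))) (Hom T (fob F x) C)"
      by (auto simp: c_def intro!: exI[of _ N])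
  qed
  show thesis
  proof (rule that[OF t \<gamma>])
    show "seq_map S (subsequence S t b) c (g0 \<circ> t)"
      using c0(2) \<kappa>(3)[OF tK] by (simp add: seq_map_def subsequence_def c_def)
    show "seq_map S c (shift_seq S (subsequence S t a)) (h0 \<circ> t)"
      using c0(3) \<kappa>(4)[OF tK] by (simp add: seq_map_def subsequence_def c_def shift_seq_def)
  qed (use c0 in simp_all)
qed

end

section \<open>Maps between colimits and the strong triangle\<close>

lemma is_mod_map_comp:
  assumes S: "category S" and u: "is_mod_map S L M u" and v: "is_mod_map S M N v"
  shows "is_mod_map S L N (\<lambda>x m. v x (u x m))"
  unfolding is_mod_map_def
proof (intro conjI ballI allI)
  fix x assume x: "x \<in> Obj S"
  have "u x \<in> hom (val L x) (val M x)" "v x \<in> hom (val M x) (val N x)"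
    using x u v by (auto simp: is_mod_map_def)
  from hom_compose[OF this] show "(\<lambda>m. v x (u x m)) \<in> hom (val L x) (val N x)"
    by (simp add: comp_def)
next
  fix x y f m assume f: "f \<in> Hom S x y" and m: "m \<in> carrier (val L y)"
  have "y \<in> Obj S" using category.Cod_closed[OF S] f by (auto simp: Hom_def)
  then have "u y m \<in> carrier (val M y)" using u m by (auto simp: is_mod_map_def hom_def)
  then show "v x (u x (res L f m)) = res N f (v y (u y m))"
    using u v f m by (simp add: is_mod_map_def)
qed

lemma is_mod_iso_comp:
  assumes S: "category S" and u: "is_mod_iso S L M u" and v: "is_mod_iso S M N v"
  shows "is_mod_iso S L N (\<lambda>x m. v x (u x m))"
  unfolding is_mod_iso_def
proof (intro conjI ballI)
  show m: "is_mod_map S L N (\<lambda>x m. v x (u x m))"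
    using is_mod_map_comp[OF S] u v by (auto simp: is_mod_iso_def)
  fix x assume x: "x \<in> Obj S"
  then have "bij_betw (u x) (carrier (val L x)) (carrier (val M x))"
    "bij_betw (v x) (carrier (val M x)) (carrier (val N x))"
    using u v by (auto simp: is_mod_iso_def iso_def)
  from bij_betw_trans[OF this] show "(\<lambda>m. v x (u x m)) \<in> Group.iso (val L x) (val N x)"
    using m x by (simp add: is_mod_map_def iso_def comp_def)
qed

text \<open>The counterpart of \<open>colim_group_shift\<close> for the classes in the colimit: it identifies the target of
  the boundary map of a strong triangle with the shift of the colimit of \<open>Y(a\<^sub>*)\<close>.\<close>

lemma colim_in_shift:
  "colim_in (\<lambda>n. md_shift S (M n)) (\<lambda>n. md_shift_map S (\<tau> n)) n x m = colim_in M \<tau> n (UnshO S x) m"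
proof -
  have "mtrans (\<lambda>n. md_shift_map S (\<tau> n)) x j k = mtrans \<tau> (UnshO S x) j k" for j k
    by (induction k) (auto simp: md_shift_map_def)
  then show ?thesis
    by (simp add: colim_in_def colim_rel_def md_shift_def)
qed

lemma (in triangulated_category) md_shift_map_mod_map:
  assumes "is_mod_map C L M \<eta>"
  shows "is_mod_map C (md_shift C L) (md_shift C M) (md_shift_map C \<eta>)"
  using assms UnshO_Obj UnshM_Hom by (auto simp: is_mod_map_def md_shift_def md_shift_map_def)

lemma (in triangulated_category) yon_bd_mod_map:
  assumes h: "h \<in> Hom C c (ShO C a)" and a: "a \<in> Obj C"
  shows "is_mod_map C (yon C c) (md_shift C (yon C a)) (yon_bd C h)"
  unfolding is_mod_map_def
proof (intro conjI ballI allI)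
  fix x assume x: "x \<in> Obj C"
  have U: "UnshM C (h \<cdot> g) \<in> Hom C (UnshO C x) a" if "g \<in> Hom C x c" for g
    using UnshM_Hom[OF Comp_Hom[OF that h]] UnshO_ShO[OF a] by simp
  show "yon_bd C h x \<in> hom (val (yon C c) x) (val (md_shift C (yon C a)) x)"
  proof (rule homI)
    fix g assume "g \<in> carrier (val (yon C c) x)"
    then have g: "g \<in> Hom C x c" by (simp add: yon_def)
    then show "yon_bd C h x g \<in> carrier (val (md_shift C (yon C a)) x)"
      using U by (simp add: yon_bd_def md_shift_def yon_def)
    fix k assume "k \<in> carrier (val (yon C c) x)"
    then have k: "k \<in> Hom C x c" by (simp add: yon_def)
    show "yon_bd C h x (g \<otimes>\<^bsub>val (yon C c) x\<^esub> k) =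
        yon_bd C h x g \<otimes>\<^bsub>val (md_shift C (yon C a)) x\<^esub> yon_bd C h x k"
      using Plus_Comp[OF g k h] UnshM_Plus[OF Comp_Hom[OF g h] Comp_Hom[OF k h]]
      by (simp add: yon_bd_def md_shift_def yon_def)
  qed
next
  fix x y f m assume f: "f \<in> Hom C x y" and "m \<in> carrier (val (yon C c) y)"
  then have m: "m \<in> Hom C y c" by (simp add: yon_def)
  show "yon_bd C h x (res (yon C c) f m) = res (md_shift C (yon C a)) f (yon_bd C h y m)"
    using Comp_assoc[OF f m h] UnshM_Comp[OF f Comp_Hom[OF m h]]
    by (simp add: yon_bd_def md_shift_def yon_def)
qed

context very_good_extension
begin

lemma ycls_in:
  assumes c: "is_sequence S c" and k: "k \<in> Hom S x (sob c n)"
  shows "ycls c n x k \<in> carrier (val (ycolim S c) x)"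
  using ycolim_carrier[OF c] k by blast

lemma ycls_smap:
  assumes c: "is_sequence S c" and k: "k \<in> Hom S x (sob c n)"
  shows "ycls c (Suc n) x (smap c n \<cdot>\<^bsub>S\<^esub> k) = ycls c n x k"
proof -
  have s: "smap c n \<in> Hom S (sob c n) (sob c (Suc n))" using c by (simp add: is_sequence_def)
  have x: "x \<in> Obj S" using S.Hom_objs[OF k] by simp
  have "ycls c (Suc n) x (mtrans (\<lambda>n. yon_map S (smap c n)) x n (Suc n) k) = ycls c n x k"
    by (rule colim_in_trans[OF S_additive S.yon_md_sequence[OF c] x]) (use k in simp_all)
  then show ?thesis
    using mtrans_yon[OF c k, of "Suc n"] S.strans_refl[of c n] S.Comp_Ident[OF s] by simp
qed

lemma ycls_map:
  assumes c: "is_sequence S c"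
  shows "is_mod_map S (yon S (sob c n)) (ycolim S c) (ycls c n)"
  unfolding ycolim_def by (rule colim_in_map[OF S_additive S.yon_md_sequence[OF c]])

lemma ycolim_map_ycls:
  assumes a: "is_sequence S a" and b: "is_sequence S b" and f: "seq_map S a b f"
    and k: "k \<in> Hom S x (sob a n)"
  shows "ycolim_map S b f x (ycls a n x k) = ycls b n x (f n \<cdot>\<^bsub>S\<^esub> k)"
proof -
  have fH: "\<And>n. f n \<in> Hom S (sob a n) (sob b n)"
    and fs: "\<And>n. f (Suc n) \<cdot>\<^bsub>S\<^esub> smap a n = smap b n \<cdot>\<^bsub>S\<^esub> f n"
    using f by (auto simp: seq_map_def)
  have x: "x \<in> Obj S" using S.Hom_objs[OF k] by simp
  have m: "is_mod_map S (yon S (sob a n)) (ycolim S b) (\<lambda>x m. ycls b n x (yon_map S (f n) x m))" for n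
    by (rule is_mod_map_comp[OF S.category_axioms S.yon_map_mod_map[OF fH] ycls_map[OF b]])
  have "ycls b (Suc n) x (yon_map S (f (Suc n)) x (yon_map S (smap a n) x m)) =
      ycls b n x (yon_map S (f n) x m)" if "m \<in> Hom S x (sob a n)" for n x m
  proof -
    have s: "smap a n \<in> Hom S (sob a n) (sob a (Suc n))" "smap b n \<in> Hom S (sob b n) (sob b (Suc n))"
      using a b by (auto simp: is_sequence_def)
    have "f (Suc n) \<cdot>\<^bsub>S\<^esub> (smap a n \<cdot>\<^bsub>S\<^esub> m) = smap b n \<cdot>\<^bsub>S\<^esub> (f n \<cdot>\<^bsub>S\<^esub> m)"
      using S.Comp_assoc[OF that s(1) fH] S.Comp_assoc[OF that fH s(2)] fs by simp
    then show ?thesis using ycls_smap[OF b S.Comp_Hom[OF that fH]] by (simp add: yon_map_def)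
  qed
  then have "ycolim_map S b f x (ycls a n x k) = ycls b n x (yon_map S (f n) x k)"
    unfolding ycolim_map_def colim_map_def
    by (intro colim_desc_in[OF S_additive S.yon_md_sequence[OF a] m]) (use x k in simp_all)
  then show ?thesis by (simp add: yon_map_def)
qed

lemma ycolim_bd_ycls:
  assumes c: "is_sequence S c" and a: "is_sequence S a" and h: "seq_map S c (shift_seq S a) h"
    and k: "k \<in> Hom S x (sob c n)"
  shows "ycolim_bd S a h x (ycls c n x k) = ycls a n (UnshO S x) (UnshM S (h n \<cdot>\<^bsub>S\<^esub> k))"
proof -
  have hH: "\<And>n. h n \<in> Hom S (sob c n) (ShO S (sob a n))"
    and hs: "\<And>n. h (Suc n) \<cdot>\<^bsub>S\<^esub> smap c n = ShM S (smap a n) \<cdot>\<^bsub>S\<^esub> h n"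
    using h by (auto simp: seq_map_def shift_seq_def)
  have aO: "sob a n \<in> Obj S" for n using a by (simp add: is_sequence_def)
  have x: "x \<in> Obj S" using S.Hom_objs[OF k] by simp
  have m: "is_mod_map S (yon S (sob c n)) (md_shift S (ycolim S a))
      (\<lambda>x m. md_shift_map S (ycls a n) x (yon_bd S (h n) x m))" for n
    by (rule is_mod_map_comp[OF S.category_axioms S.yon_bd_mod_map[OF hH aO]
        S.md_shift_map_mod_map[OF ycls_map[OF a]]])
  have e: "md_shift_map S (ycls a (Suc n)) x (yon_bd S (h (Suc n)) x (yon_map S (smap c n) x m)) =
      md_shift_map S (ycls a n) x (yon_bd S (h n) x m)" if "m \<in> Hom S x (sob c n)" for n x m
  proof -
    have s: "smap c n \<in> Hom S (sob c n) (sob c (Suc n))" "smap a n \<in> Hom S (sob a n) (sob a (Suc n))"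
      using a c by (auto simp: is_sequence_def)
    have U: "UnshM S (h n \<cdot>\<^bsub>S\<^esub> m) \<in> Hom S (UnshO S x) (sob a n)"
      using S.UnshM_Hom[OF S.Comp_Hom[OF that hH]] S.UnshO_ShO[OF aO] by simp
    have "h (Suc n) \<cdot>\<^bsub>S\<^esub> (smap c n \<cdot>\<^bsub>S\<^esub> m) = ShM S (smap a n) \<cdot>\<^bsub>S\<^esub> (h n \<cdot>\<^bsub>S\<^esub> m)"
      using S.Comp_assoc[OF that s(1) hH] S.Comp_assoc[OF that hH S.ShM_Hom[OF s(2)]] hs by simp
    then have "UnshM S (h (Suc n) \<cdot>\<^bsub>S\<^esub> (smap c n \<cdot>\<^bsub>S\<^esub> m)) = smap a n \<cdot>\<^bsub>S\<^esub> UnshM S (h n \<cdot>\<^bsub>S\<^esub> m)"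
      using S.UnshM_Comp[OF S.Comp_Hom[OF that hH] S.ShM_Hom[OF s(2)]] S.UnshM_ShM[OF s(2)] by simp
    then show ?thesis using ycls_smap[OF a U] by (simp add: yon_map_def yon_bd_def md_shift_map_def)
  qed
  have "ycolim_bd S a h = colim_desc (\<lambda>n x m. md_shift_map S (ycls a n) x (yon_bd S (h n) x m))"
    by (simp add: ycolim_bd_def colim_map_def colim_in_shift) (simp add: md_shift_map_def)
  moreover have "colim_desc (\<lambda>n x m. md_shift_map S (ycls a n) x (yon_bd S (h n) x m)) x (ycls c n x k) =
      md_shift_map S (ycls a n) x (yon_bd S (h n) x k)"
    by (intro colim_desc_in[OF S_additive S.yon_md_sequence[OF c] m]) (use e x k in simp_all)
  ultimately show ?thesis by (simp add: yon_bd_def md_shift_map_def)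
qed

text \<open>A natural transformation out of the colimit of \<open>Y(a\<^sub>*)\<close> is determined by its values on the
  classes of the identities of the \<open>a\<^sub>n\<close>.\<close>

lemma represents_iff:
  assumes \<alpha>: "approx a A \<alpha>" and \<beta>: "approx b B \<beta>" and f: "seq_map S a b f" and \<phi>: "\<phi> \<in> Hom T A B"
  shows "represents S T F a \<alpha> b \<beta> f \<phi> \<longleftrightarrow> (\<forall>n. \<phi> \<cdot>\<^bsub>T\<^esub> \<alpha> n = \<beta> n \<cdot>\<^bsub>T\<^esub> fmor F (f n))"
proof -
  note a = approxE(1,2)[OF \<alpha>] and b = approxE(1,2)[OF \<beta>]
  have fH: "\<And>n. f n \<in> Hom S (sob a n) (sob b n)" using f by (simp add: seq_map_def)
  have *: "nat_map T F \<beta> x (ycolim_map S b f x (ycls a n x k)) = (\<beta> n \<cdot>\<^bsub>T\<^esub> fmor F (f n)) \<cdot>\<^bsub>T\<^esub> fmor F k"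
    "ryon_map T \<phi> x (nat_map T F \<alpha> x (ycls a n x k)) = (\<phi> \<cdot>\<^bsub>T\<^esub> \<alpha> n) \<cdot>\<^bsub>T\<^esub> fmor F k"
    if k: "k \<in> Hom S x (sob a n)" for n x k
  proof -
    have x: "x \<in> Obj S" using S.Hom_objs[OF k] by simp
    show "nat_map T F \<beta> x (ycolim_map S b f x (ycls a n x k)) = (\<beta> n \<cdot>\<^bsub>T\<^esub> fmor F (f n)) \<cdot>\<^bsub>T\<^esub> fmor F k"
      using ycolim_map_ycls[OF a(1) b(1) f k] nat_map_ycls[OF b x S.Comp_Hom[OF k fH]]
        F_Comp[OF k fH] T.Comp_assoc[OF F_Hom[OF k] F_Hom[OF fH] approxE(3)[OF \<beta>]] by simp
    show "ryon_map T \<phi> x (nat_map T F \<alpha> x (ycls a n x k)) = (\<phi> \<cdot>\<^bsub>T\<^esub> \<alpha> n) \<cdot>\<^bsub>T\<^esub> fmor F k"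
      using nat_map_ycls[OF a x k] T.Comp_assoc[OF F_Hom[OF k] approxE(3)[OF \<alpha>] \<phi>]
      by (simp add: ryon_map_def)
  qed
  show ?thesis
  proof
    assume r: "represents S T F a \<alpha> b \<beta> f \<phi>"
    show "\<forall>n. \<phi> \<cdot>\<^bsub>T\<^esub> \<alpha> n = \<beta> n \<cdot>\<^bsub>T\<^esub> fmor F (f n)"
    proof
      fix n
      note o = approxE(4)[OF \<alpha>, of n]
      note i = S.Ident_Hom[OF o]
      have "(\<beta> n \<cdot>\<^bsub>T\<^esub> fmor F (f n)) \<cdot>\<^bsub>T\<^esub> fmor F (Ident S (sob a n)) =
          (\<phi> \<cdot>\<^bsub>T\<^esub> \<alpha> n) \<cdot>\<^bsub>T\<^esub> fmor F (Ident S (sob a n))"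
        using r *[OF i] ycls_in[OF a(1) i] o unfolding represents_def by simp
      then show "\<phi> \<cdot>\<^bsub>T\<^esub> \<alpha> n = \<beta> n \<cdot>\<^bsub>T\<^esub> fmor F (f n)"
        using F_Ident[OF o] T.Comp_Ident[OF T.Comp_Hom[OF F_Hom[OF fH] approxE(3)[OF \<beta>]]]
          T.Comp_Ident[OF T.Comp_Hom[OF approxE(3)[OF \<alpha>] \<phi>]] by simp
    qed
  next
    assume "\<forall>n. \<phi> \<cdot>\<^bsub>T\<^esub> \<alpha> n = \<beta> n \<cdot>\<^bsub>T\<^esub> fmor F (f n)"
    then show "represents S T F a \<alpha> b \<beta> f \<phi>"
      unfolding represents_def ycolim_carrier[OF a(1)] using * by auto
  qed
qed

lemma ryon_map_iso:
  assumes \<psi>: "is_iso_mor T \<psi> H X"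
  shows "is_mod_iso S (ryon T F H) (ryon T F X) (ryon_map T \<psi>)"
proof -
  have H: "\<psi> \<in> Hom T H X" using \<psi> by (simp add: is_iso_mor_def)
  have m: "is_mod_map S (ryon T F H) (ryon T F X) (ryon_map T \<psi>)"
    unfolding is_mod_map_def
  proof (intro conjI ballI allI)
    fix x assume "x \<in> Obj S"
    show "ryon_map T \<psi> x \<in> hom (val (ryon T F H) x) (val (ryon T F X) x)"
      by (rule homI) (auto simp: ryon_def ryon_map_def T.Comp_Hom[OF _ H] T.Plus_Comp[OF _ _ H])
  next
    fix x y f m assume "f \<in> Hom S x y" "m \<in> carrier (val (ryon T F H) y)"
    then show "ryon_map T \<psi> x (res (ryon T F H) f m) = res (ryon T F X) f (ryon_map T \<psi> y m)"
      by (simp add: ryon_def ryon_map_def T.Comp_assoc[OF F_Hom _ H])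
  qed
  then show ?thesis
    using T.iso_Comp_bij[OF \<psi>] by (simp add: is_mod_iso_def is_mod_map_def iso_def ryon_def ryon_map_def)
qed

text \<open>All three squares are checked on the class of a map \<open>k : x \<rightarrow> a\<^sub>n\<close> (or \<open>b\<^sub>n\<close>, \<open>c\<^sub>n\<close>), where they
  reduce to the commutative squares in \<open>T\<close> composed with \<open>F(k)\<close>. For the boundary map the value
  \<open>\<alpha>\<^sub>n \<cdot> F(\<Sigma>\<^sup>-\<^sup>1(h\<^sub>n \<cdot> k))\<close> is recognised by its shift.\<close>

lemma strong_triangle_iso:
  assumes \<alpha>: "approx a A \<alpha>" and \<beta>: "approx b B \<beta>" and \<gamma>: "approx c C \<gamma>"
    and f: "seq_map S a b f" and g: "seq_map S b c g" and h: "seq_map S c (shift_seq S a) h"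
    and \<phi>: "\<phi> \<in> Hom T A B" and v: "v \<in> Hom T B C" and w: "w \<in> Hom T C (ShO T A)"
    and sq: "\<And>n. \<phi> \<cdot>\<^bsub>T\<^esub> \<alpha> n = \<beta> n \<cdot>\<^bsub>T\<^esub> fmor F (f n)" "\<And>n. v \<cdot>\<^bsub>T\<^esub> \<beta> n = \<gamma> n \<cdot>\<^bsub>T\<^esub> fmor F (g n)"
      "\<And>n. w \<cdot>\<^bsub>T\<^esub> \<gamma> n = ShM T (\<alpha> n) \<cdot>\<^bsub>T\<^esub> (fsh F (sob a n) \<cdot>\<^bsub>T\<^esub> fmor F (h n))"
    and H: "is_hocolim T (image_seq F c) H \<kappa>" and \<psi>: "is_iso_mor T \<psi> H C" "\<And>n. \<psi> \<cdot>\<^bsub>T\<^esub> \<kappa> n = \<gamma> n"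
  shows "is_md_tri_iso S (ycolim_tri S a b c f g h) (ryon_tri S T F A B C \<phi> v w)
    (nat_map T F \<alpha>) (nat_map T F \<beta>) (\<lambda>x m. ryon_map T \<psi> x (nat_map T F \<kappa> x m))"
proof -
  note a = approxE(1,2)[OF \<alpha>] and b = approxE(1,2)[OF \<beta>] and c = approxE(1,2)[OF \<gamma>]
  note \<kappa> = hocolim_cocone[OF c(1) H]
  have gH: "\<And>n. g n \<in> Hom S (sob b n) (sob c n)" using g by (simp add: seq_map_def)
  have hH: "\<And>n. h n \<in> Hom S (sob c n) (ShO S (sob a n))" using h by (simp add: seq_map_def shift_seq_def)
  have \<psi>H: "\<psi> \<in> Hom T H C" using \<psi>(1) by (simp add: is_iso_mor_def)
  have "is_mod_iso S (ycolim S c) (ryon T F H) (nat_map T F \<kappa>)"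
    using ext approx_Cauchy[OF \<gamma>] H unfolding good_extension_def by blast
  then have iso: "is_mod_iso S (ycolim S c) (ryon T F C) (\<lambda>x m. ryon_map T \<psi> x (nat_map T F \<kappa> x m))"
    using is_mod_iso_comp[OF S.category_axioms _ ryon_map_iso[OF \<psi>(1)]] by blast
  have r: "ryon_map T \<psi> x (nat_map T F \<kappa> x (ycls c n x k)) = \<gamma> n \<cdot>\<^bsub>T\<^esub> fmor F k"
    if k: "k \<in> Hom S x (sob c n)" for n x k
    using nat_map_ycls[OF c(1) \<kappa> S.Hom_objs(1)[OF k] k]
      T.Comp_assoc[OF F_Hom[OF k] cocone_Hom[OF \<kappa>] \<psi>H] \<psi>(2) by (simp add: ryon_map_def)
  have 1: "nat_map T F \<beta> x (ycolim_map S b f x m) = ryon_map T \<phi> x (nat_map T F \<alpha> x m)"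
    if "x \<in> Obj S" "m \<in> carrier (val (ycolim S a) x)" for x m
    using represents_iff[OF \<alpha> \<beta> f \<phi>] sq(1) that unfolding represents_def by blast
  have 2: "ryon_map T \<psi> x (nat_map T F \<kappa> x (ycolim_map S c g x m)) = ryon_map T v x (nat_map T F \<beta> x m)"
    if x: "x \<in> Obj S" and "m \<in> carrier (val (ycolim S b) x)" for x m
  proof -
    obtain n k where k: "k \<in> Hom S x (sob b n)" "m = ycls b n x k"
      using \<open>m \<in> carrier (val (ycolim S b) x)\<close> unfolding ycolim_carrier[OF b(1)] by blast
    show ?thesis
      using r[OF S.Comp_Hom[OF k(1) gH]] ycolim_map_ycls[OF b(1) c(1) g k(1)] nat_map_ycls[OF b x k(1)]
        F_Comp[OF k(1) gH] T.Comp_assoc[OF F_Hom[OF k(1)] F_Hom[OF gH] approxE(3)[OF \<gamma>]] sq(2)[of n]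
        T.Comp_assoc[OF F_Hom[OF k(1)] approxE(3)[OF \<beta>] v] k(2) by (simp add: ryon_map_def)
  qed
  have 3: "md_shift_map S (nat_map T F \<alpha>) x (ycolim_bd S a h x m) =
      ryon_bd S T F A w x (ryon_map T \<psi> x (nat_map T F \<kappa> x m))"
    if x: "x \<in> Obj S" and "m \<in> carrier (val (ycolim S c) x)" for x m
  proof -
    obtain n k where k: "k \<in> Hom S x (sob c n)" "m = ycls c n x k"
      using \<open>m \<in> carrier (val (ycolim S c) x)\<close> unfolding ycolim_carrier[OF c(1)] by blast
    let ?y = "UnshO S x" and ?u = "UnshM S (h n \<cdot>\<^bsub>S\<^esub> k)"
    note y = S.UnshO_Obj[OF x] and yx = S.ShO_UnshO[OF x]
    note \<alpha>H = approxE(3)[OF \<alpha>, of n] and aO = approxE(4)[OF \<alpha>, of n]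
    have hk: "h n \<cdot>\<^bsub>S\<^esub> k \<in> Hom S x (ShO S (sob a n))" using S.Comp_Hom[OF k(1) hH] .
    have u: "?u \<in> Hom S ?y (sob a n)" using S.UnshM_Hom[OF hk] S.UnshO_ShO[OF aO] by simp
    let ?l = "\<alpha> n \<cdot>\<^bsub>T\<^esub> fmor F ?u"
    have l: "?l \<in> Hom T (fob F ?y) A" using T.Comp_Hom[OF F_Hom[OF u] \<alpha>H] .
    have "ShM T ?l \<cdot>\<^bsub>T\<^esub> fsh F ?y = ShM T (\<alpha> n) \<cdot>\<^bsub>T\<^esub> (ShM T (fmor F ?u) \<cdot>\<^bsub>T\<^esub> fsh F ?y)"
      using T.ShM_Comp[OF F_Hom[OF u] \<alpha>H]
        T.Comp_assoc[OF fsh_Hom[OF y] T.ShM_Hom[OF F_Hom[OF u]] T.ShM_Hom[OF \<alpha>H]] by simp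
    also have "ShM T (fmor F ?u) \<cdot>\<^bsub>T\<^esub> fsh F ?y = fsh F (sob a n) \<cdot>\<^bsub>T\<^esub> (fmor F (h n) \<cdot>\<^bsub>T\<^esub> fmor F k)"
      using fsh_nat[OF u] S.ShM_UnshM[OF hk] F_Comp[OF k(1) hH] by simp
    also have "ShM T (\<alpha> n) \<cdot>\<^bsub>T\<^esub> \<dots> = (w \<cdot>\<^bsub>T\<^esub> \<gamma> n) \<cdot>\<^bsub>T\<^esub> fmor F k"
      using sq(3)[of n] T.Comp_assoc[OF F_Hom[OF k(1)] F_Hom[OF hH] fsh_Hom[OF aO]]
        T.Comp_assoc[OF F_Hom[OF k(1)] T.Comp_Hom[OF F_Hom[OF hH] fsh_Hom[OF aO]] T.ShM_Hom[OF \<alpha>H]]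
      by simp
    also have "\<dots> = w \<cdot>\<^bsub>T\<^esub> (\<gamma> n \<cdot>\<^bsub>T\<^esub> fmor F k)"
      using T.Comp_assoc[OF F_Hom[OF k(1)] approxE(3)[OF \<gamma>] w] .
    finally have e: "ShM T ?l \<cdot>\<^bsub>T\<^esub> fsh F ?y = w \<cdot>\<^bsub>T\<^esub> (\<gamma> n \<cdot>\<^bsub>T\<^esub> fmor F k)" .
    have "ryon_bd S T F A w x (\<gamma> n \<cdot>\<^bsub>T\<^esub> fmor F k) = ?l"
      unfolding ryon_bd_def
    proof (rule the_equality)
      show "?l \<in> Hom T (fob F ?y) A \<and> ShM T ?l \<cdot>\<^bsub>T\<^esub> fsh F ?y = w \<cdot>\<^bsub>T\<^esub> (\<gamma> n \<cdot>\<^bsub>T\<^esub> fmor F k)"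
        using l e by blast
      fix l' assume "l' \<in> Hom T (fob F ?y) A \<and> ShM T l' \<cdot>\<^bsub>T\<^esub> fsh F ?y = w \<cdot>\<^bsub>T\<^esub> (\<gamma> n \<cdot>\<^bsub>T\<^esub> fmor F k)"
      then show "l' = ?l"
        using inj_onD[OF bij_betw_imp_inj_on[OF shift_transport[OF y approxE(5)[OF \<alpha>]]] _ _ l] e by simp
    qed
    moreover have "md_shift_map S (nat_map T F \<alpha>) x (ycolim_bd S a h x m) = ?l"
      using ycolim_bd_ycls[OF c(1) a(1) h k(1)] nat_map_ycls[OF a y u] k(2) by (simp add: md_shift_map_def)
    ultimately show ?thesis using r[OF k(1)] k(2) by simp
  qed
  show ?thesis
    unfolding ycolim_tri_def ryon_tri_def is_md_tri_iso.simps
    using approx_nat_map_iso[OF \<alpha>] approx_nat_map_iso[OF \<beta>] iso 1 2 3 by blast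
qed

section \<open>Closure properties of the homotopy colimits\<close>

lemma subsequence_id:
  assumes "is_sequence S c"
  shows "subsequence S id c = c"
proof -
  have "smap c n \<cdot>\<^bsub>S\<^esub> Ident S (sob c n) = smap c n" for n
    using assms S.Comp_Ident by (auto simp: is_sequence_def)
  then have "(\<lambda>n. strans S c n (Suc n)) = smap c" using S.strans_refl[of c] by auto
  then show ?thesis by (simp add: subsequence_def)
qed

text \<open>The composite \<open>\<phi> \<cdot> \<alpha>\<^sub>n\<close> factors uniquely through \<open>F(b\<^sub>m)\<close> for large \<open>m\<close>, and uniqueness makes the
  factorizations compatible. Only \<open>b\<^sub>*\<close> has to be thinned out for this.\<close>

lemma map_lifts_to_sequences:
  assumes \<alpha>: "approx a A \<alpha>" and \<beta>: "approx b B \<beta>" and \<phi>: "\<phi> \<in> Hom T A B"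
  shows "\<exists>s f. strict_mono s \<and> seq_map S a (subsequence S s b) f \<and>
    (\<forall>n. \<phi> \<cdot>\<^bsub>T\<^esub> \<alpha> n = \<beta> (s n) \<cdot>\<^bsub>T\<^esub> fmor F (f n))"
proof -
  note a = approxE(1,2)[OF \<alpha>] and \<alpha>H = approxE(3)[OF \<alpha>] and aO = approxE(4)[OF \<alpha>]
  note b = approxE(1,2)[OF \<beta>] and \<beta>H = approxE(3)[OF \<beta>]
  have "\<exists>K. \<forall>m\<ge>K. bij_betw (\<lambda>g. \<beta> m \<cdot>\<^bsub>T\<^esub> fmor F g) (Hom S (sob a n) (sob b m)) (Hom T (fob F (sob a n)) B)" for n
  proof -
    obtain i where i: "sob a n \<in> test i" using ex_test[OF aO] by blast
    then show ?thesis using approx_bij[OF \<beta>, of i] by blast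
  qed
  then obtain K where K: "\<And>n m. K n \<le> m \<Longrightarrow>
      bij_betw (\<lambda>g. \<beta> m \<cdot>\<^bsub>T\<^esub> fmor F g) (Hom S (sob a n) (sob b m)) (Hom T (fob F (sob a n)) B)"
    by metis
  \<comment> \<open>strictly increasing with \<open>s n \<ge> K n\<close>\<close>
  define s where "s = rec_nat (K 0) (\<lambda>n m. max (Suc m) (K (Suc n)))"
  have s: "strict_mono s" by (simp add: strict_mono_Suc_iff s_def less_max_iff_disj)
  have sK: "K n \<le> s n" for n by (cases n) (simp_all add: s_def)
  have ss: "s n \<le> s (Suc n)" for n using s by (simp add: strict_mono_less_eq)
  have "\<exists>f \<in> Hom S (sob a n) (sob b (s n)). \<beta> (s n) \<cdot>\<^bsub>T\<^esub> fmor F f = \<phi> \<cdot>\<^bsub>T\<^esub> \<alpha> n" for n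
    using K[OF sK] T.Comp_Hom[OF \<alpha>H \<phi>] by (metis (no_types, lifting) bij_betw_imp_surj_on imageE)
  then obtain f where f: "\<And>n. f n \<in> Hom S (sob a n) (sob b (s n))"
    "\<And>n. \<beta> (s n) \<cdot>\<^bsub>T\<^esub> fmor F (f n) = \<phi> \<cdot>\<^bsub>T\<^esub> \<alpha> n" by metis
  have "f (Suc n) \<cdot>\<^bsub>S\<^esub> smap a n = strans S b (s n) (s (Suc n)) \<cdot>\<^bsub>S\<^esub> f n" for n
  proof -
    have sm: "smap a n \<in> Hom S (sob a n) (sob a (Suc n))" using a(1) by (simp add: is_sequence_def)
    note t = S.strans_Hom[OF b(1) ss[of n]]
    have "\<beta> (s (Suc n)) \<cdot>\<^bsub>T\<^esub> fmor F (f (Suc n) \<cdot>\<^bsub>S\<^esub> smap a n) = \<phi> \<cdot>\<^bsub>T\<^esub> (\<alpha> (Suc n) \<cdot>\<^bsub>T\<^esub> fmor F (smap a n))"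
      using F_Comp[OF sm f(1)] T.Comp_assoc[OF F_Hom[OF sm] F_Hom[OF f(1)] \<beta>H] f(2)[of "Suc n"]
        T.Comp_assoc[OF F_Hom[OF sm] \<alpha>H \<phi>] by simp
    also have "\<dots> = \<beta> (s n) \<cdot>\<^bsub>T\<^esub> fmor F (f n)"
      using a(2) f(2)[of n] by (simp add: seq_cocone_def image_seq_def)
    also have "\<dots> = \<beta> (s (Suc n)) \<cdot>\<^bsub>T\<^esub> fmor F (strans S b (s n) (s (Suc n)) \<cdot>\<^bsub>S\<^esub> f n)"
      using cocone_strans_Comp[OF b ss f(1)] by simp
    finally show ?thesis
      using inj_onD[OF bij_betw_imp_inj_on[OF K[OF order_trans[OF sK ss]]]]
        S.Comp_Hom[OF sm f(1)] S.Comp_Hom[OF f(1) t] by blast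
  qed
  then have "seq_map S a (subsequence S s b) f"
    using f(1) by (simp add: seq_map_def subsequence_def)
  then show ?thesis using s f(2) by metis
qed

lemma Lprime_cone:
  assumes A: "A \<in> Lprime S T M F" and B: "B \<in> Lprime S T M F" and d: "Dist T \<phi> v w"
    and \<phi>: "\<phi> \<in> Hom T A B" and v: "v \<in> Hom T B C" and w: "w \<in> Hom T C (ShO T A)"
  shows "C \<in> Lprime S T M F"
proof -
  obtain a \<alpha> b \<beta> where \<alpha>: "approx a A \<alpha>" and \<beta>: "approx b B \<beta>" using A B Lprime_iff by metis
  obtain s f where s: "strict_mono s" "seq_map S a (subsequence S s b) f"
    "\<forall>n. \<phi> \<cdot>\<^bsub>T\<^esub> \<alpha> n = \<beta> (s n) \<cdot>\<^bsub>T\<^esub> fmor F (f n)"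
    using map_lifts_to_sequences[OF \<alpha> \<beta> \<phi>] by blast
  obtain c \<gamma> where "approx c C \<gamma>"
    using triangle_completion[OF \<alpha> approx_subsequence[OF \<beta> s(1)] s(2) \<phi> v w d] s(3) by (metis comp_apply)
  then show ?thesis using Lprime_iff visible_cone[OF d \<phi> v w] A B by blast
qed

lemma Lprime_iso:
  assumes "X \<in> Lprime S T M F" "is_iso_mor T u X Y"
  shows "Y \<in> Lprime S T M F"
  using assms Lprime_iff visible_iso approx_iso by meson

lemma F_Lprime:
  assumes s: "s \<in> Obj S"
  shows "fob F s \<in> Lprime S T M F"
proof -
  have "approx \<lparr>sob = (\<lambda>_. s), smap = (\<lambda>_. Ident S s)\<rparr> (fob F s) (\<lambda>_. Ident T (fob F s))"
    unfolding approx_def is_sequence_def seq_cocone_def image_seq_def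
    using s S.Ident_Hom[OF s] F_Ident[OF s] T.Ident_Hom[OF F_Obj[OF s]]
      T.Comp_Ident[OF T.Ident_Hom[OF F_Obj[OF s]]]
      T.iso_Comp_bij[OF T.is_iso_mor_Ident[OF F_Obj[OF s]]] by simp
  then show ?thesis using Lprime_iff F_visible[OF s] by blast
qed

lemma F_zero_object:
  assumes z: "is_zero_object S z"
  shows "is_zero_object T (fob F z)"
proof (rule T.zero_objectI)
  note o = S.zero_object_Obj[OF z]
  show "fob F z \<in> Obj T" using F_Obj[OF o] .
  show "Ident T (fob F z) = Zero T (fob F z) (fob F z)"
    using F_Ident[OF o] S.zero_object_Hom_from[OF z S.Ident_Hom[OF o]] F_Zero[OF o o] by simp
qed

lemma Lprime_Obj: "X \<in> Lprime S T M F \<Longrightarrow> X \<in> Obj T"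
  by (simp add: Lprime_def)

text \<open>\<open>\<Sigma>X\<close> is the cone of \<open>X \<rightarrow> 0\<close>.\<close>

lemma Lprime_ShO:
  assumes X: "X \<in> Lprime S T M F"
  shows "ShO T X \<in> Lprime S T M F"
proof -
  obtain z where z: "is_zero_object S z" using S.ex_zero_object by blast
  let ?z = "fob F z"
  note Fz = F_zero_object[OF z] and zL = F_Lprime[OF S.zero_object_Obj[OF z]]
  note o = Lprime_Obj[OF X] T.zero_object_Obj[OF Fz] T.ShO_Obj[OF Lprime_Obj[OF X]]
  note t = T.TR1_Ident[OF o(1) Fz]
  note h = T.Ident_Hom[OF o(1)] T.Zero_Hom[OF o(1,2)] T.Zero_Hom[OF o(2,3)]
  show ?thesis
    using Lprime_cone[OF X zL T.Dist_rotate(1)[OF h t] h(2,3) T.Dist_rotate(2)[OF h t]] .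
qed

lemma invisible_ShO:
  assumes K: "invisible K"
  shows "invisible (ShO T K)"
  unfolding invisible_def
proof (intro conjI ballI)
  have KO: "K \<in> Obj T" using K by (simp add: invisible_def)
  show "ShO T K \<in> Obj T" using T.ShO_Obj[OF KO] .
  fix s g assume s: "s \<in> Obj S" and g: "g \<in> Hom T (fob F s) (ShO T K)"
  let ?y = "UnshO S s"
  note y = S.UnshO_Obj[OF s] and ys = S.ShO_UnshO[OF s]
  obtain k where k: "k \<in> Hom T (fob F ?y) K" "g = ShM T k \<cdot>\<^bsub>T\<^esub> fsh F ?y"
    using bij_betw_imp_surj_on[OF shift_transport[OF y KO]] g ys by (metis (no_types, lifting) imageE)
  have "k = Zero T (fob F ?y) K" using K y k(1) by (simp add: invisible_def)
  then show "g = Zero T (fob F s) (ShO T K)"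
    using k(2) T.ShM_Zero[OF F_Obj[OF y] KO] T.Zero_Comp[OF fsh_Hom[OF y] T.ShO_Obj[OF KO]] ys by simp
qed

lemma visible_UnshO:
  assumes X: "X \<in> visible"
  shows "UnshO T X \<in> visible"
  unfolding visible_def
proof (intro CollectI conjI allI impI ballI)
  note o = visible_Obj[OF X]
  show U: "UnshO T X \<in> Obj T" using T.UnshO_Obj[OF o] .
  fix K g assume K: "invisible K" and g: "g \<in> Hom T (UnshO T X) K"
  have "ShM T g \<in> Hom T X (ShO T K)" using T.ShM_Hom[OF g] T.ShO_UnshO[OF o] by simp
  then have "ShM T g = Zero T X (ShO T K)" using visibleD[OF X invisible_ShO[OF K]] by blast
  then show "g = Zero T (UnshO T X) K" using T.ShM_eq_Zero[OF g] T.ShO_UnshO[OF o] by simp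
qed

text \<open>The desuspension of an approximating sequence approximates the desuspension. The maps
  \<open>F(\<Sigma>\<^sup>-\<^sup>1c\<^sub>n) \<rightarrow> \<Sigma>\<^sup>-\<^sup>1X\<close> correspond to the \<open>\<gamma>\<^sub>n\<close> under \<open>shift_transport\<close>, and that bijection
  turns test objects \<open>x\<close> for \<open>\<Sigma>\<^sup>-\<^sup>1X\<close> into test objects \<open>\<Sigma>x\<close> for \<open>X\<close>.\<close>

lemma approx_UnshO:
  assumes \<gamma>: "approx c X \<gamma>"
  shows "\<exists>c' \<gamma>'. approx c' (UnshO T X) \<gamma>'"
proof -
  note c = approxE(1,2)[OF \<gamma>] and \<gamma>H = approxE(3)[OF \<gamma>] and cO = approxE(4)[OF \<gamma>] and XO = approxE(5)[OF \<gamma>]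
  let ?d = "\<lambda>n. UnshO S (sob c n)" and ?Y = "UnshO T X"
  note dO = S.UnshO_Obj[OF cO] and dc = S.ShO_UnshO[OF cO] and YO = T.UnshO_Obj[OF XO] and YX = T.ShO_UnshO[OF XO]
  let ?\<theta> = "\<lambda>y k. ShM T k \<cdot>\<^bsub>T\<^esub> fsh F y"
  have \<theta>: "bij_betw (?\<theta> y) (Hom T (fob F y) ?Y) (Hom T (fob F (ShO S y)) X)" if "y \<in> Obj S" for y
    using shift_transport[OF that YO] YX by simp
  have "\<exists>k \<in> Hom T (fob F (?d n)) ?Y. ?\<theta> (?d n) k = \<gamma> n" for n
    using bij_betw_imp_surj_on[OF \<theta>[OF dO]] \<gamma>H[of n] dc by (metis (no_types, lifting) imageE)
  then obtain \<delta> where \<delta>: "\<And>n. \<delta> n \<in> Hom T (fob F (?d n)) ?Y" "\<And>n. ?\<theta> (?d n) (\<delta> n) = \<gamma> n" by metis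
  have \<theta>\<delta>: "?\<theta> x (\<delta> n \<cdot>\<^bsub>T\<^esub> fmor F u) = \<gamma> n \<cdot>\<^bsub>T\<^esub> fmor F (ShM S u)" if u: "u \<in> Hom S x (?d n)" for x n u
  proof -
    have x: "x \<in> Obj S" using S.Hom_objs[OF u] by simp
    note Fu = F_Hom[OF u]
    have "?\<theta> x (\<delta> n \<cdot>\<^bsub>T\<^esub> fmor F u) = ShM T (\<delta> n) \<cdot>\<^bsub>T\<^esub> (ShM T (fmor F u) \<cdot>\<^bsub>T\<^esub> fsh F x)"
      using T.ShM_Comp[OF Fu \<delta>(1)] T.Comp_assoc[OF fsh_Hom[OF x] T.ShM_Hom[OF Fu] T.ShM_Hom[OF \<delta>(1)]] by simp
    also have "\<dots> = ?\<theta> (?d n) (\<delta> n) \<cdot>\<^bsub>T\<^esub> fmor F (ShM S u)"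
      using fsh_nat[OF u] T.Comp_assoc[OF F_Hom[OF S.ShM_Hom[OF u]] fsh_Hom[OF dO] T.ShM_Hom[OF \<delta>(1)]] by simp
    finally show ?thesis using \<delta>(2) by simp
  qed
  define c' where "c' = \<lparr>sob = ?d, smap = (\<lambda>n. UnshM S (smap c n))\<rparr>"
  have s: "smap c n \<in> Hom S (sob c n) (sob c (Suc n))" for n using c(1) by (simp add: is_sequence_def)
  note s' = S.UnshM_Hom[OF s]
  have "approx c' ?Y \<delta>"
    unfolding approx_def
  proof (intro conjI allI)
    show "is_sequence S c'" using dO s' by (simp add: is_sequence_def c'_def)
    have "\<delta> (Suc n) \<cdot>\<^bsub>T\<^esub> fmor F (UnshM S (smap c n)) = \<delta> n" for n
    proof -
      have "?\<theta> (?d n) (\<delta> (Suc n) \<cdot>\<^bsub>T\<^esub> fmor F (UnshM S (smap c n))) = ?\<theta> (?d n) (\<delta> n)"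
        using \<theta>\<delta>[OF s'] S.ShM_UnshM[OF s] \<delta>(2)[of n] c(2) by (simp add: seq_cocone_def image_seq_def)
      then show ?thesis
        using inj_onD[OF bij_betw_imp_inj_on[OF \<theta>[OF dO]]] T.Comp_Hom[OF F_Hom[OF s'] \<delta>(1)] \<delta>(1) by blast
    qed
    then show "seq_cocone T (image_seq F c') ?Y \<delta>"
      using \<delta>(1) by (simp add: seq_cocone_def image_seq_def c'_def)
    fix i
    obtain N where N: "\<forall>n\<ge>N. \<forall>x \<in> test (Suc i).
        bij_betw (\<lambda>g. \<gamma> n \<cdot>\<^bsub>T\<^esub> fmor F g) (Hom S x (sob c n)) (Hom T (fob F x) X)"
      using approx_bij[OF \<gamma>] by blast
    have "bij_betw (\<lambda>g. \<delta> n \<cdot>\<^bsub>T\<^esub> g) (Hom T (fob F x) (fob F (?d n))) (Hom T (fob F x) ?Y)"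
      if n: "N \<le> n" and x: "x \<in> test i" for n x
    proof -
      note xO = test_Obj[OF x]
      have "bij_betw (\<lambda>g. \<gamma> n \<cdot>\<^bsub>T\<^esub> fmor F g) (Hom S (ShO S x) (sob c n)) (Hom T (fob F (ShO S x)) X)"
        using N n test_ShO[OF x] by blast
      from bij_betw_trans[OF S.ShM_Hom_bij[OF xO dO[of n], unfolded dc] this]
      have "bij_betw (?\<theta> x \<circ> (\<lambda>u. \<delta> n \<cdot>\<^bsub>T\<^esub> fmor F u)) (Hom S x (?d n)) (Hom T (fob F (ShO S x)) X)"
        by (rule iffD1[OF bij_betw_cong, rotated]) (simp add: \<theta>\<delta>)
      moreover have "(\<lambda>u. \<delta> n \<cdot>\<^bsub>T\<^esub> fmor F u) ` Hom S x (?d n) \<subseteq> Hom T (fob F x) ?Y"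
        using T.Comp_Hom[OF F_Hom \<delta>(1)] by blast
      ultimately have "bij_betw (\<lambda>u. \<delta> n \<cdot>\<^bsub>T\<^esub> fmor F u) (Hom S x (?d n)) (Hom T (fob F x) ?Y)"
        using bij_betw_comp_iff2[OF \<theta>[OF xO]] by blast
      then show ?thesis using full_bij_iff[OF \<delta>(1) xO dO] by blast
    qed
    then show "\<exists>N. \<forall>n\<ge>N. \<forall>x \<in> test i.
        bij_betw (\<lambda>g. \<delta> n \<cdot>\<^bsub>T\<^esub> g) (Hom T (fob F x) (fob F (sob c' n))) (Hom T (fob F x) ?Y)"
      by (auto simp: c'_def)
  qed
  then show ?thesis by blast
qed

lemma Lprime_UnshO:
  assumes "X \<in> Lprime S T M F"
  shows "UnshO T X \<in> Lprime S T M F"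
  using assms Lprime_iff visible_UnshO approx_UnshO by metis

text \<open>The biproduct of \<open>A\<close> and \<open>B\<close> is a cone of the zero map \<open>\<Sigma>\<^sup>-\<^sup>1A \<rightarrow> B\<close>.\<close>

lemma Lprime_biproduct:
  assumes A: "A \<in> Lprime S T M F" and B: "B \<in> Lprime S T M F" and s: "is_biproduct T s A B"
  shows "s \<in> Lprime S T M F"
proof -
  note AU = Lprime_UnshO[OF A]
  note o = Lprime_Obj[OF A] Lprime_Obj[OF B] Lprime_Obj[OF AU]
  note z = T.Zero_Hom[OF o(3,2)]
  obtain c g h where c: "Dist T (Zero T (UnshO T A) B) g h" "g \<in> Hom T B c" "h \<in> Hom T c A"
    using T.cone_exists[OF z] T.ShO_UnshO[OF o(1)] by metis
  have hs: "h \<in> Hom T c (ShO T (UnshO T A))" using c(3) T.ShO_UnshO[OF o(1)] by simp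
  obtain p j where p: "p \<in> Hom T c B" "j \<in> Hom T A c" "p \<cdot>\<^bsub>T\<^esub> g = Ident T B"
    "h \<cdot>\<^bsub>T\<^esub> j = Ident T A" "h \<cdot>\<^bsub>T\<^esub> g = Zero T B A" "p \<cdot>\<^bsub>T\<^esub> j = Zero T A B"
    "Plus T (g \<cdot>\<^bsub>T\<^esub> p) (j \<cdot>\<^bsub>T\<^esub> h) = Ident T c"
    using T.cone_of_zero_biproduct[OF o(3,2) c(2) hs c(1)] unfolding T.ShO_UnshO[OF o(1)] by metis
  have e: "Plus T (j \<cdot>\<^bsub>T\<^esub> h) (g \<cdot>\<^bsub>T\<^esub> p) = Ident T c"
    using T.Plus_commute[OF T.Comp_Hom[OF p(1) c(2)] T.Comp_Hom[OF c(3) p(2)]] p(7) by simp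
  obtain i' j' p' q' where s': "i' \<in> Hom T A s" "j' \<in> Hom T B s" "p' \<in> Hom T s A" "q' \<in> Hom T s B"
    "p' \<cdot>\<^bsub>T\<^esub> i' = Ident T A" "q' \<cdot>\<^bsub>T\<^esub> j' = Ident T B" "p' \<cdot>\<^bsub>T\<^esub> j' = Zero T B A"
    "q' \<cdot>\<^bsub>T\<^esub> i' = Zero T A B" "Plus T (i' \<cdot>\<^bsub>T\<^esub> p') (j' \<cdot>\<^bsub>T\<^esub> q') = Ident T s"
    using s unfolding is_biproduct_def by blast
  have "c \<in> Lprime S T M F" using Lprime_cone[OF AU B c(1) z c(2) hs] .
  then show ?thesis
    using Lprime_iso T.biproduct_unique[OF p(2) c(2,3) p(1,4,3,5,6) e s'] by blast
qed

lemma Lprime_triangulated: "triangulated_subcategory T (Lprime S T M F)"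
  unfolding triangulated_subcategory_def
proof (intro conjI)
  let ?L = "Lprime S T M F"
  show "?L \<subseteq> Obj T" using Lprime_Obj by blast
  show "\<exists>z \<in> ?L. is_zero_object T z"
    using S.ex_zero_object F_zero_object F_Lprime S.zero_object_Obj by blast
  show "\<forall>a \<in> ?L. \<forall>b \<in> ?L. \<forall>s. is_biproduct T s a b \<longrightarrow> s \<in> ?L" using Lprime_biproduct by blast
  show "\<forall>a \<in> ?L. \<forall>b f. is_iso_mor T f a b \<longrightarrow> b \<in> ?L" using Lprime_iso by blast
  show "ShO T ` ?L = ?L"
  proof
    show "ShO T ` ?L \<subseteq> ?L" using Lprime_ShO by blast
    show "?L \<subseteq> ShO T ` ?L"
      using Lprime_UnshO T.ShO_UnshO[OF Lprime_Obj] by (metis image_eqI subsetI)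
  qed
  show "\<forall>f g h. Dist T f g h \<and> Dom T f \<in> ?L \<and> Cod T f \<in> ?L \<longrightarrow> Cod T g \<in> ?L"
    using Lprime_cone T.Dist_types by metis
qed

end

theorem proposition5p12:
  fixes S :: "('o, 'm) tri_cat"
    and T :: "('p, 'n) tri_cat"
    and M :: "nat \<Rightarrow> 'o set"
    and F :: "('o, 'm, 'p, 'n) tri_fun"
  assumes S: "triangulated_category S"
    and T: "triangulated_category T"
    and M: "very_good_metric S M"
    and M_summands: "\<forall>i. closed_under_summands S (M i)"
    and F: "good_extension S T M F"
  shows "triangulated_subcategory T (Lprime S T M F) \<and>
    (\<forall>A B \<phi> a b \<alpha> \<beta>.
       A \<in> Lprime S T M F \<and> B \<in> Lprime S T M F \<and> \<phi> \<in> Hom T A B \<and>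
       is_Cauchy S M a \<and> hocolim_presentation T (image_seq F a) A \<alpha> \<and>
       is_Cauchy S M b \<and> hocolim_presentation T (image_seq F b) B \<beta> \<longrightarrow>
       (\<exists>r s f. strict_mono r \<and> strict_mono s \<and>
          seq_map S (subsequence S r a) (subsequence S s b) f \<and>
          represents S T F (subsequence S r a) (\<alpha> \<circ> r) (subsequence S s b) (\<beta> \<circ> s) f \<phi>) \<and>
       (\<forall>r s f C v w. strict_mono r \<and> strict_mono s \<and>
          seq_map S (subsequence S r a) (subsequence S s b) f \<and>
          represents S T F (subsequence S r a) (\<alpha> \<circ> r) (subsequence S s b) (\<beta> \<circ> s) f \<phi> \<and>
          v \<in> Hom T B C \<and> w \<in> Hom T C (ShO T A) \<and> Dist T \<phi> v w \<longrightarrow>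
          (\<exists>t c g h \<gamma>. strict_mono t \<and>
             (let a' = subsequence S t (subsequence S r a);
                  b' = subsequence S t (subsequence S s b);
                  f' = f \<circ> t; \<alpha>' = \<alpha> \<circ> r \<circ> t; \<beta>' = \<beta> \<circ> s \<circ> t
              in is_Cauchy_triangles S M a' b' c f' g h \<and>
                 seq_cocone T (image_seq F c) C \<gamma> \<and>
                 (\<forall>n. \<phi> \<cdot>\<^bsub>T\<^esub> \<alpha>' n = \<beta>' n \<cdot>\<^bsub>T\<^esub> fmor F (f' n) \<and>
                      v \<cdot>\<^bsub>T\<^esub> \<beta>' n = \<gamma> n \<cdot>\<^bsub>T\<^esub> fmor F (g n) \<and>
                      w \<cdot>\<^bsub>T\<^esub> \<gamma> n =
                        ShM T (\<alpha>' n) \<cdot>\<^bsub>T\<^esub> (fsh F (sob a' n) \<cdot>\<^bsub>T\<^esub> fmor F (h n))) \<and>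
                 (\<exists>H \<kappa>. is_hocolim T (image_seq F c) H \<kappa>) \<and>
                 (\<forall>H \<kappa>. is_hocolim T (image_seq F c) H \<kappa> \<longrightarrow>
                    (\<exists>\<psi>. is_iso_mor T \<psi> H C \<and> (\<forall>n. \<psi> \<cdot>\<^bsub>T\<^esub> \<kappa> n = \<gamma> n) \<and>
                       is_md_tri_iso S (ycolim_tri S a' b' c f' g h)
                         (ryon_tri S T F A B C \<phi> v w)
                         (nat_map T F \<alpha>') (nat_map T F \<beta>')
                         (\<lambda>x m. ryon_map T \<psi> x (nat_map T F \<kappa> x m))))))))"
proof -
  interpret very_good_extension S T M F
    using S T M M_summands F by (intro very_good_extension.intro very_good_extension_axioms.intro)
  show ?thesis
  proof (intro conjI allI impI)
    show "triangulated_subcategory T (Lprime S T M F)" using Lprime_triangulated .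
  next
    fix A B \<phi> a b \<alpha> \<beta>
    assume "A \<in> Lprime S T M F \<and> B \<in> Lprime S T M F \<and> \<phi> \<in> Hom T A B \<and>
      is_Cauchy S M a \<and> hocolim_presentation T (image_seq F a) A \<alpha> \<and>
      is_Cauchy S M b \<and> hocolim_presentation T (image_seq F b) B \<beta>"
    then have \<phi>: "\<phi> \<in> Hom T A B" and \<alpha>: "approx a A \<alpha>" and \<beta>: "approx b B \<beta>"
      using presentation_approx by blast+
    obtain s f where s: "strict_mono s" "seq_map S a (subsequence S s b) f"
      "\<forall>n. \<phi> \<cdot>\<^bsub>T\<^esub> \<alpha> n = (\<beta> \<circ> s) n \<cdot>\<^bsub>T\<^esub> fmor F (f n)"
      using map_lifts_to_sequences[OF \<alpha> \<beta> \<phi>] by auto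
    have "represents S T F a \<alpha> (subsequence S s b) (\<beta> \<circ> s) f \<phi>"
      using represents_iff[OF \<alpha> approx_subsequence[OF \<beta> s(1)] s(2) \<phi>] s(3) by blast
    then have "strict_mono (id :: nat \<Rightarrow> nat) \<and> strict_mono s \<and>
        seq_map S (subsequence S id a) (subsequence S s b) f \<and>
        represents S T F (subsequence S id a) (\<alpha> \<circ> id) (subsequence S s b) (\<beta> \<circ> s) f \<phi>"
      using s subsequence_id[OF approxE(1)[OF \<alpha>]] by (simp add: strict_mono_def)
    then show "\<exists>r s f. strict_mono r \<and> strict_mono s \<and>
        seq_map S (subsequence S r a) (subsequence S s b) f \<and>
        represents S T F (subsequence S r a) (\<alpha> \<circ> r) (subsequence S s b) (\<beta> \<circ> s) f \<phi>" by blast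
  next
    fix A B \<phi> a b \<alpha> \<beta> r s f C v w
    assume "A \<in> Lprime S T M F \<and> B \<in> Lprime S T M F \<and> \<phi> \<in> Hom T A B \<and>
      is_Cauchy S M a \<and> hocolim_presentation T (image_seq F a) A \<alpha> \<and>
      is_Cauchy S M b \<and> hocolim_presentation T (image_seq F b) B \<beta>"
    then have A: "A \<in> Lprime S T M F" and B: "B \<in> Lprime S T M F" and \<phi>: "\<phi> \<in> Hom T A B"
      and a: "approx a A \<alpha>" and b: "approx b B \<beta>"
      using presentation_approx by blast+
    assume "strict_mono r \<and> strict_mono s \<and> seq_map S (subsequence S r a) (subsequence S s b) f \<and>
      represents S T F (subsequence S r a) (\<alpha> \<circ> r) (subsequence S s b) (\<beta> \<circ> s) f \<phi> \<and>
      v \<in> Hom T B C \<and> w \<in> Hom T C (ShO T A) \<and> Dist T \<phi> v w"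
    then have r: "strict_mono r" and s: "strict_mono s"
      and f: "seq_map S (subsequence S r a) (subsequence S s b) f"
      and rep: "represents S T F (subsequence S r a) (\<alpha> \<circ> r) (subsequence S s b) (\<beta> \<circ> s) f \<phi>"
      and v: "v \<in> Hom T B C" and w: "w \<in> Hom T C (ShO T A)" and d: "Dist T \<phi> v w" by blast+
    note \<alpha> = approx_subsequence[OF a r] and \<beta> = approx_subsequence[OF b s]
    have sq: "\<phi> \<cdot>\<^bsub>T\<^esub> (\<alpha> \<circ> r) n = (\<beta> \<circ> s) n \<cdot>\<^bsub>T\<^esub> fmor F (f n)" for n
      using represents_iff[OF \<alpha> \<beta> f \<phi>] rep by blast
    obtain t c g h \<gamma> where t: "strict_mono t" and \<gamma>: "approx c C \<gamma>"
      and g: "seq_map S (subsequence S t (subsequence S s b)) c g"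
      and h: "seq_map S c (shift_seq S (subsequence S t (subsequence S r a))) h"
      and dist: "\<And>n. Dist S (f (t n)) (g n) (h n)"
      and sg: "\<And>n. v \<cdot>\<^bsub>T\<^esub> (\<beta> \<circ> s) (t n) = \<gamma> n \<cdot>\<^bsub>T\<^esub> fmor F (g n)"
      and sh: "\<And>n. w \<cdot>\<^bsub>T\<^esub> \<gamma> n =
        ShM T ((\<alpha> \<circ> r) (t n)) \<cdot>\<^bsub>T\<^esub> (fsh F (sob (subsequence S r a) (t n)) \<cdot>\<^bsub>T\<^esub> fmor F (h n))"
      using triangle_completion[OF \<alpha> \<beta> f \<phi> v w d sq] by metis
    let ?a = "subsequence S t (subsequence S r a)" and ?b = "subsequence S t (subsequence S s b)"
    let ?\<alpha> = "\<alpha> \<circ> r \<circ> t" and ?\<beta> = "\<beta> \<circ> s \<circ> t"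
    note \<alpha>t = approx_subsequence[OF \<alpha> t] and \<beta>t = approx_subsequence[OF \<beta> t]
    have ft: "seq_map S ?a ?b (f \<circ> t)"
      using S.seq_map_subsequence[OF approxE(1)[OF \<alpha>] approxE(1)[OF \<beta>] f t] .
    have sqs: "\<phi> \<cdot>\<^bsub>T\<^esub> ?\<alpha> n = ?\<beta> n \<cdot>\<^bsub>T\<^esub> fmor F ((f \<circ> t) n)"
      "v \<cdot>\<^bsub>T\<^esub> ?\<beta> n = \<gamma> n \<cdot>\<^bsub>T\<^esub> fmor F (g n)"
      "w \<cdot>\<^bsub>T\<^esub> \<gamma> n = ShM T (?\<alpha> n) \<cdot>\<^bsub>T\<^esub> (fsh F (sob ?a n) \<cdot>\<^bsub>T\<^esub> fmor F (h n))" for n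
      using sq[of "t n"] sg[of n] sh[of n] by (simp_all add: subsequence_def)
    have tri: "is_Cauchy_triangles S M ?a ?b c (f \<circ> t) g h"
      unfolding is_Cauchy_triangles_def
      using approx_Cauchy[OF \<alpha>t] approx_Cauchy[OF \<beta>t] approx_Cauchy[OF \<gamma>] ft g h dist by simp
    have C: "C \<in> visible" using visible_cone[OF d \<phi> v w] A B Lprime_iff by blast
    have hoc: "\<exists>H \<kappa>. is_hocolim T (image_seq F c) H \<kappa>"
      using hocolim_exists[OF approx_Cauchy[OF \<gamma>]] by blast
    have iso: "\<exists>\<psi>. is_iso_mor T \<psi> H C \<and> (\<forall>n. \<psi> \<cdot>\<^bsub>T\<^esub> \<kappa> n = \<gamma> n) \<and>
        is_md_tri_iso S (ycolim_tri S ?a ?b c (f \<circ> t) g h) (ryon_tri S T F A B C \<phi> v w)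
          (nat_map T F ?\<alpha>) (nat_map T F ?\<beta>) (\<lambda>x m. ryon_map T \<psi> x (nat_map T F \<kappa> x m))"
      if H: "is_hocolim T (image_seq F c) H \<kappa>" for H \<kappa>
    proof -
      obtain \<psi> where \<psi>: "is_iso_mor T \<psi> H C" "\<forall>n. \<psi> \<cdot>\<^bsub>T\<^esub> \<kappa> n = \<gamma> n"
        using hocolim_comparison[OF \<gamma> C H] by blast
      then show ?thesis
        using strong_triangle_iso[OF \<alpha>t \<beta>t \<gamma> ft g h \<phi> v w sqs H] by blast
    qed
    show "\<exists>t c g h \<gamma>. strict_mono t \<and>
       (let a' = subsequence S t (subsequence S r a);
            b' = subsequence S t (subsequence S s b);
            f' = f \<circ> t; \<alpha>' = \<alpha> \<circ> r \<circ> t; \<beta>' = \<beta> \<circ> s \<circ> t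
        in is_Cauchy_triangles S M a' b' c f' g h \<and>
           seq_cocone T (image_seq F c) C \<gamma> \<and>
           (\<forall>n. \<phi> \<cdot>\<^bsub>T\<^esub> \<alpha>' n = \<beta>' n \<cdot>\<^bsub>T\<^esub> fmor F (f' n) \<and>
                v \<cdot>\<^bsub>T\<^esub> \<beta>' n = \<gamma> n \<cdot>\<^bsub>T\<^esub> fmor F (g n) \<and>
                w \<cdot>\<^bsub>T\<^esub> \<gamma> n =
                  ShM T (\<alpha>' n) \<cdot>\<^bsub>T\<^esub> (fsh F (sob a' n) \<cdot>\<^bsub>T\<^esub> fmor F (h n))) \<and>
           (\<exists>H \<kappa>. is_hocolim T (image_seq F c) H \<kappa>) \<and>
           (\<forall>H \<kappa>. is_hocolim T (image_seq F c) H \<kappa> \<longrightarrow>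
              (\<exists>\<psi>. is_iso_mor T \<psi> H C \<and> (\<forall>n. \<psi> \<cdot>\<^bsub>T\<^esub> \<kappa> n = \<gamma> n) \<and>
                 is_md_tri_iso S (ycolim_tri S a' b' c f' g h)
                   (ryon_tri S T F A B C \<phi> v w)
                   (nat_map T F \<alpha>') (nat_map T F \<beta>')
                   (\<lambda>x m. ryon_map T \<psi> x (nat_map T F \<kappa> x m)))))"
      unfolding Let_def
      by (intro exI[of _ t] exI[of _ c] exI[of _ g] exI[of _ h] exI[of _ \<gamma>] conjI allI impI)
        (rule t tri approxE(2)[OF \<gamma>] sqs hoc iso | assumption)+
  qed
qed

end
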